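(* Let $M$ be a finitely generated graded $S$-module and $d$ an integer. The truncated complex $$\mathbf R(M)_{\ge d}:\quad \operatorname{Hom}_K(E,M_d)\to\operatorname{Hom}_K(E,M_{d+1})\to\cdots$$ is acyclic (that is, has homology only at $\operatorname{Hom}_K(E,M_d)$) if and only if $M$ is $d$-regular.
   Context: $K$ is a field; $V$ and $W=V^*$ are dual $K$-vector spaces of finite dimension $v$, with $W$ in degree $1$ and $V$ in degree $-1$; $E=\bigwedge V$ and $S=\operatorname{Sym}(W)$ with induced gradings. $(e_i)$, $(x_i)$ are dual bases of $V$, $W$. For a graded vector space $D$, $\operatorname{Hom}_K(E,D)$ is a graded left $E$-module via $(f\alpha)(e)=\alpha(ef)$. For a graded $S$-module $M=\bigoplus M_d$, $\mathbf R(M)$ is the complex with $\operatorname{Hom}_K(E,M_d)$ in cohomological degree $d$ and differential $\operatorname{Hom}_K(E,M_d)\to\operatorname{Hom}_K(E,M_{d+1})$, $\alpha\mapsto[e\mapsto\sum_i x_i\alpha(e_ie)]$. The (Castelnuovo–Mumford) regularity of $M$ is the smallest integer $r$ such that $M_{\ge r}=\bigoplus_{i\ge r}M_i$ is generated by $M_r$ and has a linear free resolution (all maps in its minimal free resolution are represented by matrices of linear forms). $M$ is $d$-regular if its regularity is at most $d$. *)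

theory Defs
  imports "HOL-Algebra.Module" "HOL-Algebra.AbelCoset" "HOL-Library.Poly_Mapping"
    "HOL-Library.Extended_Real"
begin

text \<open>
  Throughout, \<open>K\<close> is a type \<open>'k\<close> of class \<^class>\<open>field\<close>, and the dual vector spaces \<open>V\<close> and
  \<open>W = V\<^sup>*\<close> of dimension \<open>v\<close> (possibly \<open>0\<close>) are given by dual bases \<open>(e\<^sub>i)\<close>, \<open>(x\<^sub>i)\<close> with
  \<open>i < v\<close>.
\<close>

section \<open>The symmetric algebra of W\<close>

type_synonym 'k pol = "(nat \<Rightarrow>\<^sub>0 nat) \<Rightarrow>\<^sub>0 'k"

text \<open>\<open>Sym(W)\<close> is the polynomial ring in \<open>x\<^sub>0, \<dots>, x\<^sub>v\<^sub>-\<^sub>1\<close>, a subring of the type of polynomials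
  in countably many variables.\<close>

definition Sym :: "nat \<Rightarrow> 'k::field pol ring" where
  "Sym v = \<lparr>carrier = {p. \<forall>t\<in>Poly_Mapping.keys p. Poly_Mapping.keys t \<subseteq> {..<v}},
            mult = (*), one = 1, zero = 0, add = (+)\<rparr>"

definition var :: "nat \<Rightarrow> 'k::field pol" where
  "var i = Poly_Mapping.single (Poly_Mapping.single i 1) 1"

definition const :: "'k \<Rightarrow> 'k::field pol" where
  "const c = Poly_Mapping.single 0 c"

definition mon_degree :: "(nat \<Rightarrow>\<^sub>0 nat) \<Rightarrow> nat" where
  "mon_degree t = (\<Sum>i\<in>Poly_Mapping.keys t. Poly_Mapping.lookup t i)"

lemma cring_Sym: "cring (Sym v)"
proof -
  have add: "p + q \<in> carrier (Sym v)" if "p \<in> carrier (Sym v)" "q \<in> carrier (Sym v)"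
    for p q :: "'a::field pol"
    using that Poly_Mapping.keys_add[of p q] by (fastforce simp: Sym_def)
  have mult: "p * q \<in> carrier (Sym v)" if "p \<in> carrier (Sym v)" "q \<in> carrier (Sym v)"
    for p q :: "'a::field pol"
  proof -
    have "Poly_Mapping.keys t \<subseteq> {..<v}" if "t \<in> Poly_Mapping.keys (p * q)" for t
    proof -
      from that obtain a b where "t = a + b" "a \<in> Poly_Mapping.keys p" "b \<in> Poly_Mapping.keys q"
        using Poly_Mapping.keys_mult[of p q] by blast
      with \<open>p \<in> _\<close> \<open>q \<in> _\<close> Poly_Mapping.keys_add[of a b] show ?thesis
        by (fastforce simp: Sym_def)
    qed
    then show ?thesis by (simp add: Sym_def)
  qed
  have uminus: "- p \<in> carrier (Sym v)" if "p \<in> carrier (Sym v)" for p :: "'a::field pol"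
    using that by (simp add: Sym_def)
  have ops: "p \<oplus>\<^bsub>Sym v\<^esub> q = p + q" "p \<otimes>\<^bsub>Sym v\<^esub> q = p * q" "\<zero>\<^bsub>Sym v\<^esub> = 0" "\<one>\<^bsub>Sym v\<^esub> = 1"
    for p q :: "'a::field pol"
    by (simp_all add: Sym_def)
  have zero: "(0 :: 'a pol) \<in> carrier (Sym v)" and one: "(1 :: 'a pol) \<in> carrier (Sym v)"
    by (simp_all add: Sym_def)
  show ?thesis
  proof (rule cringI)
    show "abelian_group (Sym v :: 'a pol ring)"
    proof (rule abelian_groupI)
      fix p :: "'a pol" assume "p \<in> carrier (Sym v)"
      then show "\<exists>q\<in>carrier (Sym v). q \<oplus>\<^bsub>Sym v\<^esub> p = \<zero>\<^bsub>Sym v\<^esub>"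
        by (intro bexI[of _ "- p"] uminus) (simp_all only: ops left_minus)
    qed (simp_all add: ops add zero ac_simps)
    show "comm_monoid (Sym v :: 'a pol ring)"
      by (rule comm_monoidI) (simp_all add: ops mult one ac_simps)
  qed (simp add: ops distrib_right)
qed

text \<open>The homogeneous component \<open>S\<^sub>d\<close>; it is \<open>0\<close> for negative \<open>d\<close>.\<close>

definition Sym_deg :: "nat \<Rightarrow> int \<Rightarrow> 'k::field pol set" where
  "Sym_deg v d = {p \<in> carrier (Sym v). \<forall>t\<in>Poly_Mapping.keys p. int (mon_degree t) = d}"

section \<open>The exterior algebra of V\<close>

text \<open>The basis element indexed by \<open>A = {a\<^sub>1 < \<dots> < a\<^sub>k}\<close> is \<open>e\<^sub>A = e\<^sub>a\<^sub>1 \<and> \<dots> \<and> e\<^sub>a\<^sub>k\<close>. If \<open>A\<close>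
  and \<open>B\<close> are disjoint, sorting \<open>e\<^sub>A \<and> e\<^sub>B\<close> gives \<open>e\<^sub>A\<^sub>\<union>\<^sub>B\<close> up to the sign of the number of
  inversions between \<open>A\<close> and \<open>B\<close>; otherwise the product vanishes.\<close>

type_synonym 'k ext = "nat set \<Rightarrow>\<^sub>0 'k"

definition Ext :: "nat \<Rightarrow> 'k::field ext set" where
  "Ext v = {e. Poly_Mapping.keys e \<subseteq> Pow {..<v}}"

definition ext_sign :: "nat set \<Rightarrow> nat set \<Rightarrow> 'k::field" where
  "ext_sign A B = (if A \<inter> B = {} then (-1) ^ card {(a, b). a \<in> A \<and> b \<in> B \<and> b < a} else 0)"

definition ext_mult :: "'k::field ext \<Rightarrow> 'k ext \<Rightarrow> 'k ext" (infixl \<open>\<and>\<^sub>E\<close> 70) where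
  "e \<and>\<^sub>E f = (\<Sum>A\<in>Poly_Mapping.keys e. \<Sum>B\<in>Poly_Mapping.keys f.
     Poly_Mapping.single (A \<union> B)
       (ext_sign A B * (Poly_Mapping.lookup e A * Poly_Mapping.lookup f B)))"

definition ext_scale :: "'k \<Rightarrow> 'k::field ext \<Rightarrow> 'k ext" where
  "ext_scale c e = Poly_Mapping.map ((*) c) e"

definition ext_gen :: "nat \<Rightarrow> 'k::field ext" where
  "ext_gen i = Poly_Mapping.single {i} 1"

lemma ext_gen_square: "ext_gen i \<and>\<^sub>E ext_gen i = (0 :: 'k::field ext)"
  by (simp add: ext_gen_def ext_mult_def ext_sign_def)

lemma ext_gen_anticommute: "ext_gen i \<and>\<^sub>E ext_gen j = - (ext_gen j \<and>\<^sub>E ext_gen i :: 'k::field ext)"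
proof (cases "i = j")
  case False
  have *: "{(a, b). a = i \<and> b = j \<and> b < a} = (if j < i then {(i, j)} else {})" for i j :: nat
    by auto
  from False show ?thesis
    by (auto simp: ext_gen_def ext_mult_def ext_sign_def * insert_commute single_uminus)
qed (simp add: ext_gen_square)

lemma ext_sign_assoc:
  assumes "finite A" "finite B" "finite C"
  shows "ext_sign A B * ext_sign (A \<union> B) C = (ext_sign B C * ext_sign A (B \<union> C) :: 'k::field)"
proof (cases "A \<inter> B = {} \<and> A \<inter> C = {} \<and> B \<inter> C = {}")
  case True
  let ?I = "\<lambda>A B :: nat set. {(a, b). a \<in> A \<and> b \<in> B \<and> b < a}"
  have fin: "finite (?I X Y)" if "finite X" "finite Y" for X Y
    by (rule finite_subset[of _ "X \<times> Y"]) (use that in auto)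
  have "card (?I (A \<union> B) C) = card (?I A C \<union> ?I B C)"
    by (rule arg_cong[of _ _ card]) auto
  also have "\<dots> = card (?I A C) + card (?I B C)"
    by (rule card_Un_disjoint) (use assms True fin in auto)
  finally have 1: "card (?I (A \<union> B) C) = card (?I A C) + card (?I B C)" .
  have "card (?I A (B \<union> C)) = card (?I A B \<union> ?I A C)"
    by (rule arg_cong[of _ _ card]) auto
  also have "\<dots> = card (?I A B) + card (?I A C)"
    by (rule card_Un_disjoint) (use assms True fin in auto)
  finally have 2: "card (?I A (B \<union> C)) = card (?I A B) + card (?I A C)" .
  from True have "(A \<union> B) \<inter> C = {}" "A \<inter> (B \<union> C) = {}" by auto
  then show ?thesis using True 1 2 by (simp add: ext_sign_def power_add)
next
  case False
  then show ?thesis by (auto simp: ext_sign_def)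
qed

section \<open>Graded modules\<close>

text \<open>\<open>gr j\<close> is \<open>M\<^sub>j\<close>; the axiom \<open>decomp\<close> says that \<open>M\<close> is the internal direct sum of the \<open>M\<^sub>j\<close>.\<close>

locale graded_module = Module.module "Sym v :: 'k::field pol ring" M for v and M (structure) +
  fixes gr :: "int \<Rightarrow> 'm set"
  assumes gr_subgroup: "subgroup (gr j) (add_monoid M)"
    and decomp: "x \<in> carrier M \<Longrightarrow>
      \<exists>!f. (\<forall>j. f j \<in> gr j) \<and> finite {j. f j \<noteq> \<zero>\<^bsub>M\<^esub>} \<and> x = finsum M f {j. f j \<noteq> \<zero>\<^bsub>M\<^esub>}"
    and smult_gr: "p \<in> Sym_deg v i \<Longrightarrow> x \<in> gr j \<Longrightarrow> p \<odot>\<^bsub>M\<^esub> x \<in> gr (i + j)"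

definition gen_submodule :: "('r, 'q) ring_scheme \<Rightarrow> ('r, 'm) module \<Rightarrow> 'm set \<Rightarrow> 'm set" where
  "gen_submodule R M A = \<Inter> {N. submodule N R M \<and> A \<subseteq> N}"

definition finitely_generated :: "('r, 'q) ring_scheme \<Rightarrow> ('r, 'm) module \<Rightarrow> bool" where
  "finitely_generated R M \<longleftrightarrow>
     (\<exists>A. finite A \<and> A \<subseteq> carrier M \<and> gen_submodule R M A = carrier M)"

definition trunc :: "('r, 'm) module \<Rightarrow> (int \<Rightarrow> 'm set) \<Rightarrow> int \<Rightarrow> ('r, 'm) module" where
  "trunc M gr r = M\<lparr>carrier :=
     {finsum M f I | f I. finite I \<and> I \<subseteq> {r..} \<and> (\<forall>i\<in>I. f i \<in> gr i)}\<rparr>"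

definition trunc_gr :: "('r, 'm) module \<Rightarrow> (int \<Rightarrow> 'm set) \<Rightarrow> int \<Rightarrow> int \<Rightarrow> 'm set" where
  "trunc_gr M gr r j = (if r \<le> j then gr j else {\<zero>\<^bsub>M\<^esub>})"

section \<open>The complex R(M)\<close>

text \<open>\<open>Hom\<^sub>K(E, D)\<close> for a \<open>K\<close>-subspace \<open>D\<close> of \<open>M\<close>, as a left \<open>E\<close>-module via
  \<open>(f \<alpha>)(e) = \<alpha>(e f)\<close>. Linear maps are normalised to be \<open>undefined\<close> outside of \<open>E\<close>.\<close>

definition Hom_E :: "nat \<Rightarrow> ('k::field pol, 'm) module \<Rightarrow> 'm set \<Rightarrow> ('k ext, 'k ext \<Rightarrow> 'm) module" where
  "Hom_E v M D = \<lparr>carrier = {\<alpha> \<in> Ext v \<rightarrow>\<^sub>E D.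
       (\<forall>e\<in>Ext v. \<forall>f\<in>Ext v. \<alpha> (e + f) = \<alpha> e \<oplus>\<^bsub>M\<^esub> \<alpha> f) \<and>
       (\<forall>c. \<forall>e\<in>Ext v. \<alpha> (ext_scale c e) = const c \<odot>\<^bsub>M\<^esub> \<alpha> e)},
     mult = undefined, one = undefined,
     zero = (\<lambda>e\<in>Ext v. \<zero>\<^bsub>M\<^esub>),
     add = (\<lambda>\<alpha> \<beta>. \<lambda>e\<in>Ext v. \<alpha> e \<oplus>\<^bsub>M\<^esub> \<beta> e),
     smult = (\<lambda>f \<alpha>. \<lambda>e\<in>Ext v. \<alpha> (e \<and>\<^sub>E f))\<rparr>"

definition R_diff :: "nat \<Rightarrow> ('k::field pol, 'm) module \<Rightarrow> ('k ext \<Rightarrow> 'm) \<Rightarrow> 'k ext \<Rightarrow> 'm" where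
  "R_diff v M \<alpha> = (\<lambda>e\<in>Ext v. \<Oplus>\<^bsub>M\<^esub>i\<in>{..<v}. var i \<odot>\<^bsub>M\<^esub> \<alpha> (ext_gen i \<and>\<^sub>E e))"

text \<open>The term in cohomological degree \<open>j\<close> of the truncation \<open>R(M)\<^sub>\<ge>\<^sub>d\<close>; it is \<open>0\<close> for \<open>j < d\<close>.
  The differential of the truncation is still \<^const>\<open>R_diff\<close>, which vanishes on \<open>0\<close>.\<close>

definition R_trunc :: "nat \<Rightarrow> ('k::field pol, 'm) module \<Rightarrow> (int \<Rightarrow> 'm set) \<Rightarrow> int \<Rightarrow> int \<Rightarrow>
    ('k ext, 'k ext \<Rightarrow> 'm) module" where
  "R_trunc v M gr d j = Hom_E v M (if d \<le> j then gr j else {\<zero>\<^bsub>M\<^esub>})"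

definition R_trunc_acyclic :: "nat \<Rightarrow> ('k::field pol, 'm) module \<Rightarrow> (int \<Rightarrow> 'm set) \<Rightarrow> int \<Rightarrow> bool" where
  "R_trunc_acyclic v M gr d \<longleftrightarrow> (\<forall>j. j \<noteq> d \<longrightarrow>
     a_kernel (R_trunc v M gr d j) (R_trunc v M gr d (j + 1)) (R_diff v M) =
     R_diff v M ` carrier (R_trunc v M gr d (j - 1)))"

section \<open>Minimal free resolutions and regularity\<close>

definition free_mod :: "nat \<Rightarrow> nat \<Rightarrow> ('k::field pol, nat \<Rightarrow> 'k pol) module" where
  "free_mod v n = \<lparr>carrier = {..<n} \<rightarrow>\<^sub>E carrier (Sym v),
     mult = undefined, one = undefined,
     zero = (\<lambda>k\<in>{..<n}. 0),
     add = (\<lambda>x y. \<lambda>k\<in>{..<n}. x k + y k),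
     smult = (\<lambda>p x. \<lambda>k\<in>{..<n}. p * x k)\<rparr>"

text \<open>The grading of \<open>S(-a\<^sub>0) \<oplus> \<dots> \<oplus> S(-a\<^sub>n\<^sub>-\<^sub>1)\<close>: the \<open>k\<close>-th basis vector has degree \<open>a\<^sub>k\<close>.\<close>

definition free_gr :: "nat \<Rightarrow> nat \<Rightarrow> (nat \<Rightarrow> int) \<Rightarrow> int \<Rightarrow> (nat \<Rightarrow> 'k::field pol) set" where
  "free_gr v n a j = (\<Pi>\<^sub>E k\<in>{..<n}. Sym_deg v (j - a k))"

definition unit_vec :: "nat \<Rightarrow> nat \<Rightarrow> nat \<Rightarrow> 'k::field pol" where
  "unit_vec n j = (\<lambda>k\<in>{..<n}. if k = j then 1 else 0)"

definition graded_hom :: "nat \<Rightarrow> ('k::field pol, 'm) module \<Rightarrow> (int \<Rightarrow> 'm set) \<Rightarrow>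
    ('k pol, 'n) module \<Rightarrow> (int \<Rightarrow> 'n set) \<Rightarrow> ('m \<Rightarrow> 'n) \<Rightarrow> bool" where
  "graded_hom v M grM N grN h \<longleftrightarrow> h \<in> carrier M \<rightarrow> carrier N \<and>
     (\<forall>x\<in>carrier M. \<forall>y\<in>carrier M. h (x \<oplus>\<^bsub>M\<^esub> y) = h x \<oplus>\<^bsub>N\<^esub> h y) \<and>
     (\<forall>p\<in>carrier (Sym v). \<forall>x\<in>carrier M. h (p \<odot>\<^bsub>M\<^esub> x) = p \<odot>\<^bsub>N\<^esub> h x) \<and>
     (\<forall>j. h ` grM j \<subseteq> grN j)"

text \<open>A minimal graded free resolution
  \<open>\<dots> \<rightarrow> F\<^sub>2 \<rightarrow> F\<^sub>1 \<rightarrow> F\<^sub>0 \<rightarrow> N \<rightarrow> 0\<close> with augmentation \<open>\<epsilon>\<close>, where \<open>F\<^sub>i\<close> has a basis of \<open>b i\<close> elements in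
  degrees \<open>a i 0, \<dots>, a i (b i - 1)\<close> and \<open>\<phi> i : F\<^sub>i\<^sub>+\<^sub>1 \<rightarrow> F\<^sub>i\<close>. Minimality is \<open>\<phi> i (F\<^sub>i\<^sub>+\<^sub>1) \<subseteq> (x\<^sub>0, \<dots>, x\<^sub>v\<^sub>-\<^sub>1) F\<^sub>i\<close>,
  i.e. all components of elements of the image have constant term \<open>0\<close>.\<close>

definition minimal_free_resolution :: "nat \<Rightarrow> ('k::field pol, 'm) module \<Rightarrow> (int \<Rightarrow> 'm set) \<Rightarrow>
    (nat \<Rightarrow> nat) \<Rightarrow> (nat \<Rightarrow> nat \<Rightarrow> int) \<Rightarrow> ((nat \<Rightarrow> 'k pol) \<Rightarrow> 'm) \<Rightarrow>
    (nat \<Rightarrow> (nat \<Rightarrow> 'k pol) \<Rightarrow> (nat \<Rightarrow> 'k pol)) \<Rightarrow> bool" where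
  "minimal_free_resolution v N grN b a \<epsilon> \<phi> \<longleftrightarrow>
     graded_hom v (free_mod v (b 0)) (free_gr v (b 0) (a 0)) N grN \<epsilon> \<and>
     (\<forall>i. graded_hom v (free_mod v (b (Suc i))) (free_gr v (b (Suc i)) (a (Suc i)))
            (free_mod v (b i)) (free_gr v (b i) (a i)) (\<phi> i)) \<and>
     \<epsilon> ` carrier (free_mod v (b 0)) = carrier N \<and>
     a_kernel (free_mod v (b 0)) N \<epsilon> = \<phi> 0 ` carrier (free_mod v (b 1)) \<and>
     (\<forall>i. a_kernel (free_mod v (b (Suc i))) (free_mod v (b i)) (\<phi> i) =
            \<phi> (Suc i) ` carrier (free_mod v (b (Suc (Suc i))))) \<and>
     (\<forall>i. \<forall>x\<in>carrier (free_mod v (b (Suc i))). \<forall>k<b i.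
            Poly_Mapping.lookup (\<phi> i x k) 0 = 0)"

definition has_linear_resolution :: "nat \<Rightarrow> ('k::field pol, 'm) module \<Rightarrow> (int \<Rightarrow> 'm set) \<Rightarrow> bool" where
  "has_linear_resolution v N grN \<longleftrightarrow> (\<exists>b a \<epsilon> \<phi>.
     minimal_free_resolution v N grN b a \<epsilon> \<phi> \<and>
     (\<forall>i. \<forall>j<b (Suc i). \<forall>k<b i. \<phi> i (unit_vec (b (Suc i)) j) k \<in> Sym_deg v 1))"

text \<open>The infimum is attained for finitely generated \<open>M \<noteq> 0\<close>; it is \<open>-\<infinity>\<close> for \<open>M = 0\<close>.\<close>

definition regularity :: "nat \<Rightarrow> ('k::field pol, 'm) module \<Rightarrow> (int \<Rightarrow> 'm set) \<Rightarrow> ereal" where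
  "regularity v M gr = Inf {ereal (of_int r) | r.
     gen_submodule (Sym v) (trunc M gr r) (gr r) = carrier (trunc M gr r) \<and>
     has_linear_resolution v (trunc M gr r) (trunc_gr M gr r)}"

lemma regularity_eqI:
  fixes v :: nat and M :: "('k::field pol, 'm) module" and gr :: "int \<Rightarrow> 'm set"
  defines "P \<equiv> \<lambda>r. gen_submodule (Sym v) (trunc M gr r) (gr r) = carrier (trunc M gr r) \<and>
     has_linear_resolution v (trunc M gr r) (trunc_gr M gr r)"
  assumes r: "P r" and least: "\<And>r'. P r' \<Longrightarrow> r \<le> r'"
  shows "regularity v M gr = ereal (of_int r)"
proof -
  have "regularity v M gr = Inf {ereal (of_int r) | r. P r}"
    unfolding regularity_def P_def ..
  also have "\<dots> = ereal (of_int r)"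
  proof (rule Inf_eqI)
    fix y assume "y \<in> {ereal (of_int r) | r. P r}"
    then obtain r' where "y = ereal (of_int r')" "P r'" by blast
    with least[of r'] show "ereal (of_int r) \<le> y" by simp
  next
    fix y assume "\<And>i. i \<in> {ereal (of_int r) | r. P r} \<Longrightarrow> y \<le> i"
    with r show "y \<le> ereal (of_int r)" by blast
  qed
  finally show ?thesis .
qed

definition is_regular :: "nat \<Rightarrow> ('k::field pol, 'm) module \<Rightarrow> (int \<Rightarrow> 'm set) \<Rightarrow> int \<Rightarrow> bool" where
  "is_regular v M gr d \<longleftrightarrow> regularity v M gr \<le> ereal (of_int d)"

end

theory Submission
  imports Defs
begin

text \<open>
  A \<open>K\<close>-linear map on \<open>E\<close> is a family of values on the basis \<open>(e\<^sub>A)\<close>, and on such families the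
  differential of \<open>\<^bold>R(M)\<close> is the Koszul differential of \<open>x\<^sub>0, \<dots>, x\<^sub>v\<^sub>-\<^sub>1\<close> on \<open>M\<close>. So \<open>\<^bold>R(M)\<^sub>\<ge>\<^sub>d\<close>
  is acyclic if and only if the Koszul complex of \<open>N = M\<^sub>\<ge>\<^sub>d\<close> is exact at \<open>N\<^sub>j\<close> for all \<open>j \<noteq> d\<close>
  (\<open>R_exact_iff_koszul_exact\<close>). This condition passes from \<open>d\<close> to every larger integer, because
  it only concerns the terms of \<open>\<^bold>R(M)\<close> in degrees \<open>\<ge> d\<close>, and \<open>M\<close> is \<open>d\<close>-regular if and only if
  some \<open>M\<^sub>\<ge>\<^sub>r\<close> with \<open>r \<le> d\<close> is generated in degree \<open>r\<close> and has a linear resolution. It remains to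
  show that, for one fixed \<open>d\<close>, exactness away from \<open>d\<close> means that \<open>M\<^sub>\<ge>\<^sub>d\<close> is generated in degree
  \<open>d\<close> and has a linear resolution.

  Both implications compare \<open>N\<close> with a free cover \<open>F = S(-d)\<^sup>n \<rightarrow> N\<close> and the syzygy module
  \<open>N' \<subseteq> F\<close>. The Koszul complex of \<open>F\<close> is exact away from degree \<open>d\<close>: on the coefficients of
  monomials there is an explicit contracting homotopy (\<open>koszul_homotopy\<close>, \<open>koszul_exact_free\<close>).

  From exactness to the resolution: exactness at \<open>N\<^sub>j\<close> for \<open>j > d\<close> implies \<open>N\<^sub>j = W N\<^sub>j\<^sub>-\<^sub>1\<close>, so that a
  \<open>K\<close>-basis of \<open>N\<^sub>d\<close> generates \<open>N\<close> (\<open>cover_generated_degree\<close>). For the cover given by this basis,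
  \<open>N'\<close> vanishes in degrees \<open>\<le> d\<close>, and chasing cocycles through \<open>0 \<rightarrow> N' \<rightarrow> F \<rightarrow> N \<rightarrow> 0\<close> shows that
  the Koszul complex of \<open>N'\<close> is exact away from \<open>d + 1\<close> (\<open>koszul_exact_kernel\<close>). The space \<open>N\<^sub>d\<close> is
  finite-dimensional because \<open>M\<close> is finitely generated, and \<open>N'\<^sub>d\<^sub>+\<^sub>1\<close> is because it lies in
  \<open>F\<^sub>d\<^sub>+\<^sub>1\<close>. Hence \<open>N'\<close> satisfies the same hypotheses with \<open>d + 1\<close> (\<open>linear_pieces_step\<close>), and
  iterating this step yields a linear resolution (\<open>exact_imp_linear_resolution\<close>).

  From the resolution to exactness: in a minimal linear resolution of a module generated in
  degree \<open>d\<close>, all generators of \<open>F\<^sub>i\<close> have degree \<open>d + i\<close>. The chase in the opposite direction reduces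
  exactness for \<open>N\<close> at degree \<open>j\<close> to exactness for \<open>N'\<close> at degree \<open>j + 1\<close>
  (\<open>koszul_exact_from_kernel\<close>). Since the Koszul differential lowers the size of the index sets
  \<open>A\<close> by one, a cocycle of \<open>N\<close> supported on \<open>|A| \<le> p\<close> only requires exactness of \<open>N'\<close> for cocycles
  supported on \<open>|A| < p\<close>. So an induction on \<open>p\<close>, simultaneously for all syzygy modules, proves
  exactness (\<open>linear_resolution_imp_exact\<close>).
\<close>

abbreviation "keys \<equiv> Poly_Mapping.keys"
abbreviation "lookup \<equiv> Poly_Mapping.lookup"
abbreviation "single \<equiv> Poly_Mapping.single"

section \<open>Polynomials and their homogeneous parts\<close>

lemma Sym_simps [simp]:
  "mult (Sym v) = (*)" "one (Sym v) = 1" "zero (Sym v) = 0" "add (Sym v) = (+)"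
  by (simp_all add: Sym_def)

lemma Sym_closed:
  fixes p q :: "'k::field pol"
  shows Sym_zero: "(0 :: 'k pol) \<in> carrier (Sym v)"
    and Sym_one: "(1 :: 'k pol) \<in> carrier (Sym v)"
    and Sym_add: "p \<in> carrier (Sym v) \<Longrightarrow> q \<in> carrier (Sym v) \<Longrightarrow> p + q \<in> carrier (Sym v)"
    and Sym_mult: "p \<in> carrier (Sym v) \<Longrightarrow> q \<in> carrier (Sym v) \<Longrightarrow> p * q \<in> carrier (Sym v)"
proof -
  interpret S: cring "Sym v :: 'k pol ring" by (rule cring_Sym)
  show "(0 :: 'k pol) \<in> carrier (Sym v)" "(1 :: 'k pol) \<in> carrier (Sym v)"
    "p \<in> carrier (Sym v) \<Longrightarrow> q \<in> carrier (Sym v) \<Longrightarrow> p + q \<in> carrier (Sym v)"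
    "p \<in> carrier (Sym v) \<Longrightarrow> q \<in> carrier (Sym v) \<Longrightarrow> p * q \<in> carrier (Sym v)"
    using S.zero_closed S.one_closed S.add.m_closed[of p q] S.m_closed[of p q] by simp_all
qed

lemma Sym_uminus: "p \<in> carrier (Sym v) \<Longrightarrow> - p \<in> carrier (Sym v)"
  by (simp add: Sym_def)

lemma keys_nat_add: "keys (s + t) = keys s \<union> keys t"
  for s t :: "nat \<Rightarrow>\<^sub>0 nat"
  by (auto simp: in_keys_iff lookup_add)

lemma mon_degree_eq_sum:
  assumes "finite X" "keys t \<subseteq> X"
  shows "mon_degree t = (\<Sum>i\<in>X. lookup t i)"
  unfolding mon_degree_def by (rule sum.mono_neutral_left) (use assms in \<open>auto simp: in_keys_iff\<close>)

lemma mon_degree_add: "mon_degree (s + t) = mon_degree s + mon_degree t"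
proof -
  let ?X = "keys s \<union> keys t"
  have "mon_degree (s + t) = (\<Sum>i\<in>?X. lookup (s + t) i)"
    by (rule mon_degree_eq_sum) (auto simp: keys_nat_add)
  also have "\<dots> = mon_degree s + mon_degree t"
    by (simp add: lookup_add sum.distrib mon_degree_eq_sum[of ?X])
  finally show ?thesis .
qed

lemma mon_degree_zero [simp]: "mon_degree 0 = 0"
  by (simp add: mon_degree_def)

lemma mon_degree_eq_0_iff: "mon_degree t = 0 \<longleftrightarrow> t = 0"
proof
  assume "mon_degree t = 0"
  then have "\<forall>i\<in>keys t. lookup t i = 0" by (simp add: mon_degree_def)
  then show "t = 0" by (auto simp: in_keys_iff intro!: poly_mapping_eqI)
qed simp

lemma finite_monomials: "finite {t. keys t \<subseteq> {..<v} \<and> int (mon_degree t) = j}"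
  (is "finite ?T")
proof (rule finite_imageD)
  let ?r = "\<lambda>t. restrict (lookup t) {..<v}"
  show "finite (?r ` ?T)"
  proof (rule finite_subset)
    show "?r ` ?T \<subseteq> {..<v} \<rightarrow>\<^sub>E {..nat j}"
    proof (rule image_subsetI)
      fix t assume t: "t \<in> ?T"
      have "lookup t i \<le> nat j" if "i < v" for i
      proof -
        have "lookup t i \<le> (\<Sum>i<v. lookup t i)"
          using that by (intro member_le_sum) auto
        also have "\<dots> = mon_degree t" using t by (subst mon_degree_eq_sum[of "{..<v}"]) auto
        finally show ?thesis using t by auto
      qed
      then show "?r t \<in> {..<v} \<rightarrow>\<^sub>E {..nat j}" by auto
    qed
    show "finite ({..<v} \<rightarrow>\<^sub>E {..nat j})" by (intro finite_PiE) auto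
  qed
  show "inj_on ?r ?T"
  proof (rule inj_onI)
    fix s t assume st: "s \<in> ?T" "t \<in> ?T" and eq: "?r s = ?r t"
    show "s = t"
    proof (rule poly_mapping_eqI)
      fix i
      show "lookup s i = lookup t i"
      proof (cases "i < v")
        case True
        then show ?thesis using fun_cong[OF eq, of i] by simp
      next
        case False
        then have "i \<notin> keys s" "i \<notin> keys t" using st by auto
        then show ?thesis by (simp add: in_keys_iff)
      qed
    qed
  qed
qed

lemma lookup_single_mult:
  fixes p :: "'k::field pol"
  shows "lookup (single a c * p) (a + s) = c * lookup p s"
  by (simp add: lookup_mult lookup_single when_mult)

lemma lookup_single_mult_other:
  fixes p :: "'k::field pol"
  assumes "\<And>q. s \<noteq> a + q"
  shows "lookup (single a c * p) s = 0"
  using assms by (simp add: lookup_mult lookup_single when_mult)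

lemma lookup_const_mult: "lookup (const c * p) s = c * lookup p s"
  using lookup_single_mult[of 0 c p s] by (simp add: const_def)

lemma single_add_diff:
  fixes s :: "nat \<Rightarrow>\<^sub>0 nat"
  assumes "i \<in> keys s"
  shows "s = single i 1 + (s - single i 1)"
  using assms by (intro poly_mapping_eqI) (auto simp: lookup_add lookup_minus lookup_single when_def in_keys_iff)

lemma lookup_var_mult:
  "lookup (var i * p) s =
     (if i \<in> keys s then lookup p (s - single i 1) else 0)"
proof (cases "i \<in> keys s")
  case True
  from lookup_single_mult[of "single i 1" 1 p "s - single i 1"] True
  show ?thesis using single_add_diff[OF True] by (simp add: var_def)
next
  case False
  have "s \<noteq> single i 1 + q" for q
    using False by (auto simp: keys_nat_add)
  then show ?thesis using False by (simp add: var_def lookup_single_mult_other)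
qed

text \<open>Polynomials without constant term form an ideal. This is how minimality of a resolution
  enters.\<close>

lemma lookup_mult_0:
  fixes p q :: "'k::field pol"
  assumes "lookup q 0 = 0"
  shows "lookup (p * q) 0 = 0"
proof (rule ccontr)
  assume "lookup (p * q) 0 \<noteq> 0"
  then have "0 \<in> keys (p * q)" by (simp add: in_keys_iff)
  then obtain a b where ab: "0 = a + b" "b \<in> keys q"
    using Poly_Mapping.keys_mult[of p q] by blast
  then have "keys b = {}" by (metis keys_nat_add keys_zero Un_empty)
  then show False using ab assms by (simp add: in_keys_iff)
qed

lemma Sym_deg_subset: "Sym_deg v j \<subseteq> carrier (Sym v)"
  by (auto simp: Sym_deg_def)

lemma Sym_degD: "p \<in> Sym_deg v j \<Longrightarrow> lookup p t \<noteq> 0 \<Longrightarrow> int (mon_degree t) = j"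
  by (auto simp: Sym_deg_def in_keys_iff)

lemma Sym_deg_zero [simp]: "0 \<in> Sym_deg v j"
  by (simp add: Sym_deg_def Sym_closed)

lemma Sym_deg_add: "p \<in> Sym_deg v j \<Longrightarrow> q \<in> Sym_deg v j \<Longrightarrow> p + q \<in> Sym_deg v j"
  using Poly_Mapping.keys_add[of p q] by (fastforce simp: Sym_deg_def Sym_closed)

lemma Sym_deg_uminus: "p \<in> Sym_deg v j \<Longrightarrow> - p \<in> Sym_deg v j"
  by (simp add: Sym_deg_def Sym_uminus)

lemma Sym_deg_mult: "p \<in> Sym_deg v i \<Longrightarrow> q \<in> Sym_deg v j \<Longrightarrow> p * q \<in> Sym_deg v (i + j)"
  using Poly_Mapping.keys_mult[of p q] by (fastforce simp: Sym_deg_def Sym_closed mon_degree_add)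

lemma Sym_deg_neg: "j < 0 \<Longrightarrow> p \<in> Sym_deg v j \<Longrightarrow> p = 0"
  by (fastforce simp: Sym_deg_def simp flip: keys_eq_empty)

lemma Sym_deg_unique: "p \<in> Sym_deg v i \<Longrightarrow> p \<in> Sym_deg v j \<Longrightarrow> p \<noteq> 0 \<Longrightarrow> i = j"
  by (fastforce simp: Sym_deg_def simp flip: keys_eq_empty)

lemma const_Sym_deg [simp]: "const c \<in> Sym_deg v 0"
  by (simp add: Sym_deg_def const_def Sym_def)

lemma var_Sym_deg: "i < v \<Longrightarrow> var i \<in> Sym_deg v 1"
  by (simp add: Sym_deg_def var_def Sym_def mon_degree_def)

lemma const_Sym [simp]: "const c \<in> carrier (Sym v)"
  using const_Sym_deg Sym_deg_subset by blast

lemma var_Sym: "i < v \<Longrightarrow> var i \<in> carrier (Sym v)"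
  using var_Sym_deg Sym_deg_subset by blast

lemma const_simps [simp]:
  "const 0 = 0" "const 1 = 1"
  by (simp_all add: const_def)

lemma const_mult: "const (c * d) = const c * const d"
  by (simp add: const_def mult_single)

lemma const_add: "const (c + d) = const c + const d"
  by (simp add: const_def single_add)

lemma const_uminus: "const (- c) = - const c"
  by (simp add: const_def single_uminus)

lift_definition pol_part :: "int \<Rightarrow> 'k::field pol \<Rightarrow> 'k pol" is
  "\<lambda>j p t. if int (mon_degree t) = j then p t else 0"
  by (rule finite_subset[rotated], assumption) auto

lemma lookup_pol_part:
  "lookup (pol_part j p) t = (if int (mon_degree t) = j then lookup p t else 0)"
  by transfer simp

lemma pol_part_Sym_deg: "p \<in> carrier (Sym v) \<Longrightarrow> pol_part j p \<in> Sym_deg v j"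
  by (auto simp: Sym_deg_def Sym_def in_keys_iff lookup_pol_part split: if_splits)

lemma sum_pol_part:
  assumes "finite J" "\<And>t. t \<in> keys p \<Longrightarrow> int (mon_degree t) + c \<in> J"
  shows "(\<Sum>j\<in>J. pol_part (j - c) p) = p"
proof (rule poly_mapping_eqI)
  fix t
  have "lookup (\<Sum>j\<in>J. pol_part (j - c) p) t =
      (\<Sum>j\<in>J. if int (mon_degree t) + c = j then lookup p t else 0)"
    unfolding lookup_sum lookup_pol_part by (rule sum.cong) auto
  also have "\<dots> = lookup p t"
    using assms by (auto simp: in_keys_iff)
  finally show "lookup (\<Sum>j\<in>J. pol_part (j - c) p) t = lookup p t" .
qed

section \<open>Signs in the exterior algebra\<close>

lemma ext_sign_single:
  "ext_sign {i} A = (if i \<in> A then 0 else (-1) ^ card {b\<in>A. b < i} :: 'k::field)"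
proof -
  have "{(a, b). a \<in> {i} \<and> b \<in> A \<and> b < a} = Pair i ` {b\<in>A. b < i}" by auto
  then show ?thesis by (simp add: ext_sign_def card_image inj_on_def)
qed

lemma ext_sign_swap: "ext_sign {i} {k} = - (ext_sign {k} {i} :: 'k::field)"
proof -
  have *: "card {b \<in> {x}. b < y} = (if x < y then 1 else 0)" for x y :: nat
    by (cases "x < y") (auto simp: card_1_singleton_iff)
  show ?thesis unfolding ext_sign_single * by auto
qed

text \<open>Associativity of the exterior product moves both signs to \<open>e\<^sub>i \<and> e\<^sub>k = - e\<^sub>k \<and> e\<^sub>i\<close>. This
  antisymmetry makes the square of the Koszul differential vanish.\<close>

lemma ext_sign_insert_antisym:
  assumes "finite A"
  shows "ext_sign {i} A * ext_sign {k} (insert i A) =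
    - (ext_sign {k} A * ext_sign {i} (insert k A) :: 'k::field)"
proof -
  have "ext_sign {i} A * (ext_sign {k} (insert i A) :: 'k) = ext_sign {k} {i} * ext_sign {k, i} A"
    "ext_sign {k} A * (ext_sign {i} (insert k A) :: 'k) = ext_sign {i} {k} * ext_sign {k, i} A"
    using ext_sign_assoc[of "{k}" "{i}" A, where ?'k = 'k] ext_sign_assoc[of "{i}" "{k}" A, where ?'k = 'k] assms
    by (simp_all add: insert_commute)
  then show ?thesis by (simp only: ext_sign_swap[of i k, where ?'k = 'k] mult_minus_left minus_minus)
qed

lemma ext_sign_insert_self [simp]: "ext_sign {i} (insert i A) = 0"
  by (simp add: ext_sign_single)

lemma ext_sign_below: "\<forall>b\<in>A. a < b \<Longrightarrow> ext_sign {a} A = 1"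
proof -
  assume a: "\<forall>b\<in>A. a < b"
  then have "card {b\<in>A. b < a} = 0" "a \<notin> A" by auto
  then show ?thesis unfolding ext_sign_single by (simp only: if_False power_0)
qed

text \<open>Deleting \<open>a\<close> from \<open>A\<close> removes exactly one inversion with \<open>i\<close>, namely the pair \<open>(i, a)\<close>.\<close>

lemma ext_sign_remove_smaller:
  assumes "finite A" "a \<in> A" "a < i"
  shows "ext_sign {i} A = - (ext_sign {i} (A - {a}) :: 'k::field)"
proof -
  have "{b\<in>A. b < i} = insert a {b\<in>A - {a}. b < i}" using assms by auto
  then have "card {b\<in>A. b < i} = Suc (card {b\<in>A - {a}. b < i})" using assms by simp
  then show ?thesis unfolding ext_sign_single using assms by auto
qed

section \<open>Sums in abelian groups\<close>

lemma (in abelian_group) subgroup_a_inv: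
  "subgroup H (add_monoid G) \<Longrightarrow> x \<in> H \<Longrightarrow> \<ominus> x \<in> H"
  using subgroup.m_inv_closed[of H "add_monoid G" x] by (simp add: a_inv_def)

lemma (in abelian_group) minus_eq_zero_iff:
  assumes "x \<in> carrier G" "y \<in> carrier G"
  shows "x \<ominus> y = \<zero> \<longleftrightarrow> x = y"
  using assms minus_equality[of x "\<ominus> y"] by (auto simp: a_minus_def r_neg)

lemma (in abelian_group) diff_zero_right: "x \<in> carrier G \<Longrightarrow> x \<ominus> \<zero> = x"
  using r_neg[of \<zero>] by (simp add: a_minus_def)

lemma (in abelian_group) finsum_in_closed:
  assumes H: "H \<subseteq> carrier G" "\<zero> \<in> H" "\<And>x y. x \<in> H \<Longrightarrow> y \<in> H \<Longrightarrow> x \<oplus> y \<in> H"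
    and f: "\<And>i. i \<in> I \<Longrightarrow> f i \<in> H"
  shows "finsum G f I \<in> H"
proof (cases "finite I")
  case True
  then show ?thesis using f
  proof (induction I rule: finite_induct)
    case empty
    show ?case using H by simp
  next
    case (insert i I)
    have "f ` insert i I \<subseteq> carrier G"
      using insert.prems H by auto
    then have "finsum G f (insert i I) = f i \<oplus> finsum G f I"
      using insert.hyps by (intro finsum_insert) auto
    then show ?case using H(3)[of "f i" "finsum G f I"] insert by simp
  qed
next
  case False
  then show ?thesis using H by (simp add: finsum_infinite)
qed

lemma (in abelian_group) finsum_in_subgroup:
  assumes H: "subgroup H (add_monoid G)" and f: "\<And>i. i \<in> I \<Longrightarrow> f i \<in> H"
  shows "finsum G f I \<in> H"
proof (rule finsum_in_closed[OF _ _ _ f])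
  show "H \<subseteq> carrier G" "\<zero> \<in> H" using subgroup.subset[OF H] subgroup.one_closed[OF H] by auto
  show "x \<oplus> y \<in> H" if "x \<in> H" "y \<in> H" for x y using subgroup.m_closed[OF H that] by simp
qed

lemma (in abelian_group) finsum_diff:
  assumes "f \<in> I \<rightarrow> carrier G" "g \<in> I \<rightarrow> carrier G"
  shows "finsum G (\<lambda>i. f i \<ominus> g i) I = finsum G f I \<ominus> finsum G g I"
proof (cases "finite I")
  case True
  then show ?thesis using assms
  proof (induction I rule: finite_induct)
    case empty
    from r_neg[of \<zero>] have "\<ominus> \<zero> = \<zero>" by simp
    then show ?case by (simp add: a_minus_def del: add.inv_eq_1_iff)
  next
    case (insert i I)
    have c: "f \<in> I \<rightarrow> carrier G" "g \<in> I \<rightarrow> carrier G" "f i \<in> carrier G" "g i \<in> carrier G"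
      using insert.prems by auto
    then have s: "finsum G f I \<in> carrier G" "finsum G g I \<in> carrier G" by auto
    have d: "(\<lambda>i. f i \<ominus> g i) \<in> I \<rightarrow> carrier G" using c by auto
    show ?case
      using insert.hyps c s d insert.IH by (simp add: a_minus_def minus_add a_ac)
  qed
next
  case False
  from r_neg[of \<zero>] have "\<ominus> \<zero> = \<zero>" by simp
  with False show ?thesis by (simp add: finsum_infinite a_minus_def del: add.inv_eq_1_iff)
qed

text \<open>The terms at \<open>(i, k)\<close> and \<open>(k, i)\<close> cancel. The diagonal needs its own hypothesis because
  \<open>f i i = - f i i\<close> says nothing in characteristic \<open>2\<close>.\<close>

lemma (in abelian_group) finsum_antisym:
  assumes f: "\<And>i k. f i k \<in> carrier G"
    and antisym: "\<And>i k. f i k = \<ominus> f k i" and diag: "\<And>i. f i i = \<zero>"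
  shows "(\<Oplus>i\<in>{..<n::nat}. \<Oplus>k\<in>{..<n}. f i k) = \<zero>"
proof (induction n)
  case 0
  show ?case by simp
next
  case (Suc n)
  have sum: "(\<Oplus>k\<in>{..<Suc n}. g k) = g n \<oplus> (\<Oplus>k\<in>{..<n}. g k)"
    if "\<And>k. g k \<in> carrier G" for g
    using that by (simp add: lessThan_Suc)
  let ?a = "\<Oplus>k\<in>{..<n}. f n k" and ?b = "\<Oplus>i\<in>{..<n}. f i n"
  have neg: "?b = \<ominus> ?a"
  proof -
    have "?a \<oplus> ?b = (\<Oplus>k\<in>{..<n}. f n k \<oplus> f k n)"
      using f by (simp add: finsum_addf)
    also have "\<dots> = (\<Oplus>k\<in>{..<n}. \<zero>)"
    proof (rule finsum_cong')
      show "f n k \<oplus> f k n = \<zero>" for k using antisym[of k n] f[of n k] by (simp add: r_neg)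
    qed auto
    finally have "?b \<oplus> ?a = \<zero>" using f by (simp add: a_comm)
    then show ?thesis using f by (intro minus_equality[symmetric]) auto
  qed
  have "(\<Oplus>i\<in>{..<Suc n}. \<Oplus>k\<in>{..<Suc n}. f i k) =
      (\<Oplus>k\<in>{..<Suc n}. f n k) \<oplus> (\<Oplus>i\<in>{..<n}. \<Oplus>k\<in>{..<Suc n}. f i k)"
    using f by (intro sum) auto
  also have "\<dots> = (f n n \<oplus> ?a) \<oplus> (\<Oplus>i\<in>{..<n}. f i n \<oplus> (\<Oplus>k\<in>{..<n}. f i k))"
    using f by (simp add: sum)
  also have "\<dots> = ?a \<oplus> (?b \<oplus> (\<Oplus>i\<in>{..<n}. \<Oplus>k\<in>{..<n}. f i k))"
    using f by (simp add: diag finsum_addf)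
  also have "\<dots> = \<zero>" using f neg by (simp add: Suc.IH r_neg)
  finally show ?case .
qed

section \<open>The Koszul differential\<close>

text \<open>A family of independent homogeneous subgroups that need not exhaust the module. In this way a
  graded module, its truncations and the syzygies inside a free module are all described by the
  operations of one ambient module together with a family of subsets.\<close>

locale graded_pieces = Module.module "Sym v :: 'k::field pol ring" M
  for v and M :: "('k::field pol, 'm) module" (structure) +
  fixes G :: "int \<Rightarrow> 'm set"
  assumes G_subgroup: "subgroup (G j) (add_monoid M)"
    and G_smult: "p \<in> Sym_deg v i \<Longrightarrow> x \<in> G j \<Longrightarrow> p \<odot>\<^bsub>M\<^esub> x \<in> G (i + j)"
    and G_direct: "finite I \<Longrightarrow> (\<And>i. i \<in> I \<Longrightarrow> f i \<in> G i) \<Longrightarrow> finsum M f I = \<zero>\<^bsub>M\<^esub> \<Longrightarrow> i \<in> I \<Longrightarrow> f i = \<zero>\<^bsub>M\<^esub>"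

text \<open>If \<open>c A\<close> is the value of a linear map \<open>\<alpha>\<close> on \<open>e\<^sub>A\<close>, then this is the value of its image under
  the differential of \<open>\<^bold>R(M)\<close> on \<open>e\<^sub>A\<close>, since \<open>e\<^sub>i \<and> e\<^sub>A\<close> is \<open>e\<^bsub>A \<union> {i}\<^esub>\<close> times \<^term>\<open>ext_sign {i} A\<close>.
  The sign is \<open>0\<close> for \<open>i \<in> A\<close>, so the sum can run over all \<open>i\<close>.\<close>

definition koszul :: "nat \<Rightarrow> ('k::field pol, 'm) module \<Rightarrow> (nat set \<Rightarrow> 'm) \<Rightarrow> nat set \<Rightarrow> 'm" where
  "koszul v M c A = (\<Oplus>\<^bsub>M\<^esub>i\<in>{..<v}. (const (ext_sign {i} A) * var i) \<odot>\<^bsub>M\<^esub> c (insert i A))"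

definition cochains :: "nat \<Rightarrow> 'm set \<Rightarrow> (nat set \<Rightarrow> 'm) set" where
  "cochains v D = {c. \<forall>A\<subseteq>{..<v}. c A \<in> D}"

text \<open>Exactness at degree \<open>j\<close> for cocycles that are supported on index sets with fewer than \<open>p\<close>
  elements. Index sets have at most \<open>v\<close> elements, so exactness in the usual sense is this property
  for all \<open>p\<close>; the bound serves as an induction parameter.\<close>

definition koszul_exact :: "nat \<Rightarrow> ('k::field pol, 'm) module \<Rightarrow> (int \<Rightarrow> 'm set) \<Rightarrow> nat \<Rightarrow> int \<Rightarrow> bool" where
  "koszul_exact v M G p j \<longleftrightarrow> (\<forall>c\<in>cochains v (G j).
     (\<forall>A\<subseteq>{..<v}. koszul v M c A = \<zero>\<^bsub>M\<^esub>) \<and> (\<forall>A\<subseteq>{..<v}. p \<le> card A \<longrightarrow> c A = \<zero>\<^bsub>M\<^esub>) \<longrightarrow>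
     (\<exists>b\<in>cochains v (G (j - 1)). \<forall>A\<subseteq>{..<v}. c A = koszul v M b A))"

lemma koszul_exactD:
  assumes ex: "koszul_exact v M G p j" and c: "c \<in> cochains v (G j)"
    and cycle: "\<And>A. A \<subseteq> {..<v} \<Longrightarrow> koszul v M c A = \<zero>\<^bsub>M\<^esub>"
    and supp: "\<And>A. A \<subseteq> {..<v} \<Longrightarrow> p \<le> card A \<Longrightarrow> c A = \<zero>\<^bsub>M\<^esub>"
  obtains b where "b \<in> cochains v (G (j - 1))" "\<And>A. A \<subseteq> {..<v} \<Longrightarrow> c A = koszul v M b A"
proof -
  have "\<exists>b\<in>cochains v (G (j - 1)). \<forall>A\<subseteq>{..<v}. c A = koszul v M b A"
    using ex[unfolded koszul_exact_def, rule_format, OF c] cycle supp by simp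
  then show thesis using that by auto
qed

lemma koszul_exact_allD:
  assumes ex: "\<And>p. koszul_exact v M G p j" and c: "c \<in> cochains v (G j)"
    and cycle: "\<And>A. A \<subseteq> {..<v} \<Longrightarrow> koszul v M c A = \<zero>\<^bsub>M\<^esub>"
  obtains b where "b \<in> cochains v (G (j - 1))" "\<And>A. A \<subseteq> {..<v} \<Longrightarrow> c A = koszul v M b A"
proof (rule koszul_exactD[OF ex[of "Suc v"] c cycle _ that])
  fix A :: "nat set" assume "A \<subseteq> {..<v}" "Suc v \<le> card A"
  then show "c A = \<zero>\<^bsub>M\<^esub>" using card_mono[of "{..<v}" A] by simp
qed

lemma signed_var_Sym_deg: "i < v \<Longrightarrow> const c * var i \<in> Sym_deg v 1"
  using Sym_deg_mult[of "const c" v 0 "var i" 1] by (simp add: var_Sym_deg)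

lemma signed_var_Sym: "i < v \<Longrightarrow> const c * var i \<in> carrier (Sym v)"
  using signed_var_Sym_deg Sym_deg_subset by blast

lemma graded_homD:
  assumes "graded_hom v M grM N grN h"
  shows "x \<in> carrier M \<Longrightarrow> h x \<in> carrier N"
    and "x \<in> carrier M \<Longrightarrow> y \<in> carrier M \<Longrightarrow> h (x \<oplus>\<^bsub>M\<^esub> y) = h x \<oplus>\<^bsub>N\<^esub> h y"
    and "p \<in> carrier (Sym v) \<Longrightarrow> x \<in> carrier M \<Longrightarrow> h (p \<odot>\<^bsub>M\<^esub> x) = p \<odot>\<^bsub>N\<^esub> h x"
    and "x \<in> grM j \<Longrightarrow> h x \<in> grN j"
  using assms by (auto simp: graded_hom_def image_subset_iff)

lemma graded_hom_finsum:
  assumes "abelian_group M" "abelian_group N" and h: "graded_hom v M grM N grN h"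
    and f: "f \<in> I \<rightarrow> carrier M"
  shows "h (finsum M f I) = finsum N (\<lambda>i. h (f i)) I"
proof -
  interpret M: abelian_group M by fact
  interpret N: abelian_group N by fact
  have car: "h x \<in> carrier N" if "x \<in> carrier M" for x
    using h that by (auto simp: graded_hom_def)
  have add: "h (x \<oplus>\<^bsub>M\<^esub> y) = h x \<oplus>\<^bsub>N\<^esub> h y" if "x \<in> carrier M" "y \<in> carrier M" for x y
    using h that by (auto simp: graded_hom_def)
  have zero: "h \<zero>\<^bsub>M\<^esub> = \<zero>\<^bsub>N\<^esub>"
    using add[of "\<zero>\<^bsub>M\<^esub>" "\<zero>\<^bsub>M\<^esub>"] car[of "\<zero>\<^bsub>M\<^esub>"] by (simp add: N.add.l_cancel_one)
  show ?thesis
  proof (cases "finite I")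
    case True
    then show ?thesis using f
    proof (induction I rule: finite_induct)
      case (insert i I)
      then have "(\<lambda>i. h (f i)) \<in> I \<rightarrow> carrier N" "h (f i) \<in> carrier N" by (auto intro!: car)
      with insert show ?case by (auto simp: add)
    qed (simp add: zero)
  next
    case False
    then show ?thesis by (simp add: M.finsum_infinite N.finsum_infinite zero)
  qed
qed

lemma
  assumes "abelian_group M" "abelian_group N" and h: "graded_hom v M grM N grN h"
  shows graded_hom_zero: "h \<zero>\<^bsub>M\<^esub> = \<zero>\<^bsub>N\<^esub>"
    and graded_hom_a_inv: "x \<in> carrier M \<Longrightarrow> h (\<ominus>\<^bsub>M\<^esub> x) = \<ominus>\<^bsub>N\<^esub> h x"
    and graded_hom_minus: "x \<in> carrier M \<Longrightarrow> y \<in> carrier M \<Longrightarrow> h (x \<ominus>\<^bsub>M\<^esub> y) = h x \<ominus>\<^bsub>N\<^esub> h y"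
proof -
  interpret M: abelian_group M by fact
  interpret N: abelian_group N by fact
  show zero: "h \<zero>\<^bsub>M\<^esub> = \<zero>\<^bsub>N\<^esub>"
    using graded_hom_finsum[OF assms, of "\<lambda>_. \<zero>\<^bsub>M\<^esub>" "{}"] by simp
  have car: "h x \<in> carrier N" if "x \<in> carrier M" for x
    using h that by (auto simp: graded_hom_def)
  have add: "h (x \<oplus>\<^bsub>M\<^esub> y) = h x \<oplus>\<^bsub>N\<^esub> h y" if "x \<in> carrier M" "y \<in> carrier M" for x y
    using h that by (auto simp: graded_hom_def)
  show inv: "h (\<ominus>\<^bsub>M\<^esub> x) = \<ominus>\<^bsub>N\<^esub> h x" if "x \<in> carrier M" for x
    using that add[of "\<ominus>\<^bsub>M\<^esub> x" x]
    by (intro N.minus_equality[symmetric]) (auto simp: zero car M.l_neg)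
  show "h (x \<ominus>\<^bsub>M\<^esub> y) = h x \<ominus>\<^bsub>N\<^esub> h y" if "x \<in> carrier M" "y \<in> carrier M"
    using that by (simp add: a_minus_def add inv)
qed

lemma cochainsD: "c \<in> cochains v D \<Longrightarrow> A \<subseteq> {..<v} \<Longrightarrow> c A \<in> D"
  by (simp add: cochains_def)

lemma cochains_mono: "c \<in> cochains v D \<Longrightarrow> D \<subseteq> D' \<Longrightarrow> c \<in> cochains v D'"
  by (auto simp: cochains_def)

context
  fixes v and M :: "('k::field pol, 'm) module" (structure)
  assumes M: "Module.module (Sym v) M"
begin

interpretation Module.module "Sym v" M by (fact M)

lemma koszul_term_closed:
  "c \<in> cochains v (carrier M) \<Longrightarrow> A \<subseteq> {..<v} \<Longrightarrow> i < v \<Longrightarrow> (const s * var i) \<odot> c (insert i A) \<in> carrier M"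
  by (intro smult_closed signed_var_Sym) (auto intro: cochainsD)

lemma koszul_closed:
  "c \<in> cochains v (carrier M) \<Longrightarrow> A \<subseteq> {..<v} \<Longrightarrow> koszul v M c A \<in> carrier M"
  unfolding koszul_def by (intro finsum_closed) (auto intro: koszul_term_closed)

lemma koszul_cong:
  assumes "c \<in> cochains v (carrier M)" "\<And>A. A \<subseteq> {..<v} \<Longrightarrow> b A = c A" "A \<subseteq> {..<v}"
  shows "koszul v M b A = koszul v M c A"
  unfolding koszul_def
  by (rule finsum_cong') (use assms in \<open>auto intro: koszul_term_closed\<close>)

lemma koszul_diff:
  assumes "c \<in> cochains v (carrier M)" "b \<in> cochains v (carrier M)" "A \<subseteq> {..<v}"
  shows "koszul v M (\<lambda>A. c A \<ominus> b A) A = koszul v M c A \<ominus> koszul v M b A"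
proof -
  have "koszul v M (\<lambda>A. c A \<ominus> b A) A = (\<Oplus>i\<in>{..<v}. (const (ext_sign {i} A) * var i) \<odot> c (insert i A) \<ominus>
      (const (ext_sign {i} A) * var i) \<odot> b (insert i A))"
    unfolding koszul_def
  proof (rule finsum_cong')
    fix i assume "i \<in> {..<v}"
    with assms cochainsD[of c v _ "insert i A"] cochainsD[of b v _ "insert i A"]
    show "(const (ext_sign {i} A) * var i) \<odot> (c (insert i A) \<ominus> b (insert i A)) =
        (const (ext_sign {i} A) * var i) \<odot> c (insert i A) \<ominus> (const (ext_sign {i} A) * var i) \<odot> b (insert i A)"
      by (simp add: a_minus_def smult_r_distr smult_r_minus signed_var_Sym)
  qed (use assms in \<open>auto intro: koszul_term_closed\<close>)
  also have "\<dots> = koszul v M c A \<ominus> koszul v M b A"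
    unfolding koszul_def by (rule finsum_diff) (use assms in \<open>auto intro: koszul_term_closed\<close>)
  finally show ?thesis .
qed

lemma koszul_zero:
  assumes "\<And>i. i < v \<Longrightarrow> i \<notin> A \<Longrightarrow> c (insert i A) = \<zero>" "c \<in> cochains v (carrier M)" "A \<subseteq> {..<v}"
  shows "koszul v M c A = \<zero>"
proof -
  have "koszul v M c A = (\<Oplus>i\<in>{..<v}. \<zero>)"
    unfolding koszul_def
  proof (rule finsum_cong')
    fix i assume i: "i \<in> {..<v}"
    show "(const (ext_sign {i} A) * var i) \<odot> c (insert i A) = \<zero>"
    proof (cases "i \<in> A")
      case True
      then show ?thesis
        using i assms cochainsD[of c v _ "insert i A"] smult_l_null[of "c (insert i A)"]
        by (simp add: ext_sign_single)
    next
      case False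
      then show ?thesis using i assms smult_r_null[OF signed_var_Sym] by simp
    qed
  qed auto
  then show ?thesis by simp
qed

text \<open>The square of the differential is a double sum over \<open>(i, k)\<close> in which \<open>x\<^sub>i x\<^sub>k\<close> is symmetric and the
  sign is antisymmetric.\<close>

lemma koszul_koszul:
  assumes c: "c \<in> cochains v (carrier M)" and A: "A \<subseteq> {..<v}"
  shows "koszul v M (koszul v M c) A = \<zero>"
proof -
  define f where "f i k = (if i < v \<and> k < v then
      (const (ext_sign {i} A * ext_sign {k} (insert i A)) * (var i * var k)) \<odot> c (insert k (insert i A))
      else \<zero>)" for i k
  have fin: "finite A" using A finite_subset by blast
  have Sym: "const s * (var i * var k) \<in> carrier (Sym v)" if "i < v" "k < v" for s :: 'k and i k
    using that by (intro Sym_mult const_Sym var_Sym)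
  have f: "f i k \<in> carrier M" for i k
    unfolding f_def using A by (auto intro!: smult_closed Sym cochainsD[OF c])
  have antisym: "f i k = \<ominus> f k i" for i k
  proof (cases "i < v \<and> k < v")
    case True
    have sign: "const (ext_sign {i} A * ext_sign {k} (insert i A)) =
        - (const (ext_sign {k} A * ext_sign {i} (insert k A)) :: 'k pol)"
      by (subst ext_sign_insert_antisym[OF fin]) (rule const_uminus)
    have "f i k = (- (const (ext_sign {k} A * ext_sign {i} (insert k A)) * (var k * var i)))
        \<odot> c (insert i (insert k A))"
      unfolding f_def
      by (simp only: sign mult_minus_left mult.commute[of "var i" "var k"] insert_commute[of i k] True if_True simp_thms)
    also have "\<dots> = \<ominus> f k i"
    proof -
      let ?p = "const (ext_sign {k} A * ext_sign {i} (insert k A)) * (var k * var i) :: 'k pol"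
      have "?p \<in> carrier (Sym v)" using True Sym by blast
      then have "\<ominus>\<^bsub>Sym v\<^esub> ?p = - ?p"
        by (intro R.minus_equality) (auto intro: Sym_uminus)
      moreover have "c (insert i (insert k A)) \<in> carrier M" using True A by (auto intro!: cochainsD[OF c])
      ultimately show ?thesis unfolding f_def
        using True smult_l_minus[of ?p "c (insert i (insert k A))"] Sym by simp
    qed
    finally show ?thesis .
  next
    case False
    from r_neg[of \<zero>] have "\<ominus> \<zero> = \<zero>" by simp
    with False show ?thesis unfolding f_def by (auto simp del: add.inv_eq_1_iff)
  qed
  have diag: "f i i = \<zero>" for i
    unfolding f_def using c A smult_l_null[of "c (insert i A)"] by (auto simp: cochains_def)
  have "koszul v M (koszul v M c) A = (\<Oplus>i\<in>{..<v}. \<Oplus>k\<in>{..<v}. f i k)"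
    unfolding koszul_def[of v M "koszul v M c"]
  proof (rule finsum_cong')
    fix i assume i: "i \<in> {..<v}"
    let ?s = "const (ext_sign {i} A) * var i :: 'k pol"
    have "?s \<odot> koszul v M c (insert i A) =
        (\<Oplus>k\<in>{..<v}. ?s \<odot> ((const (ext_sign {k} (insert i A)) * var k) \<odot> c (insert k (insert i A))))"
      unfolding koszul_def
      using i c A by (intro finsum_smult_ldistr) (auto intro!: koszul_term_closed signed_var_Sym)
    also have "\<dots> = (\<Oplus>k\<in>{..<v}. f i k)"
    proof (rule finsum_cong')
      fix k assume k: "k \<in> {..<v}"
      let ?t = "const (ext_sign {k} (insert i A)) * var k :: 'k pol"
      have "c (insert k (insert i A)) \<in> carrier M" using i k A by (auto intro!: cochainsD[OF c])
      then have "?s \<odot> (?t \<odot> c (insert k (insert i A))) = (?s * ?t) \<odot> c (insert k (insert i A))"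
        using i k smult_assoc1[of ?s ?t] by (simp add: signed_var_Sym)
      also have "?s * ?t = const (ext_sign {i} A * ext_sign {k} (insert i A)) * (var i * var k)"
        by (simp add: const_mult algebra_simps)
      finally show "?s \<odot> (?t \<odot> c (insert k (insert i A))) = f i k"
        using i k by (simp add: f_def)
    qed (use f in auto)
    finally show "?s \<odot> koszul v M c (insert i A) = (\<Oplus>k\<in>{..<v}. f i k)" .
  qed (use f in auto)
  also have "\<dots> = \<zero>" by (rule finsum_antisym[OF f antisym diag])
  finally show ?thesis .
qed

end

lemma graded_hom_koszul:
  fixes M :: "('k::field pol, 'm) module" and N :: "('k pol, 'n) module"
  assumes "Module.module (Sym v) M" "Module.module (Sym v) N" and h: "graded_hom v M grM N grN h"
    and c: "c \<in> cochains v (carrier M)" and A: "A \<subseteq> {..<v}"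
  shows "h (koszul v M c A) = koszul v N (\<lambda>A. h (c A)) A"
proof -
  interpret M: Module.module "Sym v" M by fact
  interpret N: Module.module "Sym v" N by fact
  have "h (koszul v M c A) =
      (\<Oplus>\<^bsub>N\<^esub>i\<in>{..<v}. h ((const (ext_sign {i} A) * var i) \<odot>\<^bsub>M\<^esub> c (insert i A)))"
    unfolding koszul_def
    by (rule graded_hom_finsum[OF _ _ h])
      (use assms koszul_term_closed[of v M] in \<open>auto intro: M.abelian_group_axioms N.abelian_group_axioms\<close>)
  also have "\<dots> = koszul v N (\<lambda>A. h (c A)) A"
    unfolding koszul_def
  proof (rule N.finsum_cong')
    fix i assume i: "i \<in> {..<v}"
    then have ci: "c (insert i A) \<in> carrier M" using A by (auto intro: cochainsD[OF c])
    show "h ((const (ext_sign {i} A) * var i) \<odot>\<^bsub>M\<^esub> c (insert i A)) =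
        (const (ext_sign {i} A) * var i) \<odot>\<^bsub>N\<^esub> h (c (insert i A))"
      using h i ci signed_var_Sym[of i v "ext_sign {i} A :: 'k"] unfolding graded_hom_def by auto
  next
    show "(\<lambda>i. (const (ext_sign {i} A) * var i) \<odot>\<^bsub>N\<^esub> h (c (insert i A))) \<in> {..<v} \<rightarrow> carrier N"
    proof
      fix i assume i: "i \<in> {..<v}"
      then have "c (insert i A) \<in> carrier M" using A by (auto intro: cochainsD[OF c])
      then have "h (c (insert i A)) \<in> carrier N" using h by (auto simp: graded_hom_def)
      then show "(const (ext_sign {i} A) * var i) \<odot>\<^bsub>N\<^esub> h (c (insert i A)) \<in> carrier N"
        using i signed_var_Sym by blast
    qed
  qed auto
  finally show ?thesis .
qed

context graded_pieces
begin

lemma G_carrier: "x \<in> G j \<Longrightarrow> x \<in> carrier M"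
  using subgroup.subset[OF G_subgroup] by auto

lemma G_zero: "\<zero> \<in> G j"
  using subgroup.one_closed[OF G_subgroup] by simp

lemma G_add: "x \<in> G j \<Longrightarrow> y \<in> G j \<Longrightarrow> x \<oplus> y \<in> G j"
  using subgroup.m_closed[OF G_subgroup] by simp

lemma G_minus: "x \<in> G j \<Longrightarrow> y \<in> G j \<Longrightarrow> x \<ominus> y \<in> G j"
  unfolding a_minus_def by (intro G_add subgroup_a_inv[OF G_subgroup])

lemma G_finsum: "(\<And>i. i \<in> I \<Longrightarrow> f i \<in> G j) \<Longrightarrow> finsum M f I \<in> G j"
  by (rule finsum_in_subgroup[OF G_subgroup])

lemma koszul_G:
  assumes "c \<in> cochains v (G j)" "A \<subseteq> {..<v}"
  shows "koszul v M c A \<in> G (j + 1)"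
  unfolding koszul_def
proof (rule G_finsum)
  fix i assume "i \<in> {..<v}"
  then show "(const (ext_sign {i} A) * var i) \<odot> c (insert i A) \<in> G (j + 1)"
    using G_smult[of "const (ext_sign {i} A) * var i" 1 "c (insert i A)" j] assms signed_var_Sym_deg[of i v "ext_sign {i} A :: 'k"]
    by (auto simp: add.commute cochains_def)
qed

lemma cochains_carrier: "c \<in> cochains v (G j) \<Longrightarrow> c \<in> cochains v (carrier M)"
  by (auto intro: G_carrier cochains_mono)

end

section \<open>Graded free modules\<close>

lemma free_mod_simps [simp]:
  "carrier (free_mod v n) = {..<n} \<rightarrow>\<^sub>E carrier (Sym v)"
  "zero (free_mod v n) = (\<lambda>k\<in>{..<n}. 0)"
  "add (free_mod v n) x y = (\<lambda>k\<in>{..<n}. x k + y k)"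
  "smult (free_mod v n) p x = (\<lambda>k\<in>{..<n}. p * x k)"
  by (simp_all add: free_mod_def)

lemma module_free_mod: "Module.module (Sym v) (free_mod v n)"
proof (rule Module.moduleI)
  show "abelian_group (free_mod v n)"
  proof (rule abelian_groupI)
    fix x assume "x \<in> carrier (free_mod v n)"
    then show "\<exists>y\<in>carrier (free_mod v n). y \<oplus>\<^bsub>free_mod v n\<^esub> x = \<zero>\<^bsub>free_mod v n\<^esub>"
      by (intro bexI[of _ "\<lambda>k\<in>{..<n}. - x k"]) (auto simp: PiE_iff Sym_uminus fun_eq_iff)
  qed (auto simp: PiE_iff fun_eq_iff Sym_closed extensional_def restrict_def add_ac)
qed (auto simp: PiE_iff fun_eq_iff Sym_closed cring_Sym extensional_def restrict_def algebra_simps)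

lemma free_mod_a_inv:
  assumes "x \<in> carrier (free_mod v n)"
  shows "\<ominus>\<^bsub>free_mod v n\<^esub> x = (\<lambda>k\<in>{..<n}. - x k)"
proof -
  interpret F: Module.module "Sym v" "free_mod v n" by (rule module_free_mod)
  show ?thesis using assms by (intro F.minus_equality) (auto simp: PiE_iff Sym_uminus)
qed

lemma finsum_free_mod:
  assumes "finite I" "f \<in> I \<rightarrow> carrier (free_mod v n)" "k < n"
  shows "finsum (free_mod v n) f I k = (\<Sum>i\<in>I. f i k)"
proof -
  interpret F: Module.module "Sym v" "free_mod v n" by (rule module_free_mod)
  from assms(1,2) show ?thesis
  proof (induction I rule: finite_induct)
    case empty
    show ?case using assms(3) F.finsum_empty by simp
  next
    case (insert i I)
    then have "finsum (free_mod v n) f (insert i I) = f i \<oplus>\<^bsub>free_mod v n\<^esub> finsum (free_mod v n) f I"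
      by (intro F.finsum_insert) auto
    then show ?case using insert assms(3) by auto
  qed
qed

lemma free_gr_subset: "free_gr v n a j \<subseteq> carrier (free_mod v n)"
  using Sym_deg_subset by (fastforce simp: free_gr_def PiE_iff)

lemma free_gr_eq_zeroI:
  "x \<in> free_gr v n a j \<Longrightarrow> (\<And>k. k < n \<Longrightarrow> x k = 0) \<Longrightarrow> x = \<zero>\<^bsub>free_mod v n\<^esub>"
  by (auto simp: free_gr_def PiE_iff extensional_def fun_eq_iff)

lemma graded_pieces_free:
  "graded_pieces v (free_mod v n :: ('k::field pol, nat \<Rightarrow> 'k pol) module) (free_gr v n a)"
proof -
  interpret F: Module.module "Sym v :: 'k pol ring" "free_mod v n" by (rule module_free_mod)
  show ?thesis
  proof (intro graded_pieces.intro graded_pieces_axioms.intro module_free_mod)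
    fix j
    show "subgroup (free_gr v n a j :: (nat \<Rightarrow> 'k pol) set) (add_monoid (free_mod v n))"
    proof (rule F.add.subgroupI)
      show "(free_gr v n a j :: (nat \<Rightarrow> 'k pol) set) \<subseteq> carrier (free_mod v n)" using free_gr_subset by simp
      have "(\<lambda>k\<in>{..<n}. (0 :: 'k pol)) \<in> free_gr v n a j" by (auto simp: free_gr_def)
      then show "(free_gr v n a j :: (nat \<Rightarrow> 'k pol) set) \<noteq> {}" by blast
      fix x y :: "nat \<Rightarrow> 'k pol" assume x: "x \<in> free_gr v n a j" and y: "y \<in> free_gr v n a j"
      then show "x \<oplus>\<^bsub>free_mod v n\<^esub> y \<in> free_gr v n a j"
        by (auto simp: free_gr_def PiE_iff Sym_deg_add)
    next
      fix x :: "nat \<Rightarrow> 'k pol" assume x: "x \<in> free_gr v n a j"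
      have "x \<in> carrier (free_mod v n)" using x free_gr_subset by blast
      then have "\<ominus>\<^bsub>free_mod v n\<^esub> x = (\<lambda>k\<in>{..<n}. - x k)" by (rule free_mod_a_inv)
      then show "\<ominus>\<^bsub>free_mod v n\<^esub> x \<in> free_gr v n a j"
        using x by (auto simp: free_gr_def PiE_iff Sym_deg_uminus)
    qed
  next
    fix p :: "'k pol" and x :: "nat \<Rightarrow> 'k pol" and i j assume "p \<in> Sym_deg v i" "x \<in> free_gr v n a j"
    then show "p \<odot>\<^bsub>free_mod v n\<^esub> x \<in> free_gr v n a (i + j)"
      using Sym_deg_mult[of p v i "x _" "j - a _"] by (auto simp: free_gr_def PiE_iff add_diff_eq)
  next
    fix I :: "int set" and f :: "int \<Rightarrow> nat \<Rightarrow> 'k pol" and i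
    assume I: "finite I" and f: "\<And>i. i \<in> I \<Longrightarrow> f i \<in> free_gr v n a i"
      and sum: "finsum (free_mod v n) f I = \<zero>\<^bsub>free_mod v n\<^esub>" and i: "i \<in> I"
    have f': "f \<in> I \<rightarrow> carrier (free_mod v n)" using f free_gr_subset by blast
    have "lookup (f i k) t = 0" if k: "k < n" for k t
    proof (rule ccontr)
      assume nz: "lookup (f i k) t \<noteq> 0"
      have deg: "int (mon_degree t) = i' - a k" if "i' \<in> I" "lookup (f i' k) t \<noteq> 0" for i'
        using f[OF that(1)] k that(2) by (auto simp: free_gr_def PiE_iff dest: Sym_degD)
      have other: "lookup (f i' k) t = 0" if "i' \<in> I" "i' \<noteq> i" for i'
        using deg[OF that(1)] deg[OF i nz] that(2) by fastforce
      have "0 = lookup (\<Sum>i\<in>I. f i k) t"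
        using finsum_free_mod[OF I f' k] sum k by simp
      also have "\<dots> = (\<Sum>i'\<in>I. lookup (f i' k) t)" by (simp add: lookup_sum)
      also have "\<dots> = (\<Sum>i'\<in>{i}. lookup (f i' k) t)"
        using I i other by (intro sum.mono_neutral_right) auto
      finally show False using nz by simp
    qed
    then have "f i k = 0" if "k < n" for k using that by (intro poly_mapping_eqI) simp
    then show "f i = \<zero>\<^bsub>free_mod v n\<^esub>"
      by (rule free_gr_eq_zeroI[OF f[OF i]])
  qed
qed

text \<open>The component of degree \<open>j\<close> in \<open>S(-a\<^sub>0) \<oplus> \<dots> \<oplus> S(-a\<^sub>n\<^sub>-\<^sub>1)\<close>.\<close>

definition vec_part :: "nat \<Rightarrow> (nat \<Rightarrow> int) \<Rightarrow> int \<Rightarrow> (nat \<Rightarrow> 'k::field pol) \<Rightarrow> nat \<Rightarrow> 'k pol" where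
  "vec_part n a j x = (\<lambda>k\<in>{..<n}. pol_part (j - a k) (x k))"

lemma vec_part_free_gr: "x \<in> carrier (free_mod v n) \<Longrightarrow> vec_part n a j x \<in> free_gr v n a j"
  by (auto simp: vec_part_def free_gr_def intro!: pol_part_Sym_deg)

lemma free_mod_decomp:
  assumes x: "x \<in> carrier (free_mod v n)"
  obtains J where "finite J"
    "\<And>J'. finite J' \<Longrightarrow> J \<subseteq> J' \<Longrightarrow> x = finsum (free_mod v n) (\<lambda>j. vec_part n a j x) J'"
proof
  interpret F: Module.module "Sym v" "free_mod v n" by (rule module_free_mod)
  let ?J = "\<Union>k<n. (\<lambda>t. int (mon_degree t) + a k) ` keys (x k)"
  show "finite ?J" by simp
  fix J assume J: "finite J" "?J \<subseteq> J"
  have hc: "(\<lambda>j. vec_part n a j x) \<in> J \<rightarrow> carrier (free_mod v n)"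
    using vec_part_free_gr[OF x] free_gr_subset by blast
  then have "finsum (free_mod v n) (\<lambda>j. vec_part n a j x) J \<in> carrier (free_mod v n)"
    by (rule F.finsum_closed)
  then show "x = finsum (free_mod v n) (\<lambda>j. vec_part n a j x) J"
  proof (intro ext)
    fix k
    show "x k = finsum (free_mod v n) (\<lambda>j. vec_part n a j x) J k"
    proof (cases "k < n")
      case True
      then have "finsum (free_mod v n) (\<lambda>j. vec_part n a j x) J k = (\<Sum>j\<in>J. pol_part (j - a k) (x k))"
        using finsum_free_mod[OF J(1) hc] by (simp add: vec_part_def)
      also have "\<dots> = x k" by (rule sum_pol_part) (use J True in auto)
      finally show ?thesis ..
    next
      case False
      then show ?thesis
        using x \<open>finsum _ _ J \<in> carrier _\<close> by (auto simp: PiE_iff extensional_def)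
    qed
  qed
qed

context graded_pieces
begin

text \<open>A preimage of a homogeneous element can be replaced by its component of the right degree: the
  images of all components add up to \<open>h x\<close>, and by independence only the one in \<open>G j\<close> can
  contribute.\<close>

lemma hom_vec_part:
  assumes h: "graded_hom v (free_mod v n) (free_gr v n a) M G h"
    and x: "x \<in> carrier (free_mod v n)" and hx: "h x \<in> G j"
  shows "h (vec_part n a j x) = h x"
proof -
  interpret F: Module.module "Sym v" "free_mod v n" by (rule module_free_mod)
  from free_mod_decomp[OF x] obtain J0 where J0: "finite J0"
    "\<And>J. finite J \<Longrightarrow> J0 \<subseteq> J \<Longrightarrow> x = finsum (free_mod v n) (\<lambda>j. vec_part n a j x) J"
    by metis
  define J where "J = insert j J0"
  have J: "finite J" "j \<in> J" using J0 by (auto simp: J_def)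
  have hG: "h (vec_part n a i x) \<in> G i" for i
    using graded_homD(4)[OF h] vec_part_free_gr[OF x] by blast
  have hxc: "h x \<in> carrier M" using hx G_carrier by blast
  have hx': "h x = (\<Oplus>i\<in>J. h (vec_part n a i x))"
  proof -
    have "h x = h (finsum (free_mod v n) (\<lambda>j. vec_part n a j x) J)"
      using J0(2)[of J] J(1) by (metis J_def subset_insertI)
    also have "\<dots> = (\<Oplus>i\<in>J. h (vec_part n a i x))"
      using vec_part_free_gr[OF x] free_gr_subset
      by (intro graded_hom_finsum[OF F.abelian_group_axioms abelian_group_axioms h]) blast
    finally show ?thesis .
  qed
  let ?d = "\<lambda>i. if j = i then h x else \<zero>"
  have "(\<Oplus>i\<in>J. h (vec_part n a i x) \<ominus> ?d i) = (\<Oplus>i\<in>J. h (vec_part n a i x)) \<ominus> (\<Oplus>i\<in>J. ?d i)"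
    using hG hxc G_carrier by (intro finsum_diff) auto
  also have "\<dots> = \<zero>"
    using hx' J hxc finsum_singleton[of j J "\<lambda>_. h x"] by (simp add: a_minus_def r_neg)
  finally have "h (vec_part n a j x) \<ominus> ?d j = \<zero>"
    by (rule G_direct[OF J(1) _ _ J(2), of "\<lambda>i. h (vec_part n a i x) \<ominus> ?d i", rotated])
      (use hG hx G_zero G_minus in auto)
  then show ?thesis using hxc G_carrier[OF hG] by (simp add: minus_eq_zero_iff)
qed

lemma kernel_vec_part:
  assumes "graded_hom v (free_mod v n) (free_gr v n a) M G h"
    and "x \<in> carrier (free_mod v n)" and "h x = \<zero>"
  shows "h (vec_part n a j x) = \<zero>"
  using hom_vec_part[OF assms(1,2), of j] assms(3) G_zero by simp

lemma graded_pieces_kernel: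
  assumes N: "Module.module (Sym v) N" and h: "graded_hom v M G N grN h"
  shows "graded_pieces v M (\<lambda>j. G j \<inter> {x. h x = \<zero>\<^bsub>N\<^esub>})"
proof -
  interpret N: Module.module "Sym v" N by fact
  note ab = abelian_group_axioms N.abelian_group_axioms
  show ?thesis
  proof (intro graded_pieces.intro graded_pieces_axioms.intro module_axioms)
    fix j
    show "subgroup (G j \<inter> {x. h x = \<zero>\<^bsub>N\<^esub>}) (add_monoid M)"
    proof (rule add.subgroupI)
      show "G j \<inter> {x. h x = \<zero>\<^bsub>N\<^esub>} \<subseteq> carrier M" using G_carrier by auto
      show "G j \<inter> {x. h x = \<zero>\<^bsub>N\<^esub>} \<noteq> {}" using G_zero graded_hom_zero[OF ab h] by blast
      fix x y assume x: "x \<in> G j \<inter> {x. h x = \<zero>\<^bsub>N\<^esub>}" and y: "y \<in> G j \<inter> {x. h x = \<zero>\<^bsub>N\<^esub>}"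
      then show "x \<oplus> y \<in> G j \<inter> {x. h x = \<zero>\<^bsub>N\<^esub>}"
        using graded_homD(2)[OF h, of x y] G_carrier[of x j] G_carrier[of y j] by (simp add: G_add)
    next
      fix x assume x: "x \<in> G j \<inter> {x. h x = \<zero>\<^bsub>N\<^esub>}"
      then show "\<ominus> x \<in> G j \<inter> {x. h x = \<zero>\<^bsub>N\<^esub>}"
        using graded_hom_a_inv[OF ab h, of x] G_carrier[of x j] subgroup_a_inv[OF G_subgroup, of x j]
          N.minus_equality[of "\<zero>\<^bsub>N\<^esub>" "\<zero>\<^bsub>N\<^esub>"] by simp
    qed
  next
    fix p :: "'k pol" and x i j assume "p \<in> Sym_deg v i" "x \<in> G j \<inter> {x. h x = \<zero>\<^bsub>N\<^esub>}"
    then show "p \<odot> x \<in> G (i + j) \<inter> {x. h x = \<zero>\<^bsub>N\<^esub>}"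
      using graded_homD(3)[OF h, of p x] G_carrier[of x j] Sym_deg_subset G_smult by auto
  next
    fix I :: "int set" and f i
    assume "finite I" "\<And>i. i \<in> I \<Longrightarrow> f i \<in> G i \<inter> {x. h x = \<zero>\<^bsub>N\<^esub>}" "finsum M f I = \<zero>" "i \<in> I"
    then show "f i = \<zero>" using G_direct[of I f i] by blast
  qed
qed

lemma graded_pieces_trunc: "graded_pieces v M (trunc_gr M G d)"
proof (intro graded_pieces.intro graded_pieces_axioms.intro module_axioms)
  fix j
  show "subgroup (trunc_gr M G d j) (add_monoid M)"
    using G_subgroup add.triv_subgroup by (simp add: trunc_gr_def)
next
  fix p :: "'k pol" and x i j assume p: "p \<in> Sym_deg v i" and x: "x \<in> trunc_gr M G d j"
  have x': "x \<in> G j" using x G_zero by (auto simp: trunc_gr_def split: if_splits)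
  have pc: "p \<in> carrier (Sym v)" using p Sym_deg_subset by blast
  show "p \<odot> x \<in> trunc_gr M G d (i + j)"
  proof (cases "i < 0 \<or> j < d")
    case True
    then have "p \<odot> x = \<zero>"
      using x Sym_deg_neg[OF _ p] smult_l_null[OF G_carrier[OF x']] smult_r_null[OF pc]
      by (auto simp: trunc_gr_def)
    then show ?thesis using G_zero by (simp add: trunc_gr_def)
  next
    case False
    then show ?thesis using G_smult[OF p x'] by (simp add: trunc_gr_def)
  qed
next
  fix I :: "int set" and f i
  assume I: "finite I" "finsum M f I = \<zero>" "i \<in> I" and f: "\<And>i. i \<in> I \<Longrightarrow> f i \<in> trunc_gr M G d i"
  have "f i \<in> G i" if "i \<in> I" for i
    using f[OF that] G_zero by (auto simp: trunc_gr_def split: if_splits)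
  with I show "f i = \<zero>" using G_direct[of I f i] by blast
qed

end

text \<open>Independence follows from uniqueness of the decomposition of \<open>0\<close>, once a vanishing sum is
  extended by zero to a family over all degrees.\<close>

lemma graded_module_pieces:
  fixes M :: "('k::field pol, 'm) module" (structure)
  assumes "graded_module v M gr"
  shows "graded_pieces v M gr"
proof -
  interpret graded_module v M gr by fact
  show ?thesis
  proof (intro graded_pieces.intro graded_pieces_axioms.intro module_axioms gr_subgroup smult_gr)
    fix I :: "int set" and f :: "int \<Rightarrow> 'm" and i
    assume I: "finite I" and f: "\<And>i. i \<in> I \<Longrightarrow> f i \<in> gr i" and sum: "finsum M f I = \<zero>" and i: "i \<in> I"
    have zero: "\<zero> \<in> gr j" for j using subgroup.one_closed[OF gr_subgroup] by simp
    have car: "x \<in> carrier M" if "x \<in> gr j" for x j using subgroup.subset[OF gr_subgroup] that by auto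
    let ?P = "\<lambda>f. (\<forall>j. f j \<in> gr j) \<and> finite {j. f j \<noteq> \<zero>} \<and> \<zero> = finsum M f {j. f j \<noteq> \<zero>}"
    define g where "g j = (if j \<in> I then f j else \<zero>)" for j
    have sub: "{j. g j \<noteq> \<zero>} \<subseteq> I" by (auto simp: g_def)
    have "finsum M g {j. g j \<noteq> \<zero>} = finsum M g I"
      using I sub car[OF f] by (intro add.finprod_mono_neutral_cong_left) (auto simp: g_def)
    also have "\<dots> = finsum M f I"
      using car[OF f] by (intro finsum_cong') (auto simp: g_def)
    finally have Pg: "?P g"
      using f zero I finite_subset[OF sub] sum by (auto simp: g_def)
    have P0: "?P (\<lambda>_. \<zero>)" using zero by simp
    have "g = (\<lambda>_. \<zero>)"
    proof (rule ex1E[OF decomp[OF zero_closed]])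
      fix u assume u: "\<forall>y. ?P y \<longrightarrow> y = u"
      from spec[OF u, of g] spec[OF u, of "\<lambda>_. \<zero>"] Pg P0 show ?thesis by simp
    qed
    then have "g i = \<zero>" by simp
    then show "f i = \<zero>" using i by (simp add: g_def)
  qed
qed

definition comb :: "('r, 'm) module \<Rightarrow> nat \<Rightarrow> (nat \<Rightarrow> 'm) \<Rightarrow> (nat \<Rightarrow> 'r) \<Rightarrow> 'm" where
  "comb M n g x = (\<Oplus>\<^bsub>M\<^esub>k\<in>{..<n}. x k \<odot>\<^bsub>M\<^esub> g k)"

context graded_pieces
begin

lemma comb_hom:
  assumes g: "\<And>k. k < n \<Longrightarrow> g k \<in> G (a k)"
  shows "graded_hom v (free_mod v n) (free_gr v n a) M G (comb M n g)"
proof -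
  have gc: "g k \<in> carrier M" if "k < n" for k using g[OF that] G_carrier by blast
  have xc: "x k \<in> carrier (Sym v)" if "x \<in> carrier (free_mod v n)" "k < n" for x k
    using that by (auto simp: PiE_iff)
  have tc: "x k \<odot> g k \<in> carrier M" if "x \<in> carrier (free_mod v n)" "k < n" for x k
    using that xc gc by blast
  show ?thesis
    unfolding graded_hom_def
  proof (intro conjI ballI allI)
    show "comb M n g \<in> carrier (free_mod v n) \<rightarrow> carrier M"
      unfolding comb_def using tc by (intro funcsetI finsum_closed) auto
  next
    fix x y :: "nat \<Rightarrow> 'k pol" assume x: "x \<in> carrier (free_mod v n)" and y: "y \<in> carrier (free_mod v n)"
    have "comb M n g (x \<oplus>\<^bsub>free_mod v n\<^esub> y) = (\<Oplus>k\<in>{..<n}. x k \<odot> g k \<oplus> y k \<odot> g k)"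
      unfolding comb_def
    proof (rule finsum_cong')
      fix k assume "k \<in> {..<n}"
      then show "(x \<oplus>\<^bsub>free_mod v n\<^esub> y) k \<odot> g k = x k \<odot> g k \<oplus> y k \<odot> g k"
        using xc[OF x] xc[OF y] gc smult_l_distr[of "x k" "y k" "g k"] by simp
    qed (use tc[OF x] tc[OF y] in auto)
    also have "\<dots> = comb M n g x \<oplus> comb M n g y"
      unfolding comb_def using tc[OF x] tc[OF y] by (intro finsum_addf) auto
    finally show "comb M n g (x \<oplus>\<^bsub>free_mod v n\<^esub> y) = comb M n g x \<oplus> comb M n g y" .
  next
    fix p :: "'k pol" and x :: "nat \<Rightarrow> 'k pol" assume p: "p \<in> carrier (Sym v)" and x: "x \<in> carrier (free_mod v n)"
    have "p \<odot> comb M n g x = (\<Oplus>k\<in>{..<n}. p \<odot> (x k \<odot> g k))"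
      unfolding comb_def using tc[OF x] p by (intro finsum_smult_ldistr) auto
    also have "\<dots> = comb M n g (p \<odot>\<^bsub>free_mod v n\<^esub> x)"
      unfolding comb_def
    proof (rule finsum_cong')
      fix k assume k: "k \<in> {..<n}"
      then show "p \<odot> (x k \<odot> g k) = (p \<odot>\<^bsub>free_mod v n\<^esub> x) k \<odot> g k"
        using xc[OF x] gc p smult_assoc1[of p "x k" "g k"] by simp
    next
      show "(\<lambda>k. (p \<odot>\<^bsub>free_mod v n\<^esub> x) k \<odot> g k) \<in> {..<n} \<rightarrow> carrier M"
        using xc[OF x] gc p by (auto intro!: smult_closed Sym_mult)
    qed auto
    finally show "comb M n g (p \<odot>\<^bsub>free_mod v n\<^esub> x) = p \<odot> comb M n g x" ..
  next
    fix j
    show "comb M n g ` free_gr v n a j \<subseteq> G j"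
    proof (rule image_subsetI)
      fix x :: "nat \<Rightarrow> 'k pol" assume x: "x \<in> free_gr v n a j"
      have "x k \<odot> g k \<in> G j" if "k < n" for k
        using G_smult[of "x k" "j - a k" "g k" "a k"] g that x by (auto simp: free_gr_def PiE_iff)
      then show "comb M n g x \<in> G j" unfolding comb_def by (intro G_finsum) auto
    qed
  qed
qed

lemma comb_unit_vec:
  assumes "j < n" "\<And>k. k < n \<Longrightarrow> g k \<in> carrier M"
  shows "comb M n g (unit_vec n j) = g j"
proof -
  have "comb M n g (unit_vec n j) = (\<Oplus>k\<in>{..<n}. if j = k then g k else \<zero>)"
    unfolding comb_def
  proof (rule finsum_cong')
    fix k assume "k \<in> {..<n}"
    then show "unit_vec n j k \<odot> g k = (if j = k then g k else \<zero>)"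
      using assms smult_one[of "g k"] smult_l_null[of "g k"] by (auto simp: unit_vec_def)
  qed (use assms in auto)
  also have "\<dots> = g j" using assms by (intro finsum_singleton) auto
  finally show ?thesis .
qed

end

lemma unit_vec_closed: "unit_vec n j \<in> carrier (free_mod v n)"
  by (auto simp: unit_vec_def Sym_closed)

lemma unit_vec_free_gr: "j < n \<Longrightarrow> unit_vec n j \<in> free_gr v n a (a j)"
  using const_Sym_deg[of 1 v] by (auto simp: unit_vec_def free_gr_def)

section \<open>Exactness of the Koszul complex of a free module\<close>

text \<open>Here \<open>L A s\<close> is the coefficient of the monomial \<open>x\<^sup>s\<close> in the value at \<open>A\<close> of a cochain of \<open>S\<close>, and
  \<open>D\<close> is the Koszul differential on coefficients. The differential preserves the total exponent of
  \<open>x\<^sup>s\<close> and \<open>e\<^sub>A\<close>, hence also the smallest index \<open>m\<close> occurring in \<open>s\<close> or \<open>A\<close>. The homotopy \<open>H\<close> trades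
  \<open>x\<^sub>m\<close> for \<open>e\<^sub>m\<close>: its value at \<open>(A, s)\<close> is nonzero only if \<open>m \<in> A\<close>, and then it is the coefficient
  of \<open>L\<close> with \<open>m\<close> moved from \<open>A\<close> into \<open>s\<close>. The sign of \<open>e\<^sub>m\<close> is always \<open>+\<close> because \<open>m\<close> is smallest.
  So \<open>D H + H D\<close> is the identity except at the total exponent \<open>0\<close>, where \<open>L {} 0 = 0\<close> is assumed.\<close>

lemma koszul_homotopy:
  fixes v :: nat and L :: "nat set \<Rightarrow> (nat \<Rightarrow>\<^sub>0 nat) \<Rightarrow> 'k::field"
  defines "\<delta> \<equiv> \<lambda>i. single i (1::nat)"
  defines "D \<equiv> \<lambda>L A s. \<Sum>i<v. if i \<in> keys s then ext_sign {i} A * L (insert i A) (s - \<delta> i) else 0"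
  defines "H \<equiv> \<lambda>A s. if A \<noteq> {} \<and> (\<forall>l\<in>keys s. Min A \<le> l)
      then L (A - {Min A}) (s + \<delta> (Min A)) else 0"
  assumes cycle: "\<And>A s. A \<subseteq> {..<v} \<Longrightarrow> D L A s = 0" and L0: "L {} 0 = 0"
    and A: "A \<subseteq> {..<v}" and s: "keys s \<subseteq> {..<v}"
  shows "D H A s = L A s"
proof -
  have fin: "finite A" using A finite_subset by blast
  have keys_diff: "keys (s - \<delta> i) \<subseteq> keys s" for i
    by (auto simp: in_keys_iff lookup_minus)
  have keys_diff': "l \<in> keys (s - \<delta> i)" if "l \<in> keys s" "l \<noteq> i" for l i
    using that by (auto simp: in_keys_iff lookup_minus lookup_single \<delta>_def)
  have shift: "s - \<delta> i + \<delta> m = s + \<delta> m - \<delta> i" if "i \<in> keys s" for i m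
    using that by (intro poly_mapping_eqI) (auto simp: in_keys_iff lookup_minus lookup_add lookup_single \<delta>_def when_def)
  show ?thesis
  proof (cases "A \<noteq> {} \<and> (\<forall>l\<in>keys s. Min A \<le> l)")
    case True
    define a B t where "a = Min A" and "B = A - {a}" and "t = s + \<delta> a"
    have aA: "a \<in> A" and amin: "\<And>b. b \<in> A \<Longrightarrow> a \<le> b" using True fin by (auto simp: a_def)
    have a_below: "\<forall>b\<in>B. a < b" using amin unfolding B_def by force
    have av: "a < v" using aA A by auto
    have keys_t: "keys t = insert a (keys s)"
      by (simp add: t_def keys_nat_add \<delta>_def)
    let ?f = "\<lambda>i. if i \<in> keys t then ext_sign {i} B * L (insert i B) (t - \<delta> i) else 0"
    let ?g = "\<lambda>i. if i \<in> keys s then ext_sign {i} A * H (insert i A) (s - \<delta> i) else 0"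
    \<comment> \<open>Here \<open>m = a\<close> lies in \<open>A\<close>. The cocycle condition at \<open>(A - {a}, s + \<delta> a)\<close> expresses \<open>L A s\<close> by
      terms that cancel those of \<open>D H\<close>, since removing \<open>a\<close> from \<open>A\<close> flips the sign of \<open>e\<^sub>i\<close>.\<close>
    have "0 = (\<Sum>i<v. ?f i)"
    proof -
      have "B \<subseteq> {..<v}" using A by (auto simp: B_def)
      from cycle[OF this, of t] show ?thesis by (simp add: D_def)
    qed
    also have "\<dots> = ?f a + (\<Sum>i\<in>{..<v} - {a}. ?f i)"
      using av by (intro sum.remove) auto
    also have "?f a = L A s"
    proof -
      have "insert a B = A" using aA by (auto simp: B_def)
      then show ?thesis using ext_sign_below[OF a_below, where ?'a = 'k] keys_t by (simp add: t_def)
    qed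
    finally have 1: "L A s = - (\<Sum>i\<in>{..<v} - {a}. ?f i)" by (simp add: eq_neg_iff_add_eq_0)
    have "D H A s = ?g a + (\<Sum>i\<in>{..<v} - {a}. ?g i)"
      unfolding D_def using av by (intro sum.remove) auto
    also have "?g a = 0" using aA by (simp add: ext_sign_single)
    also have "(\<Sum>i\<in>{..<v} - {a}. ?g i) = (\<Sum>i\<in>{..<v} - {a}. - ?f i)"
    proof (rule sum.cong[OF refl])
      fix i assume i: "i \<in> {..<v} - {a}"
      show "?g i = - ?f i"
      proof (cases "i \<in> keys s \<and> i \<notin> A")
        case False
        then show ?thesis using i keys_t by (auto simp: ext_sign_single B_def)
      next
        case iA: True
        then have ai: "a < i" using True i by (auto simp: a_def order_less_le)
        have "Min (insert i A) = a" using ai amin aA fin by (intro Min_eqI) auto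
        moreover have "\<forall>l\<in>keys (s - \<delta> i). a \<le> l" using True keys_diff by (auto simp: a_def)
        ultimately have "H (insert i A) (s - \<delta> i) = L (insert i A - {a}) (s - \<delta> i + \<delta> a)"
          by (simp add: H_def)
        also have "insert i A - {a} = insert i B" using ai by (auto simp: B_def)
        also have "s - \<delta> i + \<delta> a = t - \<delta> i" using iA shift by (simp add: t_def)
        finally show ?thesis
          using iA keys_t ext_sign_remove_smaller[OF fin aA ai, where ?'k = 'k] by (simp add: B_def)
      qed
    qed
    finally show ?thesis using 1 by (simp add: sum_negf)
  next
    case False
    show ?thesis
    proof (cases "s = 0")
      case True
      then show ?thesis using False L0 by (auto simp: D_def)
    next
      case s0: False
      define m where "m = Min (keys s)"
      have ne: "keys s \<noteq> {}" using s0 by simp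
      have m: "m \<in> keys s" and mmin: "\<And>l. l \<in> keys s \<Longrightarrow> m \<le> l"
        using ne by (auto simp: m_def)
      have mA: "m < b" if b: "b \<in> A" for b
      proof -
        from False b obtain l where "l \<in> keys s" "l < Min A" by (auto simp: not_le)
        then have "m < Min A" using mmin by force
        then show ?thesis using b fin Min_le[of A b] by linarith
      qed
      let ?g = "\<lambda>i. if i \<in> keys s then ext_sign {i} A * H (insert i A) (s - \<delta> i) else 0"
      \<comment> \<open>Here \<open>m\<close> lies in \<open>s\<close> and below all of \<open>A\<close>, so only the term \<open>i = m\<close> of \<open>D H\<close> survives.\<close>
      have "D H A s = ?g m + (\<Sum>i\<in>{..<v} - {m}. ?g i)"
        unfolding D_def using m s by (intro sum.remove) auto
      also have "(\<Sum>i\<in>{..<v} - {m}. ?g i) = 0"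
      proof (rule sum.neutral, rule ballI)
        fix i assume i: "i \<in> {..<v} - {m}"
        show "?g i = 0"
        proof (cases "i \<in> keys s")
          case True
          then have "m < i" using mmin[of i] i by auto
          then have "m < Min (insert i A)" using mA fin by simp
          moreover have "m \<in> keys (s - \<delta> i)" using m i keys_diff' by auto
          ultimately show ?thesis by (auto simp: H_def)
        qed simp
      qed
      also have "?g m = L A s"
      proof -
        have "Min (insert m A) = m" using mA fin by (intro Min_eqI) (auto intro: less_imp_le)
        moreover have "\<forall>l\<in>keys (s - \<delta> m). m \<le> l" using mmin keys_diff by auto
        moreover have "insert m A - {m} = A" using mA by auto
        moreover have "s - \<delta> m + \<delta> m = s" using shift[OF m, of m] by simp
        ultimately have "H (insert m A) (s - \<delta> m) = L A s" by (simp add: H_def)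
        moreover have "ext_sign {m} A = (1 :: 'k)" using mA by (intro ext_sign_below) auto
        ultimately show ?thesis using m by simp
      qed
      finally show ?thesis by simp
    qed
  qed
qed

text \<open>The quotient by \<open>x\<^sub>i\<close> of the part of \<open>p\<close> spanned by the monomials whose smallest variable is
  \<open>x\<^sub>i\<close>.\<close>

lift_definition var_quot :: "nat \<Rightarrow> 'k::field pol \<Rightarrow> 'k pol" is
  "\<lambda>i p s. if \<forall>l\<in>keys s. i \<le> l then p (s + single i 1) else 0"
proof -
  fix i and p :: "(nat \<Rightarrow>\<^sub>0 nat) \<Rightarrow> 'k"
  let ?q = "\<lambda>s. if \<forall>l\<in>keys s. i \<le> l then p (s + single i 1) else 0"
  assume "finite {t. p t \<noteq> 0}"
  then have "finite ((\<lambda>t. t - single i 1) ` {t. p t \<noteq> 0})" by simp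
  moreover have "{s. ?q s \<noteq> 0} \<subseteq> (\<lambda>t. t - single i 1) ` {t. p t \<noteq> 0}"
  proof
    fix s assume "s \<in> {s. ?q s \<noteq> 0}"
    then have "p (s + single i 1) \<noteq> 0" by (auto split: if_splits)
    then show "s \<in> (\<lambda>t. t - single i 1) ` {t. p t \<noteq> 0}"
      by (intro image_eqI[of _ _ "s + single i 1"]) simp_all
  qed
  ultimately show "finite {s. ?q s \<noteq> 0}" using finite_subset by blast
qed

lemma lookup_var_quot:
  "lookup (var_quot i p) s =
     (if \<forall>l\<in>keys s. i \<le> l then lookup p (s + single i 1) else 0)"
  by transfer simp

lemma var_quot_Sym_deg: "p \<in> Sym_deg v j \<Longrightarrow> var_quot i p \<in> Sym_deg v (j - 1)"
proof -
  assume p: "p \<in> Sym_deg v j"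
  have "keys s \<subseteq> {..<v} \<and> int (mon_degree s) = j - 1" if "s \<in> keys (var_quot i p)" for s
  proof -
    from that have "s + single i 1 \<in> keys p"
      by (auto simp: in_keys_iff lookup_var_quot split: if_splits)
    then have "keys (s + single i 1) \<subseteq> {..<v}"
      "int (mon_degree (s + single i 1)) = j"
      using p by (auto simp: Sym_deg_def Sym_def)
    moreover have "mon_degree (single i 1) = 1" by (simp add: mon_degree_def)
    ultimately show ?thesis by (auto simp: keys_nat_add mon_degree_add)
  qed
  then show ?thesis by (auto simp: Sym_deg_def Sym_def)
qed

lemma lookup_koszul_free:
  fixes c :: "nat set \<Rightarrow> nat \<Rightarrow> 'k::field pol"
  assumes c: "c \<in> cochains v (carrier (free_mod v n))" and A: "A \<subseteq> {..<v}" and k: "k < n"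
  shows "lookup (koszul v (free_mod v n) c A k) s =
    (\<Sum>i<v. if i \<in> keys s
      then ext_sign {i} A * lookup (c (insert i A) k) (s - single i 1) else 0)"
proof -
  have "koszul v (free_mod v n) c A k =
      (\<Sum>i<v. ((const (ext_sign {i} A) * var i) \<odot>\<^bsub>free_mod v n\<^esub> c (insert i A)) k)"
    unfolding koszul_def
    by (rule finsum_free_mod)
      (use koszul_term_closed[OF module_free_mod c A] k in \<open>auto simp del: free_mod_simps\<close>)
  also have "\<dots> = (\<Sum>i<v. const (ext_sign {i} A) * (var i * c (insert i A) k))"
    using k by (simp add: mult.assoc)
  finally show ?thesis
    by (simp add: lookup_sum lookup_const_mult lookup_var_mult if_distrib cong: if_cong)
qed

text \<open>The homotopy is applied to each component. A coefficient at the empty index set and the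
  monomial \<open>1\<close> would have degree \<open>d\<close>, which is why it vanishes in degree \<open>j\<close>.\<close>

lemma koszul_exact_free:
  assumes a: "\<And>k. k < n \<Longrightarrow> a k = d" and j: "j \<noteq> d"
  shows "koszul_exact v (free_mod v n :: ('k::field pol, nat \<Rightarrow> 'k pol) module) (free_gr v n a) p j"
  unfolding koszul_exact_def
proof (intro ballI impI)
  let ?F = "free_mod v n :: ('k pol, nat \<Rightarrow> 'k pol) module"
  interpret F: graded_pieces v ?F "free_gr v n a" by (rule graded_pieces_free)
  fix c :: "nat set \<Rightarrow> nat \<Rightarrow> 'k pol"
  assume c: "c \<in> cochains v (free_gr v n a j)"
    and "(\<forall>A\<subseteq>{..<v}. koszul v ?F c A = \<zero>\<^bsub>?F\<^esub>) \<and> (\<forall>A\<subseteq>{..<v}. p \<le> card A \<longrightarrow> c A = \<zero>\<^bsub>?F\<^esub>)"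
  then have cycle: "koszul v ?F c A = \<zero>\<^bsub>?F\<^esub>" if "A \<subseteq> {..<v}" for A
    using that by blast
  define b where "b A = (\<lambda>k\<in>{..<n}. if A = {} then 0 else var_quot (Min A) (c (A - {Min A}) k))" for A
  have b: "b \<in> cochains v (free_gr v n a (j - 1))"
  proof -
    have "var_quot (Min A) (c (A - {Min A}) k) \<in> Sym_deg v (j - 1 - a k)" if "A \<subseteq> {..<v}" "k < n" for A k
    proof -
      have "A - {Min A} \<subseteq> {..<v}" using that by auto
      then have "c (A - {Min A}) k \<in> Sym_deg v (j - a k)"
        using cochainsD[OF c] that by (fastforce simp: free_gr_def PiE_iff)
      from var_quot_Sym_deg[OF this] show ?thesis by (simp add: algebra_simps)
    qed
    then show ?thesis by (auto simp: cochains_def free_gr_def b_def)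
  qed
  have cc: "c \<in> cochains v (carrier ?F)" and bc: "b \<in> cochains v (carrier ?F)"
    using F.cochains_carrier c b by blast+
  have "c A = koszul v ?F b A" if A: "A \<subseteq> {..<v}" for A
  proof (rule ext)
    fix k
    have cA: "c A \<in> carrier ?F" and kA: "koszul v ?F b A \<in> carrier ?F"
      using cochainsD[OF cc A] koszul_closed[OF module_free_mod bc A] by blast+
    show "c A k = koszul v ?F b A k"
    proof (cases "k < n")
      case k: True
      define L where "L A s = lookup (c A k) s" for A s
      show ?thesis
      proof (rule poly_mapping_eqI)
        fix s
        show "lookup (c A k) s = lookup (koszul v ?F b A k) s"
        proof (cases "keys s \<subseteq> {..<v}")
          case s: True
          have "L {} 0 = 0"
          proof (rule ccontr)
            assume "L {} 0 \<noteq> 0"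
            moreover have "c {} k \<in> Sym_deg v (j - d)"
              using cochainsD[OF c, of "{}"] k a by (auto simp: free_gr_def PiE_iff)
            ultimately show False using Sym_degD[of "c {} k" v "j - d" 0] j by (simp add: L_def)
          qed
          moreover have "(\<Sum>i<v. if i \<in> keys s then ext_sign {i} A * L (insert i A) (s - single i 1) else 0) = 0"
            if "A \<subseteq> {..<v}" for A s
            using lookup_koszul_free[OF cc that k, of s] cycle[OF that] k unfolding L_def by simp
          ultimately have "L A s = (\<Sum>i<v. if i \<in> keys s then ext_sign {i} A *
              (if insert i A \<noteq> {} \<and> (\<forall>l\<in>keys (s - single i 1). Min (insert i A) \<le> l)
               then L (insert i A - {Min (insert i A)}) (s - single i 1 + single (Min (insert i A)) 1)
               else 0) else 0)"
            using koszul_homotopy[of v L A s] A s by simp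
          also have "\<dots> = lookup (koszul v ?F b A k) s"
            unfolding lookup_koszul_free[OF bc A k]
            using k by (intro sum.cong refl) (simp add: b_def L_def lookup_var_quot)
          finally show ?thesis by (simp add: L_def)
        next
          case False
          moreover have "c A k \<in> carrier (Sym v)" "koszul v ?F b A k \<in> carrier (Sym v)"
            using cA kA k by (auto simp: PiE_iff)
          ultimately have "s \<notin> keys (c A k)" "s \<notin> keys (koszul v ?F b A k)"
            unfolding Sym_def by auto
          then show ?thesis by (simp add: in_keys_iff)
        qed
      qed
    next
      case False
      then show ?thesis using cA kA by (auto simp: PiE_iff extensional_def)
    qed
  qed
  with b show "\<exists>b\<in>cochains v (free_gr v n a (j - 1)). \<forall>A\<subseteq>{..<v}. c A = koszul v ?F b A"
    by blast
qed

section \<open>The complex R(M) as a Koszul complex\<close>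

lemma Ext_add: "e \<in> Ext v \<Longrightarrow> f \<in> Ext v \<Longrightarrow> e + f \<in> Ext v"
  using Poly_Mapping.keys_add[of e f] by (auto simp: Ext_def)

lemma lookup_ext_scale: "lookup (ext_scale c e) A = c * lookup e A"
  by (simp add: ext_scale_def Poly_Mapping.map.rep_eq when_def)

lemma Ext_scale: "e \<in> Ext v \<Longrightarrow> ext_scale c e \<in> Ext v"
  by (auto simp: Ext_def in_keys_iff lookup_ext_scale)

lemma Ext_single: "A \<subseteq> {..<v} \<Longrightarrow> single A c \<in> Ext v"
  by (simp add: Ext_def)

text \<open>Allowing any finite \<open>X\<close> that contains the support makes the product visibly linear in \<open>e\<close>, since
  two elements can be expanded over a common \<open>X\<close>.\<close>

lemma ext_gen_mult:
  fixes e :: "'k::field ext"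
  assumes "finite X" "keys e \<subseteq> X"
  shows "ext_gen i \<and>\<^sub>E e =
    (\<Sum>B\<in>X. single (insert i B) (ext_sign {i} B * lookup e B))"
proof -
  have "ext_gen i \<and>\<^sub>E e =
      (\<Sum>B\<in>keys e. single (insert i B) (ext_sign {i} B * lookup e B))"
    by (simp add: ext_mult_def ext_gen_def)
  also have "\<dots> = (\<Sum>B\<in>X. single (insert i B) (ext_sign {i} B * lookup e B))"
    by (rule sum.mono_neutral_left) (use assms in \<open>auto simp: in_keys_iff\<close>)
  finally show ?thesis .
qed

lemma ext_gen_mult_add: "ext_gen i \<and>\<^sub>E (e + f) = ext_gen i \<and>\<^sub>E e + ext_gen i \<and>\<^sub>E (f :: 'k::field ext)"
proof -
  let ?X = "keys e \<union> keys f"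
  have "keys (e + f) \<subseteq> ?X" by (rule Poly_Mapping.keys_add)
  then show ?thesis
    by (simp add: ext_gen_mult[of ?X] lookup_add distrib_left single_add sum.distrib)
qed

lemma ext_scale_single: "ext_scale c (single A d) = single A (c * d)"
  by (rule poly_mapping_eqI) (simp add: lookup_ext_scale lookup_single when_def)

lemma ext_scale_sum: "ext_scale c (sum f X) = (\<Sum>x\<in>X. ext_scale c (f x))"
  by (rule poly_mapping_eqI) (simp add: lookup_ext_scale lookup_sum sum_distrib_left)

lemma ext_gen_mult_scale: "ext_gen i \<and>\<^sub>E ext_scale c e = ext_scale c (ext_gen i \<and>\<^sub>E (e :: 'k::field ext))"
proof -
  let ?X = "keys e"
  have "keys (ext_scale c e) \<subseteq> ?X" by (auto simp: in_keys_iff lookup_ext_scale)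
  then show ?thesis
    by (simp add: ext_gen_mult[of ?X] ext_scale_sum ext_scale_single lookup_ext_scale mult.left_commute)
qed

lemma ext_gen_mult_single:
  "ext_gen i \<and>\<^sub>E single A 1 = single (insert i A) (ext_sign {i} A :: 'k::field)"
  by (simp add: ext_gen_mult[of "{A}"])

lemma Ext_gen_mult:
  assumes "e \<in> Ext v" "i < v"
  shows "ext_gen i \<and>\<^sub>E e \<in> Ext v"
proof -
  have sum: "sum f X \<in> Ext v" if "\<And>x. x \<in> X \<Longrightarrow> f x \<in> Ext v" for f :: "nat set \<Rightarrow> 'a ext" and X
    using that by (induction X rule: infinite_finite_induct) (auto simp: Ext_add, auto simp: Ext_def)
  then show ?thesis
    unfolding ext_gen_mult[OF finite_keys order_refl]
    using assms by (intro sum Ext_single) (auto simp: Ext_def)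
qed

lemma Hom_E_simps [simp]:
  "zero (Hom_E v M D) = (\<lambda>e\<in>Ext v. \<zero>\<^bsub>M\<^esub>)"
  by (simp add: Hom_E_def)

lemma Hom_E_iff:
  "\<alpha> \<in> carrier (Hom_E v M D) \<longleftrightarrow> \<alpha> \<in> extensional (Ext v) \<and> (\<forall>e\<in>Ext v. \<alpha> e \<in> D) \<and>
     (\<forall>e\<in>Ext v. \<forall>f\<in>Ext v. \<alpha> (e + f) = \<alpha> e \<oplus>\<^bsub>M\<^esub> \<alpha> f) \<and>
     (\<forall>c. \<forall>e\<in>Ext v. \<alpha> (ext_scale c e) = const c \<odot>\<^bsub>M\<^esub> \<alpha> e)"
  by (auto simp: Hom_E_def PiE_iff)

definition from_cochain :: "nat \<Rightarrow> ('k::field pol, 'm) module \<Rightarrow> (nat set \<Rightarrow> 'm) \<Rightarrow> 'k ext \<Rightarrow> 'm" where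
  "from_cochain v M c = (\<lambda>e\<in>Ext v. \<Oplus>\<^bsub>M\<^esub>A\<in>Pow {..<v}. const (lookup e A) \<odot>\<^bsub>M\<^esub> c A)"

definition to_cochain :: "('k::field ext \<Rightarrow> 'm) \<Rightarrow> nat set \<Rightarrow> 'm" where
  "to_cochain \<alpha> A = \<alpha> (single A 1)"

context graded_pieces
begin

lemma Hom_E_subset: "D \<subseteq> carrier M \<Longrightarrow> carrier (Hom_E v M D) \<subseteq> carrier (Hom_E v M (carrier M))"
  unfolding Hom_E_iff subset_iff by blast

lemma to_cochain: "\<alpha> \<in> carrier (Hom_E v M D) \<Longrightarrow> to_cochain \<alpha> \<in> cochains v D"
  by (auto simp: cochains_def to_cochain_def Hom_E_iff Ext_single)

lemma Hom_E_zero: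
  assumes \<alpha>: "\<alpha> \<in> carrier (Hom_E v M (carrier M))"
  shows "\<alpha> 0 = \<zero>"
proof -
  have 0: "0 \<in> Ext v" by (simp add: Ext_def)
  have "ext_scale 0 0 = (0 :: 'k ext)" by (rule poly_mapping_eqI) (simp add: lookup_ext_scale)
  then have "\<alpha> 0 = const 0 \<odot> \<alpha> 0" using \<alpha> 0 by (metis Hom_E_iff)
  moreover have "\<alpha> 0 \<in> carrier M" using \<alpha> 0 unfolding Hom_E_iff by blast
  ultimately show ?thesis using smult_l_null[of "\<alpha> 0"] by simp
qed

text \<open>Induction on a set of basis elements that contains the support of \<open>e\<close>, splitting off one basis
  element at a time.\<close>

lemma Hom_E_expand:
  assumes \<alpha>: "\<alpha> \<in> carrier (Hom_E v M (carrier M))" and e: "e \<in> Ext v"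
  shows "\<alpha> e = (\<Oplus>A\<in>Pow {..<v}. const (lookup e A) \<odot> to_cochain \<alpha> A)"
proof -
  have c: "to_cochain \<alpha> A \<in> carrier M" if "A \<subseteq> {..<v}" for A
    using to_cochain[OF \<alpha>] that by (simp add: cochains_def)
  have "\<alpha> e = (\<Oplus>A\<in>X. const (lookup e A) \<odot> to_cochain \<alpha> A)"
    if "finite X" "X \<subseteq> Pow {..<v}" "keys e \<subseteq> X" for X e
    using that
  proof (induction X arbitrary: e rule: finite_induct)
    case empty
    then show ?case using Hom_E_zero[OF \<alpha>] by simp
  next
    case (insert A X)
    define s where "s = single A (lookup e A)"
    have lookup_r: "lookup (e - s) B = (if B = A then 0 else lookup e B)" for B
      by (simp add: s_def lookup_minus lookup_single when_def)
    have keys_r: "keys (e - s) \<subseteq> X"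
      using insert.prems by (auto simp: in_keys_iff lookup_r split: if_splits)
    have Ext: "s \<in> Ext v" "e - s \<in> Ext v"
      using insert.prems keys_r by (auto simp: s_def Ext_def)
    have "\<alpha> e = \<alpha> (s + (e - s))" by simp
    also have "\<dots> = \<alpha> s \<oplus> \<alpha> (e - s)" using \<alpha> Ext unfolding Hom_E_iff by blast
    also have "\<alpha> s = const (lookup e A) \<odot> to_cochain \<alpha> A"
    proof -
      have "s = ext_scale (lookup e A) (single A 1)"
        by (simp add: s_def ext_scale_single)
      moreover have "single A 1 \<in> Ext v" using insert.prems by (auto intro: Ext_single)
      ultimately show ?thesis using \<alpha> unfolding Hom_E_iff to_cochain_def by blast
    qed
    also have "\<alpha> (e - s) = (\<Oplus>B\<in>X. const (lookup (e - s) B) \<odot> to_cochain \<alpha> B)"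
      using insert.IH[OF _ keys_r] insert.prems by auto
    also have "\<dots> = (\<Oplus>B\<in>X. const (lookup e B) \<odot> to_cochain \<alpha> B)"
      by (rule finsum_cong') (use insert c lookup_r in \<open>auto intro!: smult_closed\<close>)
    also have "const (lookup e A) \<odot> to_cochain \<alpha> A \<oplus> \<dots> =
        (\<Oplus>B\<in>insert A X. const (lookup e B) \<odot> to_cochain \<alpha> B)"
      by (rule finsum_insert[symmetric]) (use insert c in \<open>auto intro!: smult_closed\<close>)
    finally show ?case .
  qed
  from this[of "Pow {..<v}" e] e show ?thesis by (simp add: Ext_def)
qed

lemma Hom_E_eqI:
  assumes \<alpha>: "\<alpha> \<in> carrier (Hom_E v M (carrier M))" and \<beta>: "\<beta> \<in> carrier (Hom_E v M (carrier M))"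
    and eq: "\<And>A. A \<subseteq> {..<v} \<Longrightarrow> to_cochain \<alpha> A = to_cochain \<beta> A"
  shows "\<alpha> = \<beta>"
proof (rule ext)
  fix e
  show "\<alpha> e = \<beta> e"
  proof (cases "e \<in> Ext v")
    case True
    show ?thesis unfolding Hom_E_expand[OF \<alpha> True] Hom_E_expand[OF \<beta> True]
      by (rule finsum_cong')
        (use eq to_cochain[OF \<beta>] in \<open>auto simp: cochains_def intro!: smult_closed\<close>)
  next
    case False
    then show ?thesis using \<alpha> \<beta> by (simp add: Hom_E_iff extensional_def)
  qed
qed

lemma from_cochain_Hom:
  assumes c: "c \<in> cochains v (G j)"
  shows "from_cochain v M c \<in> carrier (Hom_E v M (G j))"
proof -
  have cG: "c A \<in> G j" if "A \<subseteq> {..<v}" for A using c that by (simp add: cochains_def)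
  have cc: "c A \<in> carrier M" if "A \<subseteq> {..<v}" for A using cG[OF that] by (rule G_carrier)
  have tc: "const s \<odot> c A \<in> carrier M" if "A \<subseteq> {..<v}" for A s
    using cc that by auto
  have tG: "const s \<odot> c A \<in> G j" if "A \<subseteq> {..<v}" for A s
    using G_smult[OF const_Sym_deg cG[OF that]] by simp
  show ?thesis
    unfolding Hom_E_iff
  proof (intro conjI ballI allI)
    show "from_cochain v M c \<in> extensional (Ext v)" by (simp add: from_cochain_def)
  next
    fix e :: "'k ext" assume e: "e \<in> Ext v"
    show "from_cochain v M c e \<in> G j"
      unfolding from_cochain_def using e tG by (auto intro!: G_finsum)
    fix f :: "'k ext" assume f: "f \<in> Ext v"
    have "(\<Oplus>A\<in>Pow {..<v}. const (lookup (e + f) A) \<odot> c A) =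
        (\<Oplus>A\<in>Pow {..<v}. const (lookup e A) \<odot> c A \<oplus> const (lookup f A) \<odot> c A)"
    proof (rule finsum_cong')
      fix A assume "A \<in> Pow {..<v}"
      then show "const (lookup (e + f) A) \<odot> c A =
          const (lookup e A) \<odot> c A \<oplus> const (lookup f A) \<odot> c A"
        using smult_l_distr[of "const (lookup e A)" "const (lookup f A)" "c A"] cc
        by (simp add: lookup_add const_add)
    qed (use tc in auto)
    also have "\<dots> = (\<Oplus>A\<in>Pow {..<v}. const (lookup e A) \<odot> c A) \<oplus>
        (\<Oplus>A\<in>Pow {..<v}. const (lookup f A) \<odot> c A)"
      using tc by (intro finsum_addf) auto
    finally show "from_cochain v M c (e + f) = from_cochain v M c e \<oplus> from_cochain v M c f"
      using e f by (simp add: from_cochain_def Ext_add)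
  next
    fix s and e :: "'k ext" assume e: "e \<in> Ext v"
    have "const s \<odot> (\<Oplus>A\<in>Pow {..<v}. const (lookup e A) \<odot> c A) =
        (\<Oplus>A\<in>Pow {..<v}. const s \<odot> (const (lookup e A) \<odot> c A))"
      using tc by (intro finsum_smult_ldistr) auto
    also have "\<dots> = (\<Oplus>A\<in>Pow {..<v}. const (lookup (ext_scale s e) A) \<odot> c A)"
    proof (rule finsum_cong')
      fix A assume "A \<in> Pow {..<v}"
      then show "const s \<odot> (const (lookup e A) \<odot> c A) =
          const (lookup (ext_scale s e) A) \<odot> c A"
        using smult_assoc1[of "const s" "const (lookup e A)" "c A"] cc
        by (simp add: lookup_ext_scale const_mult)
    qed (use tc in auto)
    finally show "from_cochain v M c (ext_scale s e) = const s \<odot> from_cochain v M c e"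
      using e by (simp add: from_cochain_def Ext_scale)
  qed
qed

lemma to_cochain_from_cochain:
  assumes c: "c \<in> cochains v (carrier M)" and A: "A \<subseteq> {..<v}"
  shows "to_cochain (from_cochain v M c) A = c A"
proof -
  have cc: "c B \<in> carrier M" if "B \<subseteq> {..<v}" for B using c that by (simp add: cochains_def)
  have "to_cochain (from_cochain v M c) A = (\<Oplus>B\<in>Pow {..<v}. const (lookup (single A 1) B) \<odot> c B)"
    by (simp add: to_cochain_def from_cochain_def Ext_single A)
  also have "\<dots> = (\<Oplus>B\<in>Pow {..<v}. if A = B then c B else \<zero>)"
  proof (rule finsum_cong')
    fix B assume "B \<in> Pow {..<v}"
    then show "const (lookup (single A 1) B) \<odot> c B = (if A = B then c B else \<zero>)"
      using smult_one[of "c B"] smult_l_null[of "c B"] cc by (auto simp: lookup_single when_def)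
  qed (use cc in auto)
  also have "\<dots> = c A" using A cc by (intro finsum_singleton) auto
  finally show ?thesis .
qed

lemma R_diff_term_closed:
  assumes "\<alpha> \<in> carrier (Hom_E v M (carrier M))" "e \<in> Ext v" "i < v"
  shows "var i \<odot> \<alpha> (ext_gen i \<and>\<^sub>E e) \<in> carrier M"
  using assms by (intro smult_closed var_Sym) (auto simp: Hom_E_iff Ext_gen_mult)

lemma R_diff_Hom:
  assumes \<alpha>: "\<alpha> \<in> carrier (Hom_E v M (G j))"
  shows "R_diff v M \<alpha> \<in> carrier (Hom_E v M (G (j + 1)))"
proof -
  have \<alpha>': "\<alpha> \<in> carrier (Hom_E v M (carrier M))"
    using \<alpha> Hom_E_subset[of "G j"] G_carrier by blast
  note tc = R_diff_term_closed[OF \<alpha>']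
  have \<alpha>c: "\<alpha> e \<in> carrier M" if "e \<in> Ext v" for e using \<alpha>' that by (auto simp: Hom_E_iff)
  show ?thesis
    unfolding Hom_E_iff
  proof (intro conjI ballI allI)
    show "R_diff v M \<alpha> \<in> extensional (Ext v)" by (simp add: R_diff_def)
  next
    fix e :: "'k ext" assume e: "e \<in> Ext v"
    have "var i \<odot> \<alpha> (ext_gen i \<and>\<^sub>E e) \<in> G (j + 1)" if "i < v" for i
      using G_smult[OF var_Sym_deg[OF that], of "\<alpha> (ext_gen i \<and>\<^sub>E e)" j] Ext_gen_mult[OF e that] \<alpha>
      by (auto simp: Hom_E_iff add.commute)
    then show "R_diff v M \<alpha> e \<in> G (j + 1)"
      unfolding R_diff_def using e by (auto intro!: G_finsum)
    fix f :: "'k ext" assume f: "f \<in> Ext v"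
    have "(\<Oplus>i\<in>{..<v}. var i \<odot> \<alpha> (ext_gen i \<and>\<^sub>E (e + f))) =
        (\<Oplus>i\<in>{..<v}. var i \<odot> \<alpha> (ext_gen i \<and>\<^sub>E e) \<oplus> var i \<odot> \<alpha> (ext_gen i \<and>\<^sub>E f))"
    proof (rule finsum_cong')
      fix i assume "i \<in> {..<v}"
      then have i: "i < v" by simp
      have "\<alpha> (ext_gen i \<and>\<^sub>E (e + f)) = \<alpha> (ext_gen i \<and>\<^sub>E e) \<oplus> \<alpha> (ext_gen i \<and>\<^sub>E f)"
        using \<alpha> Ext_gen_mult[OF e i] Ext_gen_mult[OF f i] unfolding Hom_E_iff ext_gen_mult_add by blast
      then show "var i \<odot> \<alpha> (ext_gen i \<and>\<^sub>E (e + f)) = var i \<odot> \<alpha> (ext_gen i \<and>\<^sub>E e) \<oplus> var i \<odot> \<alpha> (ext_gen i \<and>\<^sub>E f)"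
        using smult_r_distr[OF var_Sym[OF i] \<alpha>c[OF Ext_gen_mult[OF e i]] \<alpha>c[OF Ext_gen_mult[OF f i]]] by simp
    qed (use tc e f in auto)
    also have "\<dots> = (\<Oplus>i\<in>{..<v}. var i \<odot> \<alpha> (ext_gen i \<and>\<^sub>E e)) \<oplus> (\<Oplus>i\<in>{..<v}. var i \<odot> \<alpha> (ext_gen i \<and>\<^sub>E f))"
      using tc e f by (intro finsum_addf) auto
    finally show "R_diff v M \<alpha> (e + f) = R_diff v M \<alpha> e \<oplus> R_diff v M \<alpha> f"
      using e f by (simp add: R_diff_def Ext_add)
  next
    fix s and e :: "'k ext" assume e: "e \<in> Ext v"
    have "const s \<odot> (\<Oplus>i\<in>{..<v}. var i \<odot> \<alpha> (ext_gen i \<and>\<^sub>E e)) =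
        (\<Oplus>i\<in>{..<v}. const s \<odot> (var i \<odot> \<alpha> (ext_gen i \<and>\<^sub>E e)))"
      using tc e by (intro finsum_smult_ldistr) auto
    also have "\<dots> = (\<Oplus>i\<in>{..<v}. var i \<odot> \<alpha> (ext_gen i \<and>\<^sub>E ext_scale s e))"
    proof (rule finsum_cong')
      fix i assume "i \<in> {..<v}"
      then have i: "i < v" by simp
      let ?x = "\<alpha> (ext_gen i \<and>\<^sub>E e)"
      have x: "?x \<in> carrier M" using \<alpha>c Ext_gen_mult[OF e i] by blast
      have "\<alpha> (ext_gen i \<and>\<^sub>E ext_scale s e) = const s \<odot> ?x"
        using \<alpha> Ext_gen_mult[OF e i] unfolding Hom_E_iff ext_gen_mult_scale by blast
      then show "const s \<odot> (var i \<odot> ?x) = var i \<odot> \<alpha> (ext_gen i \<and>\<^sub>E ext_scale s e)"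
        using smult_assoc1[OF const_Sym var_Sym[OF i] x, of s] smult_assoc1[OF var_Sym[OF i] const_Sym x, of s]
        by (simp add: mult.commute)
    qed (use tc e in \<open>auto simp: Ext_scale\<close>)
    finally show "R_diff v M \<alpha> (ext_scale s e) = const s \<odot> R_diff v M \<alpha> e"
      using e by (simp add: R_diff_def Ext_scale)
  qed
qed

lemma to_cochain_R_diff:
  assumes \<alpha>: "\<alpha> \<in> carrier (Hom_E v M (carrier M))" and A: "A \<subseteq> {..<v}"
  shows "to_cochain (R_diff v M \<alpha>) A = koszul v M (to_cochain \<alpha>) A"
proof -
  have "to_cochain (R_diff v M \<alpha>) A = (\<Oplus>i\<in>{..<v}. var i \<odot> \<alpha> (ext_gen i \<and>\<^sub>E single A 1))"
    by (simp add: to_cochain_def R_diff_def Ext_single A)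
  also have "\<dots> = koszul v M (to_cochain \<alpha>) A"
    unfolding koszul_def
  proof (rule finsum_cong')
    fix i assume "i \<in> {..<v}"
    then have i: "i < v" and iA: "insert i A \<subseteq> {..<v}" using A by auto
    let ?s = "ext_sign {i} A :: 'k"
    have x: "to_cochain \<alpha> (insert i A) \<in> carrier M" using to_cochain[OF \<alpha>] iA by (simp add: cochains_def)
    have "ext_gen i \<and>\<^sub>E single A 1 = ext_scale ?s (single (insert i A) 1)"
      by (simp add: ext_gen_mult_single ext_scale_single)
    then have "\<alpha> (ext_gen i \<and>\<^sub>E single A 1) = const ?s \<odot> to_cochain \<alpha> (insert i A)"
      using \<alpha> Ext_single[OF iA, of "1 :: 'k"] unfolding Hom_E_iff to_cochain_def by auto
    then show "var i \<odot> \<alpha> (ext_gen i \<and>\<^sub>E single A 1) = (const ?s * var i) \<odot> to_cochain \<alpha> (insert i A)"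
      using smult_assoc1[OF var_Sym[OF i] const_Sym x, of ?s] by (simp add: mult.commute)
  qed (use koszul_term_closed[OF module_axioms to_cochain[OF \<alpha>] A] in auto)
  finally show ?thesis .
qed

text \<open>Evaluation on the basis \<open>(e\<^sub>A)\<close> identifies linear maps with cochains and the differentials with
  each other. The inclusion of the image in the kernel is \<open>koszul_koszul\<close>.\<close>

lemma R_exact_iff_koszul_exact:
  "a_kernel (Hom_E v M (G j)) (Hom_E v M (G (j + 1))) (R_diff v M) =
     R_diff v M ` carrier (Hom_E v M (G (j - 1))) \<longleftrightarrow> (\<forall>p. koszul_exact v M G p j)"
  (is "?K = ?I \<longleftrightarrow> _")
proof -
  have K: "\<alpha> \<in> ?K \<longleftrightarrow> \<alpha> \<in> carrier (Hom_E v M (G j)) \<and> R_diff v M \<alpha> = (\<lambda>e\<in>Ext v. \<zero>)" for \<alpha>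
    by (simp add: a_kernel_def kernel_def)
  have Hc: "\<alpha> \<in> carrier (Hom_E v M (carrier M))" if "\<alpha> \<in> carrier (Hom_E v M (G i))" for \<alpha> i
    using that Hom_E_subset[of "G i"] G_carrier by blast
  have zero: "(\<lambda>e\<in>Ext v. \<zero>) \<in> carrier (Hom_E v M (carrier M))"
    by (auto simp: Hom_E_iff Ext_add Ext_scale)
  have to_zero: "to_cochain (\<lambda>e\<in>Ext v. \<zero>) A = \<zero>" if "A \<subseteq> {..<v}" for A
    using that by (simp add: to_cochain_def Ext_single)
  show ?thesis
  proof
    assume KI: "?K = ?I"
    show "\<forall>p. koszul_exact v M G p j"
      unfolding koszul_exact_def
    proof (intro allI ballI impI)
      fix p c assume c: "c \<in> cochains v (G j)"
        and "(\<forall>A\<subseteq>{..<v}. koszul v M c A = \<zero>) \<and> (\<forall>A\<subseteq>{..<v}. p \<le> card A \<longrightarrow> c A = \<zero>)"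
      then have cycle: "\<And>A. A \<subseteq> {..<v} \<Longrightarrow> koszul v M c A = \<zero>" by blast
      let ?\<alpha> = "from_cochain v M c"
      note \<alpha> = from_cochain_Hom[OF c]
      note cc = cochains_carrier[OF c]
      have "R_diff v M ?\<alpha> = (\<lambda>e\<in>Ext v. \<zero>)"
      proof (rule Hom_E_eqI[OF Hc[OF R_diff_Hom[OF \<alpha>]] zero])
        fix A assume A: "A \<subseteq> {..<v}"
        have "to_cochain (R_diff v M ?\<alpha>) A = koszul v M (to_cochain ?\<alpha>) A"
          by (rule to_cochain_R_diff[OF Hc[OF \<alpha>] A])
        also have "\<dots> = koszul v M c A"
          by (rule koszul_cong[OF module_axioms cc _ A]) (rule to_cochain_from_cochain[OF cc])
        finally show "to_cochain (R_diff v M ?\<alpha>) A = to_cochain (\<lambda>e\<in>Ext v. \<zero>) A"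
          using cycle A by (simp add: to_zero)
      qed
      then have "?\<alpha> \<in> ?K" using \<alpha> K by blast
      then obtain \<beta> where \<beta>: "\<beta> \<in> carrier (Hom_E v M (G (j - 1)))" "?\<alpha> = R_diff v M \<beta>"
        using KI by blast
      show "\<exists>b\<in>cochains v (G (j - 1)). \<forall>A\<subseteq>{..<v}. c A = koszul v M b A"
      proof (intro bexI allI impI)
        show "to_cochain \<beta> \<in> cochains v (G (j - 1))" by (rule to_cochain[OF \<beta>(1)])
        fix A assume A: "A \<subseteq> {..<v}"
        show "c A = koszul v M (to_cochain \<beta>) A"
          using to_cochain_from_cochain[OF cc A] to_cochain_R_diff[OF Hc[OF \<beta>(1)] A] \<beta>(2) by simp
      qed
    qed
  next
    assume ex: "\<forall>p. koszul_exact v M G p j"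
    show "?K = ?I"
    proof
      show "?I \<subseteq> ?K"
      proof (rule image_subsetI)
        fix \<beta> assume \<beta>: "\<beta> \<in> carrier (Hom_E v M (G (j - 1)))"
        have D\<beta>: "R_diff v M \<beta> \<in> carrier (Hom_E v M (G j))" using R_diff_Hom[OF \<beta>] by simp
        have bc: "to_cochain \<beta> \<in> cochains v (carrier M)" by (rule to_cochain[OF Hc[OF \<beta>]])
        have "R_diff v M (R_diff v M \<beta>) = (\<lambda>e\<in>Ext v. \<zero>)"
        proof (rule Hom_E_eqI[OF Hc[OF R_diff_Hom[OF D\<beta>]] zero])
          fix A assume A: "A \<subseteq> {..<v}"
          have "to_cochain (R_diff v M (R_diff v M \<beta>)) A = koszul v M (to_cochain (R_diff v M \<beta>)) A"
            by (rule to_cochain_R_diff[OF Hc[OF D\<beta>] A])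
          also have "\<dots> = koszul v M (koszul v M (to_cochain \<beta>)) A"
            by (rule koszul_cong[OF module_axioms _ _ A])
              (auto simp: cochains_def koszul_closed[OF module_axioms bc] to_cochain_R_diff[OF Hc[OF \<beta>]])
          also have "\<dots> = \<zero>" by (rule koszul_koszul[OF module_axioms bc A])
          finally show "to_cochain (R_diff v M (R_diff v M \<beta>)) A = to_cochain (\<lambda>e\<in>Ext v. \<zero>) A"
            using A by (simp add: to_zero)
        qed
        then show "R_diff v M \<beta> \<in> ?K" using D\<beta> K by blast
      qed
      show "?K \<subseteq> ?I"
      proof
        fix \<alpha> assume "\<alpha> \<in> ?K"
        then have \<alpha>: "\<alpha> \<in> carrier (Hom_E v M (G j))" and D\<alpha>: "R_diff v M \<alpha> = (\<lambda>e\<in>Ext v. \<zero>)"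
          using K by blast+
        have cycle: "koszul v M (to_cochain \<alpha>) A = \<zero>" if "A \<subseteq> {..<v}" for A
          using to_cochain_R_diff[OF Hc[OF \<alpha>] that, unfolded D\<alpha> to_zero[OF that]] by (rule sym)
        obtain b where b: "b \<in> cochains v (G (j - 1))"
          and eq: "\<And>A. A \<subseteq> {..<v} \<Longrightarrow> to_cochain \<alpha> A = koszul v M b A"
          using koszul_exact_allD[OF spec[OF ex] to_cochain[OF \<alpha>] cycle] by blast
        let ?\<beta> = "from_cochain v M b"
        note \<beta> = from_cochain_Hom[OF b]
        have "\<alpha> = R_diff v M ?\<beta>"
        proof (rule Hom_E_eqI[OF Hc[OF \<alpha>] Hc[OF R_diff_Hom[OF \<beta>]]])
          fix A assume A: "A \<subseteq> {..<v}"
          have "koszul v M (to_cochain ?\<beta>) A = koszul v M b A"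
            by (rule koszul_cong[OF module_axioms cochains_carrier[OF b] _ A])
              (rule to_cochain_from_cochain[OF cochains_carrier[OF b]])
          then show "to_cochain \<alpha> A = to_cochain (R_diff v M ?\<beta>) A"
            using eq[OF A] to_cochain_R_diff[OF Hc[OF \<beta>] A] by simp
        qed
        then show "\<alpha> \<in> ?I" using \<beta> by blast
      qed
    qed
  qed
qed

end

section \<open>Exactness of a module and of its syzygies\<close>

context graded_pieces
begin

lemma koszul_exact_of_zero:
  assumes "\<And>c A. c \<in> cochains v (G j) \<Longrightarrow> (\<And>A. A \<subseteq> {..<v} \<Longrightarrow> p \<le> card A \<Longrightarrow> c A = \<zero>) \<Longrightarrow>
    A \<subseteq> {..<v} \<Longrightarrow> c A = \<zero>"
  shows "koszul_exact v M G p j"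
  unfolding koszul_exact_def
proof (intro ballI impI)
  fix c assume c: "c \<in> cochains v (G j)"
    and "(\<forall>A\<subseteq>{..<v}. koszul v M c A = \<zero>) \<and> (\<forall>A\<subseteq>{..<v}. p \<le> card A \<longrightarrow> c A = \<zero>)"
  then have c0: "c A = \<zero>" if "A \<subseteq> {..<v}" for A using assms[OF c _ that] by blast
  have "koszul v M (\<lambda>_. \<zero>) A = \<zero>" if "A \<subseteq> {..<v}" for A
    by (rule koszul_zero[OF module_axioms _ _ that]) (simp_all add: cochains_def)
  then show "\<exists>b\<in>cochains v (G (j - 1)). \<forall>A\<subseteq>{..<v}. c A = koszul v M b A"
    using c0 G_zero by (intro bexI[of _ "\<lambda>_. \<zero>"]) (simp_all add: cochains_def)
qed

lemma koszul_exact_trivial: "(\<And>x. x \<in> G j \<Longrightarrow> x = \<zero>) \<Longrightarrow> koszul_exact v M G p j"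
  by (rule koszul_exact_of_zero) (auto dest: cochainsD)

lemma koszul_exact_0: "koszul_exact v M G 0 j"
  by (rule koszul_exact_of_zero) blast

text \<open>Zero values are lifted to zero, so that lifting does not enlarge the support.\<close>

lemma lift_cochain:
  assumes h: "graded_hom v (free_mod v n) (free_gr v n a) M G h"
    and surj: "\<And>j. G j \<subseteq> h ` free_gr v n a j" and c: "c \<in> cochains v (G j)"
  obtains c' where "c' \<in> cochains v (free_gr v n a j)" "\<And>A. A \<subseteq> {..<v} \<Longrightarrow> h (c' A) = c A"
    "\<And>A. c A = \<zero> \<Longrightarrow> c' A = \<zero>\<^bsub>free_mod v n\<^esub>"
proof -
  interpret F: graded_pieces v "free_mod v n :: ('k pol, nat \<Rightarrow> 'k pol) module" "free_gr v n a"
    by (rule graded_pieces_free)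
  have "\<exists>y. (A \<subseteq> {..<v} \<longrightarrow> y \<in> free_gr v n a j \<and> h y = c A) \<and> (c A = \<zero> \<longrightarrow> y = \<zero>\<^bsub>free_mod v n\<^esub>)" for A
  proof (cases "c A = \<zero>")
    case True
    have "h \<zero>\<^bsub>free_mod v n\<^esub> = \<zero>"
      by (rule graded_hom_zero[OF F.abelian_group_axioms abelian_group_axioms h])
    then show ?thesis using True F.G_zero by (intro exI[of _ "\<zero>\<^bsub>free_mod v n\<^esub>"]) simp
  next
    case False
    show ?thesis
    proof (cases "A \<subseteq> {..<v}")
      case True
      then have "c A \<in> h ` free_gr v n a j" using surj cochainsD[OF c] by blast
      then show ?thesis using False by auto
    qed (use False in auto)
  qed
  then obtain c' where c': "\<And>A. (A \<subseteq> {..<v} \<longrightarrow> c' A \<in> free_gr v n a j \<and> h (c' A) = c A) \<and>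
      (c A = \<zero> \<longrightarrow> c' A = \<zero>\<^bsub>free_mod v n\<^esub>)" by metis
  then show thesis by (intro that[of c']) (auto simp: cochains_def)
qed

text \<open>For \<open>j \<le> d\<close> the kernel vanishes in degree \<open>j\<close>. Otherwise a cocycle \<open>c\<close> of the kernel is the
  differential of some \<open>b\<close> with values in the free module. Then \<open>h b\<close> is a cocycle of \<open>G\<close> in degree
  \<open>j - 1 > d\<close>, so \<open>h b\<close> is the differential of some \<open>g\<close>. If \<open>g'\<close> lifts \<open>g\<close>, then \<open>b\<close> minus the
  differential of \<open>g'\<close> has values in the kernel and still has differential \<open>c\<close>.\<close>

lemma koszul_exact_kernel:
  assumes h: "graded_hom v (free_mod v n) (free_gr v n a) M G h" and a: "\<And>k. k < n \<Longrightarrow> a k = d"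
    and surj: "\<And>j. G j \<subseteq> h ` free_gr v n a j"
    and ex: "\<And>p j. j \<noteq> d \<Longrightarrow> koszul_exact v M G p j"
    and inj: "\<And>x. x \<in> free_gr v n a d \<Longrightarrow> h x = \<zero> \<Longrightarrow> x = \<zero>\<^bsub>free_mod v n\<^esub>"
    and j: "j \<noteq> d + 1"
  shows "koszul_exact v (free_mod v n) (\<lambda>j. free_gr v n a j \<inter> {x. h x = \<zero>}) p j"
    (is "koszul_exact v ?F ?N p j")
  unfolding koszul_exact_def
proof (intro ballI impI)
  interpret F: graded_pieces v ?F "free_gr v n a" by (rule graded_pieces_free)
  interpret N: graded_pieces v ?F ?N by (rule F.graded_pieces_kernel[OF module_axioms h])
  note ab = F.abelian_group_axioms abelian_group_axioms
  note hk = graded_hom_koszul[OF F.module_axioms module_axioms h]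
  fix c assume c: "c \<in> cochains v (?N j)"
    and "(\<forall>A\<subseteq>{..<v}. koszul v ?F c A = \<zero>\<^bsub>?F\<^esub>) \<and> (\<forall>A\<subseteq>{..<v}. p \<le> card A \<longrightarrow> c A = \<zero>\<^bsub>?F\<^esub>)"
  then have cycle: "\<And>A. A \<subseteq> {..<v} \<Longrightarrow> koszul v ?F c A = \<zero>\<^bsub>?F\<^esub>" by blast
  have cF: "c \<in> cochains v (free_gr v n a j)" using c by (rule cochains_mono) simp
  show "\<exists>b\<in>cochains v (?N (j - 1)). \<forall>A\<subseteq>{..<v}. c A = koszul v ?F b A"
  proof (cases "j \<le> d")
    case True
    have "x = \<zero>\<^bsub>?F\<^esub>" if x: "x \<in> ?N j" for x
    proof (cases "j = d")
      case False
      have "x k = 0" if "k < n" for k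
        using x that a True False Sym_deg_neg[of "j - a k" "x k" v] by (auto simp: free_gr_def PiE_iff)
      then show ?thesis using x by (auto simp: free_gr_def PiE_iff extensional_def fun_eq_iff)
    qed (use x inj in auto)
    then have "koszul_exact v ?F ?N p j" by (rule N.koszul_exact_trivial)
    then show ?thesis unfolding koszul_exact_def
      using c cycle \<open>(\<forall>A\<subseteq>{..<v}. koszul v ?F c A = \<zero>\<^bsub>?F\<^esub>) \<and> _\<close> by blast
  next
    case False
    obtain b where b: "b \<in> cochains v (free_gr v n a (j - 1))"
      and cb: "\<And>A. A \<subseteq> {..<v} \<Longrightarrow> c A = koszul v ?F b A"
      using koszul_exact_allD[OF koszul_exact_free[of n a d j, OF a] cF cycle] False by auto
    note bc = F.cochains_carrier[OF b]
    have hb: "(\<lambda>A. h (b A)) \<in> cochains v (G (j - 1))"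
      using b graded_homD(4)[OF h] by (simp add: cochains_def)
    have "koszul v M (\<lambda>A. h (b A)) A = \<zero>" if "A \<subseteq> {..<v}" for A
      using hk[OF bc that] cb[OF that] cochainsD[OF c that] by simp
    then obtain g where g: "g \<in> cochains v (G (j - 1 - 1))"
      and hbg: "\<And>A. A \<subseteq> {..<v} \<Longrightarrow> h (b A) = koszul v M g A"
      using koszul_exact_allD[OF ex[of "j - 1"] hb] False j by auto
    obtain g' where g': "g' \<in> cochains v (free_gr v n a (j - 1 - 1))"
      and hg': "\<And>A. A \<subseteq> {..<v} \<Longrightarrow> h (g' A) = g A"
      using lift_cochain[OF h surj g] by metis
    note gc' = F.cochains_carrier[OF g'] and gc = cochains_carrier[OF g]
    have kg': "koszul v ?F g' A \<in> free_gr v n a (j - 1)" if "A \<subseteq> {..<v}" for A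
      using F.koszul_G[OF g' that] by simp
    define y where "y A = b A \<ominus>\<^bsub>?F\<^esub> koszul v ?F g' A" for A
    have "y A \<in> ?N (j - 1)" if A: "A \<subseteq> {..<v}" for A
    proof -
      have "h (y A) = h (b A) \<ominus> h (koszul v ?F g' A)"
        unfolding y_def
        by (rule graded_hom_minus[OF ab h cochainsD[OF bc A] F.G_carrier[OF kg'[OF A]]])
      also have "h (koszul v ?F g' A) = koszul v M (\<lambda>A. h (g' A)) A" by (rule hk[OF gc' A])
      also have "\<dots> = koszul v M g A" by (rule koszul_cong[OF module_axioms gc hg' A])
      also have "h (b A) \<ominus> \<dots> = \<zero>"
        using hbg[OF A] koszul_closed[OF module_axioms gc A] by (simp add: minus_eq_zero_iff)
      finally show ?thesis using F.G_minus[OF cochainsD[OF b A] kg'[OF A]] by (simp add: y_def)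
    qed
    then have y: "y \<in> cochains v (?N (j - 1))" by (simp add: cochains_def)
    have "c A = koszul v ?F y A" if A: "A \<subseteq> {..<v}" for A
    proof -
      have kc: "koszul v ?F g' \<in> cochains v (carrier ?F)"
        using F.G_carrier[OF kg'] by (simp only: cochains_def mem_Collect_eq) blast
      have "koszul v ?F y A = koszul v ?F b A \<ominus>\<^bsub>?F\<^esub> koszul v ?F (koszul v ?F g') A"
        unfolding y_def by (rule koszul_diff[OF F.module_axioms bc kc A])
      also have "koszul v ?F (koszul v ?F g') A = \<zero>\<^bsub>?F\<^esub>" by (rule koszul_koszul[OF F.module_axioms gc' A])
      also have "koszul v ?F b A \<ominus>\<^bsub>?F\<^esub> \<zero>\<^bsub>?F\<^esub> = koszul v ?F b A"
        using koszul_closed[OF F.module_axioms bc A] by (rule F.diff_zero_right)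
      finally show ?thesis using cb[OF A] by simp
    qed
    with y show ?thesis by blast
  qed
qed

text \<open>A lift \<open>c'\<close> of the cocycle \<open>c\<close> has a differential \<open>e\<close> that takes values in the kernel and is a
  cocycle. If \<open>c'\<close> is supported on \<open>|A| \<le> p\<close>, then \<open>e\<close> is supported on \<open>|A| < p\<close>, so \<open>e\<close> is the
  differential of some \<open>b\<close> with values in the kernel. Now \<open>c' - b\<close> is a cocycle of the free module,
  hence a coboundary, and \<open>h\<close> maps it to \<open>c\<close>.\<close>

lemma koszul_exact_from_kernel:
  assumes h: "graded_hom v (free_mod v n) (free_gr v n a) M G h" and a: "\<And>k. k < n \<Longrightarrow> a k = d"
    and surj: "\<And>j. G j \<subseteq> h ` free_gr v n a j"
    and j: "j \<noteq> d"
    and ex: "koszul_exact v (free_mod v n) (\<lambda>j. free_gr v n a j \<inter> {x. h x = \<zero>}) p (j + 1)"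
      (is "koszul_exact v ?F ?N p _")
  shows "koszul_exact v M G (Suc p) j"
  unfolding koszul_exact_def
proof (intro ballI impI)
  interpret F: graded_pieces v ?F "free_gr v n a" by (rule graded_pieces_free)
  interpret N: graded_pieces v ?F ?N by (rule F.graded_pieces_kernel[OF module_axioms h])
  note ab = F.abelian_group_axioms abelian_group_axioms
  note hk = graded_hom_koszul[OF F.module_axioms module_axioms h]
  fix c assume c: "c \<in> cochains v (G j)"
    and "(\<forall>A\<subseteq>{..<v}. koszul v M c A = \<zero>) \<and> (\<forall>A\<subseteq>{..<v}. Suc p \<le> card A \<longrightarrow> c A = \<zero>)"
  then have cycle: "\<And>A. A \<subseteq> {..<v} \<Longrightarrow> koszul v M c A = \<zero>"
    and supp: "\<And>A. A \<subseteq> {..<v} \<Longrightarrow> Suc p \<le> card A \<Longrightarrow> c A = \<zero>" by blast+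
  note cc = cochains_carrier[OF c]
  obtain c' where c': "c' \<in> cochains v (free_gr v n a j)"
    and hc': "\<And>A. A \<subseteq> {..<v} \<Longrightarrow> h (c' A) = c A" and c'0: "\<And>A. c A = \<zero> \<Longrightarrow> c' A = \<zero>\<^bsub>?F\<^esub>"
    using lift_cochain[OF h surj c] by metis
  note cc' = F.cochains_carrier[OF c']
  define e where "e = koszul v ?F c'"
  have e: "e \<in> cochains v (?N (j + 1))"
    unfolding cochains_def
  proof (intro CollectI allI impI)
    fix A :: "nat set" assume A: "A \<subseteq> {..<v}"
    have "h (e A) = koszul v M (\<lambda>A. h (c' A)) A" unfolding e_def by (rule hk[OF cc' A])
    also have "\<dots> = koszul v M c A" by (rule koszul_cong[OF module_axioms cc hc' A])
    finally show "e A \<in> ?N (j + 1)"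
      using cycle[OF A] F.koszul_G[OF c' A] by (simp add: e_def)
  qed
  have e_cycle: "koszul v ?F e A = \<zero>\<^bsub>?F\<^esub>" if "A \<subseteq> {..<v}" for A
    unfolding e_def by (rule koszul_koszul[OF F.module_axioms cc' that])
  have e_supp: "e A = \<zero>\<^bsub>?F\<^esub>" if A: "A \<subseteq> {..<v}" and p: "p \<le> card A" for A
    unfolding e_def
  proof (rule koszul_zero[OF F.module_axioms _ cc' A])
    fix i assume i: "i < v" "i \<notin> A"
    then have "insert i A \<subseteq> {..<v}" "Suc p \<le> card (insert i A)"
      using A p finite_subset[OF A] by auto
    then show "c' (insert i A) = \<zero>\<^bsub>?F\<^esub>" using supp c'0 by blast
  qed
  obtain b where b: "b \<in> cochains v (?N j)" and eb: "\<And>A. A \<subseteq> {..<v} \<Longrightarrow> e A = koszul v ?F b A"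
    using koszul_exactD[OF ex e e_cycle e_supp] by auto
  have bF: "b \<in> cochains v (free_gr v n a j)" using b by (rule cochains_mono) simp
  note bc = F.cochains_carrier[OF bF]
  let ?x = "\<lambda>A. c' A \<ominus>\<^bsub>?F\<^esub> b A"
  have x: "?x \<in> cochains v (free_gr v n a j)"
    using F.G_minus[OF cochainsD[OF c'] cochainsD[OF bF]] by (simp add: cochains_def)
  have "koszul v ?F ?x A = \<zero>\<^bsub>?F\<^esub>" if A: "A \<subseteq> {..<v}" for A
  proof -
    have "koszul v ?F ?x A = koszul v ?F c' A \<ominus>\<^bsub>?F\<^esub> koszul v ?F b A"
      by (rule koszul_diff[OF F.module_axioms cc' bc A])
    also have "\<dots> = \<zero>\<^bsub>?F\<^esub>"
      using eb[OF A] koszul_closed[OF F.module_axioms bc A] F.minus_eq_zero_iff by (simp only: e_def)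
    finally show ?thesis .
  qed
  then obtain y where y: "y \<in> cochains v (free_gr v n a (j - 1))"
    and xy: "\<And>A. A \<subseteq> {..<v} \<Longrightarrow> ?x A = koszul v ?F y A"
    using koszul_exact_allD[OF koszul_exact_free[of n a d j, OF a j] x] by auto
  note yc = F.cochains_carrier[OF y]
  show "\<exists>b\<in>cochains v (G (j - 1)). \<forall>A\<subseteq>{..<v}. c A = koszul v M b A"
  proof (intro bexI allI impI)
    show "(\<lambda>A. h (y A)) \<in> cochains v (G (j - 1))"
      using y graded_homD(4)[OF h] by (simp add: cochains_def)
    fix A :: "nat set" assume A: "A \<subseteq> {..<v}"
    have "koszul v M (\<lambda>A. h (y A)) A = h (?x A)" using hk[OF yc A] xy[OF A] by simp
    also have "\<dots> = h (c' A) \<ominus> h (b A)"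
      by (rule graded_hom_minus[OF ab h cochainsD[OF cc' A] cochainsD[OF bc A]])
    also have "\<dots> = c A"
      using hc'[OF A] cochainsD[OF b A] cochainsD[OF cc A] by (simp add: a_minus_def del: free_mod_simps)
    finally show "c A = koszul v M (\<lambda>A. h (y A)) A" ..
  qed
qed

end

section \<open>Finite-dimensional spaces over the base field\<close>

definition K_subspace :: "('k::field pol, 'm) module \<Rightarrow> 'm set \<Rightarrow> bool" where
  "K_subspace M H \<longleftrightarrow> H \<subseteq> carrier M \<and> \<zero>\<^bsub>M\<^esub> \<in> H \<and> (\<forall>x\<in>H. \<forall>y\<in>H. x \<oplus>\<^bsub>M\<^esub> y \<in> H) \<and>
     (\<forall>c. \<forall>x\<in>H. const c \<odot>\<^bsub>M\<^esub> x \<in> H)"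

definition K_span :: "('k::field pol, 'm) module \<Rightarrow> nat \<Rightarrow> (nat \<Rightarrow> 'm) \<Rightarrow> 'm set" where
  "K_span M n g = range (\<lambda>s. comb M n g (\<lambda>k. const (s k)))"

definition K_independent :: "('k::field pol, 'm) module \<Rightarrow> nat \<Rightarrow> (nat \<Rightarrow> 'm) \<Rightarrow> bool" where
  "K_independent M n g \<longleftrightarrow>
     (\<forall>s. comb M n g (\<lambda>k. const (s k)) = \<zero>\<^bsub>M\<^esub> \<longrightarrow> (\<forall>k<n. s k = 0))"

context
  fixes v and M :: "('k::field pol, 'm) module" (structure)
  assumes M: "Module.module (Sym v) M"
begin

interpretation Module.module "Sym v" M by (fact M)

lemma comb_Suc:
  assumes "\<And>k. k \<le> n \<Longrightarrow> g k \<in> carrier M" "\<And>k. k \<le> n \<Longrightarrow> x k \<in> carrier (Sym v)"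
  shows "comb M (Suc n) g x = x n \<odot> g n \<oplus> comb M n g x"
  unfolding comb_def lessThan_Suc
  by (rule finsum_insert) (use assms in auto)

lemma comb_closed:
  assumes "\<And>k. k < n \<Longrightarrow> g k \<in> carrier M" "\<And>k. k < n \<Longrightarrow> x k \<in> carrier (Sym v)"
  shows "comb M n g x \<in> carrier M"
  unfolding comb_def by (intro finsum_closed) (use assms in auto)

lemma comb_cong:
  assumes "\<And>k. k < n \<Longrightarrow> g k \<in> carrier M" "\<And>k. k < n \<Longrightarrow> x k \<in> carrier (Sym v)"
    and "\<And>k. k < n \<Longrightarrow> g' k = g k" "\<And>k. k < n \<Longrightarrow> x' k = x k"
  shows "comb M n g' x' = comb M n g x"
  unfolding comb_def by (rule finsum_cong') (use assms in auto)

lemma smult_const_minus_one: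
  assumes "y \<in> carrier M"
  shows "const (- 1) \<odot> y = \<ominus> y"
proof -
  have "const (- 1) = \<ominus>\<^bsub>Sym v\<^esub> (1 :: 'k pol)"
    by (rule R.minus_equality[symmetric]) (simp_all add: const_uminus Sym_closed Sym_uminus)
  then show ?thesis using smult_l_minus[of 1 y] smult_one[OF assms] assms by (simp add: Sym_closed)
qed

lemma K_subspace_minus:
  assumes H: "K_subspace M H" and "x \<in> H" "y \<in> H"
  shows "x \<ominus> y \<in> H"
proof -
  have y: "y \<in> carrier M" using H \<open>y \<in> H\<close> by (auto simp: K_subspace_def)
  have "const (- 1) \<odot> y = \<ominus> y" by (rule smult_const_minus_one[OF y])
  then have "\<ominus> y \<in> H" using H \<open>y \<in> H\<close> unfolding K_subspace_def by metis
  then show ?thesis using H \<open>x \<in> H\<close> by (simp add: K_subspace_def a_minus_def)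
qed

lemma K_span_insert:
  assumes g: "\<And>k. k < n \<Longrightarrow> g k \<in> carrier M" and x: "x \<in> carrier M"
  shows "comb M (Suc n) (g(n := x)) (\<lambda>k. const (s k)) = const (s n) \<odot> x \<oplus> comb M n g (\<lambda>k. const (s k))"
proof -
  have "comb M (Suc n) (g(n := x)) (\<lambda>k. const (s k)) =
      const (s n) \<odot> (g(n := x)) n \<oplus> comb M n (g(n := x)) (\<lambda>k. const (s k))"
    by (rule comb_Suc) (use g x in auto)
  also have "comb M n (g(n := x)) (\<lambda>k. const (s k)) = comb M n g (\<lambda>k. const (s k))"
    by (rule comb_cong) (use g in auto)
  finally show ?thesis by (simp only: fun_upd_same)
qed

text \<open>The vectors are processed one after the other; each is dropped if it is in the span of those
  kept so far, and otherwise kept, which preserves independence.\<close>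

lemma K_basis_exists:
  assumes H: "K_subspace M H" and g: "\<And>k. k < n \<Longrightarrow> g k \<in> H"
  shows "\<exists>m b. (\<forall>k<m. b k \<in> H) \<and> K_independent M m b \<and> K_span M n g \<subseteq> K_span M m b"
  using g
proof (induction n)
  case 0
  show ?case by (rule exI[of _ 0], rule exI[of _ g]) (simp add: K_independent_def)
next
  case (Suc n)
  have Hc: "x \<in> carrier M" if "x \<in> H" for x using that H by (auto simp: K_subspace_def)
  obtain m b where b: "\<And>k. k < m \<Longrightarrow> b k \<in> H" and ind: "K_independent M m b"
    and span: "K_span M n g \<subseteq> K_span M m b"
    using Suc.IH Suc.prems by auto
  have bc: "b k \<in> carrier M" if "k < m" for k using b[OF that] Hc by blast
  have gn: "g n \<in> carrier M" using Suc.prems Hc by blast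
  have decomp: "comb M (Suc n) g (\<lambda>k. const (s k)) = const (s n) \<odot> g n \<oplus> comb M n g (\<lambda>k. const (s k))" for s
    by (rule comb_Suc) (use Suc.prems Hc in auto)
  have closed: "comb M m b (\<lambda>k. const (s k)) \<in> carrier M" for s
    by (rule comb_closed) (use bc in auto)
  have spanD: "\<exists>t. comb M n g (\<lambda>k. const (s k)) = comb M m b (\<lambda>k. const (t k))" for s
    using span unfolding K_span_def by blast
  show ?case
  proof (cases "g n \<in> K_span M m b")
    case True
    then obtain u where u: "g n = comb M m b (\<lambda>k. const (u k))" by (auto simp: K_span_def)
    have "K_span M (Suc n) g \<subseteq> K_span M m b"
    proof
      fix x assume "x \<in> K_span M (Suc n) g"
      then obtain s where x: "x = const (s n) \<odot> g n \<oplus> comb M n g (\<lambda>k. const (s k))"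
        using decomp by (auto simp: K_span_def)
      obtain t where t: "comb M n g (\<lambda>k. const (s k)) = comb M m b (\<lambda>k. const (t k))" using spanD by blast
      have first: "const (s n) \<odot> g n = (\<Oplus>k\<in>{..<m}. const (s n) \<odot> (const (u k) \<odot> b k))"
        unfolding u comb_def by (rule finsum_smult_ldistr) (use bc in auto)
      have "x = (\<Oplus>k\<in>{..<m}. const (s n) \<odot> (const (u k) \<odot> b k)) \<oplus> (\<Oplus>k\<in>{..<m}. const (t k) \<odot> b k)"
        unfolding x t first by (simp only: comb_def)
      also have "\<dots> = (\<Oplus>k\<in>{..<m}. const (s n) \<odot> (const (u k) \<odot> b k) \<oplus> const (t k) \<odot> b k)"
        by (rule finsum_addf[symmetric]) (use bc in auto)
      also have "\<dots> = comb M m b (\<lambda>k. const (s n * u k + t k))"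
        unfolding comb_def
      proof (rule finsum_cong')
        fix k assume "k \<in> {..<m}"
        then show "const (s n) \<odot> (const (u k) \<odot> b k) \<oplus> const (t k) \<odot> b k = const (s n * u k + t k) \<odot> b k"
          using bc smult_assoc1[of "const (s n)" "const (u k)" "b k"]
            smult_l_distr[of "const (s n) * const (u k)" "const (t k)" "b k"]
          by (simp add: const_add const_mult Sym_mult)
      qed (use bc in auto)
      finally show "x \<in> K_span M m b" by (auto simp: K_span_def)
    qed
    then show ?thesis using b ind by blast
  next
    case False
    let ?b = "b(m := g n)"
    note ins = K_span_insert[where n = m and g = b and x = "g n", OF bc gn]
    have "K_independent M (Suc m) ?b"
      unfolding K_independent_def
    proof (rule allI, rule impI)
      fix s assume "comb M (Suc m) ?b (\<lambda>k. const (s k)) = \<zero>"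
      then have 0: "const (s m) \<odot> g n \<oplus> comb M m b (\<lambda>k. const (s k)) = \<zero>" by (simp add: ins)
      have sm: "s m = 0"
      proof (rule ccontr)
        assume nz: "s m \<noteq> 0"
        let ?c = "- inverse (s m)"
        let ?y = "comb M m b (\<lambda>k. const (s k))"
        have "?y \<oplus> const (s m) \<odot> g n = \<zero>" using 0 gn closed by (simp add: a_comm)
        then have y: "?y = \<ominus> (const (s m) \<odot> g n)"
          using closed gn by (intro minus_equality[symmetric]) auto
        have "const ?c \<odot> ?y = \<ominus> (const ?c \<odot> (const (s m) \<odot> g n))"
          unfolding y using gn by (simp add: smult_r_minus)
        also have "const ?c \<odot> (const (s m) \<odot> g n) = const (- 1) \<odot> g n"
          using smult_assoc1[of "const ?c" "const (s m)" "g n"] gn nz by (simp flip: const_mult)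
        also have "const (- 1) \<odot> g n = \<ominus> g n" by (rule smult_const_minus_one[OF gn])
        finally have "g n = const ?c \<odot> ?y" using gn by simp
        also have "\<dots> = (\<Oplus>k\<in>{..<m}. const ?c \<odot> (const (s k) \<odot> b k))"
          unfolding comb_def by (rule finsum_smult_ldistr) (use bc in auto)
        also have "\<dots> = comb M m b (\<lambda>k. const (?c * s k))"
          unfolding comb_def
        proof (rule finsum_cong')
          fix k assume "k \<in> {..<m}"
          then show "const ?c \<odot> (const (s k) \<odot> b k) = const (?c * s k) \<odot> b k"
            using bc smult_assoc1[of "const ?c" "const (s k)" "b k"]
            by (simp add: const_mult del: mult_minus_left)
        qed (use bc in auto)
        finally show False using False by (auto simp: K_span_def)
      qed
      then have "comb M m b (\<lambda>k. const (s k)) = \<zero>" using 0 gn closed smult_l_null[OF gn] by simp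
      then have "\<forall>k<m. s k = 0" using ind by (simp add: K_independent_def)
      then show "\<forall>k<Suc m. s k = 0" using sm by (simp add: less_Suc_eq)
    qed
    moreover have "K_span M (Suc n) g \<subseteq> K_span M (Suc m) ?b"
    proof
      fix x assume "x \<in> K_span M (Suc n) g"
      then obtain s where x: "x = const (s n) \<odot> g n \<oplus> comb M n g (\<lambda>k. const (s k))"
        using decomp by (auto simp: K_span_def)
      obtain t where t: "comb M n g (\<lambda>k. const (s k)) = comb M m b (\<lambda>k. const (t k))" using spanD by blast
      have "comb M m b (\<lambda>k. const ((t(m := s n)) k)) = comb M m b (\<lambda>k. const (t k))"
        by (rule comb_cong) (use bc in auto)
      then have "x = comb M (Suc m) ?b (\<lambda>k. const ((t(m := s n)) k))"
        by (simp only: ins x t) simp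
      then show "x \<in> K_span M (Suc m) ?b" unfolding K_span_def by blast
    qed
    moreover have "\<forall>k<Suc m. ?b k \<in> H" using b Suc.prems by (simp add: less_Suc_eq)
    ultimately show ?thesis by blast
  qed
qed

end

text \<open>Gaussian elimination on the coefficient positions in \<open>X\<close>, which determine the elements of \<open>H\<close>:
  if some \<open>h0 \<in> H\<close> has a nonzero coefficient at one position, then \<open>H\<close> is spanned by \<open>h0\<close> together
  with the subspace \<open>H'\<close> of elements that vanish at this position.\<close>

lemma free_mod_subspace_finite_span:
  fixes H :: "(nat \<Rightarrow> 'k::field pol) set"
  assumes "finite X" and H: "K_subspace (free_mod v n) H"
    and inj: "\<And>h. h \<in> H \<Longrightarrow> (\<And>k t. (k, t) \<in> X \<Longrightarrow> k < n \<Longrightarrow> lookup (h k) t = 0) \<Longrightarrow>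
      h = \<zero>\<^bsub>free_mod v n\<^esub>"
  shows "\<exists>m g. (\<forall>k<m. g k \<in> H) \<and> H \<subseteq> K_span (free_mod v n) m g"
  using assms
proof (induction X arbitrary: H rule: finite_induct)
  let ?F = "free_mod v n :: ('k pol, nat \<Rightarrow> 'k pol) module"
  interpret F: Module.module "Sym v" ?F by (rule module_free_mod)
  case empty
  have "H \<subseteq> K_span ?F 0 g" for g
    using empty.prems(2) by (auto simp: K_span_def comb_def simp del: free_mod_simps)
  then show ?case by (intro exI[of _ 0]) blast
next
  let ?F = "free_mod v n :: ('k pol, nat \<Rightarrow> 'k pol) module"
  interpret F: Module.module "Sym v" ?F by (rule module_free_mod)
  case (insert x X)
  obtain k0 t0 where x: "x = (k0, t0)" by (cases x)
  show ?case
  proof (cases "k0 < n \<and> (\<exists>h\<in>H. lookup (h k0) t0 \<noteq> 0)")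
    case False
    have "h = \<zero>\<^bsub>?F\<^esub>" if h: "h \<in> H" and X: "\<And>k t. (k, t) \<in> X \<Longrightarrow> k < n \<Longrightarrow> lookup (h k) t = 0" for h
      by (rule insert.prems(2)[OF h]) (use False X h x in auto)
    from insert.IH[OF insert.prems(1) this] show ?thesis by blast
  next
    case True
    then obtain h0 where k0: "k0 < n" and h0: "h0 \<in> H" and nz: "lookup (h0 k0) t0 \<noteq> 0" by blast
    define H' where "H' = {h \<in> H. lookup (h k0) t0 = 0}"
    have Hc: "h \<in> carrier ?F" if "h \<in> H" for h using that insert.prems(1) by (auto simp: K_subspace_def)
    have H': "K_subspace ?F H'"
      using insert.prems(1) k0 by (auto simp: K_subspace_def H'_def lookup_add lookup_const_mult)
    have inj': "h = \<zero>\<^bsub>?F\<^esub>" if h: "h \<in> H'" and X: "\<And>k t. (k, t) \<in> X \<Longrightarrow> k < n \<Longrightarrow> lookup (h k) t = 0" for h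
      by (rule insert.prems(2)) (use X h x in \<open>auto simp: H'_def\<close>)
    obtain m g where g: "\<And>k. k < m \<Longrightarrow> g k \<in> H'" and span: "H' \<subseteq> K_span ?F m g"
      using insert.IH[OF H' inj'] by blast
    have gc: "g k \<in> carrier ?F" if "k < m" for k using g[OF that] Hc by (auto simp: H'_def)
    have "h \<in> K_span ?F (Suc m) (g(m := h0))" if h: "h \<in> H" for h
    proof -
      define c where "c = lookup (h k0) t0 / lookup (h0 k0) t0"
      have ch0: "const c \<odot>\<^bsub>?F\<^esub> h0 \<in> H" using insert.prems(1) h0 unfolding K_subspace_def by blast
      let ?r = "h \<ominus>\<^bsub>?F\<^esub> const c \<odot>\<^bsub>?F\<^esub> h0"
      have r: "?r \<in> H" by (rule K_subspace_minus[OF F.module_axioms insert.prems(1) h ch0])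
      have h_eq: "h = const c \<odot>\<^bsub>?F\<^esub> h0 \<oplus>\<^bsub>?F\<^esub> ?r"
        using Hc[OF h] Hc[OF ch0] by (simp add: a_minus_def F.a_ac F.r_neg1 F.r_neg del: free_mod_simps)
      have "h k0 = const c * h0 k0 + ?r k0"
        by (subst h_eq) (simp add: k0)
      then have "lookup (h k0) t0 = c * lookup (h0 k0) t0 + lookup (?r k0) t0"
        by (simp only: lookup_add lookup_const_mult)
      then have "?r \<in> H'" using r nz by (simp add: H'_def c_def)
      then obtain s where s: "?r = comb ?F m g (\<lambda>k. const (s k))" using span by (auto simp: K_span_def)
      have "comb ?F (Suc m) (g(m := h0)) (\<lambda>k. const ((s(m := c)) k)) =
          const ((s(m := c)) m) \<odot>\<^bsub>?F\<^esub> h0 \<oplus>\<^bsub>?F\<^esub> comb ?F m g (\<lambda>k. const ((s(m := c)) k))"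
        by (rule K_span_insert[OF F.module_axioms gc Hc[OF h0]])
      also have "comb ?F m g (\<lambda>k. const ((s(m := c)) k)) = comb ?F m g (\<lambda>k. const (s k))"
        by (rule comb_cong[OF F.module_axioms gc]) auto
      also have "const ((s(m := c)) m) \<odot>\<^bsub>?F\<^esub> h0 \<oplus>\<^bsub>?F\<^esub> \<dots> = h"
        using h_eq s by (simp del: free_mod_simps)
      finally have "h = comb ?F (Suc m) (g(m := h0)) (\<lambda>k. const ((s(m := c)) k))" ..
      then show ?thesis unfolding K_span_def by blast
    qed
    moreover have "\<forall>k<Suc m. (g(m := h0)) k \<in> H" using g h0 by (auto simp: less_Suc_eq H'_def)
    ultimately show ?thesis by blast
  qed
qed

lemma (in graded_pieces) G_K_subspace: "K_subspace M (G j)"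
  unfolding K_subspace_def using G_carrier G_zero G_add G_smult[OF const_Sym_deg, of _ j] by auto

text \<open>There are only finitely many monomials of each degree.\<close>

lemma free_gr_finite_span:
  assumes H: "K_subspace (free_mod v n) H" and sub: "H \<subseteq> free_gr v n a j"
  shows "\<exists>m g. (\<forall>k<m. g k \<in> H) \<and> H \<subseteq> K_span (free_mod v n) m g"
proof (rule free_mod_subspace_finite_span[OF _ H])
  let ?T = "\<lambda>k. {t. keys t \<subseteq> {..<v} \<and> int (mon_degree t) = j - a k}"
  show "finite (SIGMA k:{..<n}. ?T k)" using finite_monomials by auto
  fix h assume h: "h \<in> H"
    and 0: "\<And>k t. (k, t) \<in> (SIGMA k:{..<n}. ?T k) \<Longrightarrow> k < n \<Longrightarrow> lookup (h k) t = 0"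
  have hg: "h \<in> free_gr v n a j" using h sub by blast
  have "h k = 0" if k: "k < n" for k
  proof (rule poly_mapping_eqI, simp, rule ccontr)
    fix t assume nz: "lookup (h k) t \<noteq> 0"
    have "h k \<in> Sym_deg v (j - a k)" using hg k by (auto simp: free_gr_def PiE_iff)
    with nz have "t \<in> ?T k" by (auto simp: Sym_deg_def Sym_def in_keys_iff)
    with 0[of k t] k nz show False by simp
  qed
  then show "h = \<zero>\<^bsub>free_mod v n\<^esub>" by (rule free_gr_eq_zeroI[OF hg])
qed

lemma graded_hom_comb:
  assumes MM: "Module.module (Sym v) M" and NN: "Module.module (Sym v) N" and h: "graded_hom v M grM N grN h"
    and g: "\<And>k. k < n \<Longrightarrow> g k \<in> carrier M" and x: "\<And>k. k < n \<Longrightarrow> x k \<in> carrier (Sym v)"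
  shows "h (comb M n g x) = comb N n (\<lambda>k. h (g k)) x"
proof -
  interpret M: Module.module "Sym v" M by fact
  interpret N: Module.module "Sym v" N by fact
  have "h (comb M n g x) = (\<Oplus>\<^bsub>N\<^esub>k\<in>{..<n}. h (x k \<odot>\<^bsub>M\<^esub> g k))"
    unfolding comb_def
    by (rule graded_hom_finsum[OF M.abelian_group_axioms N.abelian_group_axioms h]) (use g x in auto)
  also have "\<dots> = comb N n (\<lambda>k. h (g k)) x"
    unfolding comb_def
    by (rule N.finsum_cong') (use g x graded_homD[OF h] in auto)
  finally show ?thesis .
qed

section \<open>Syzygies of modules with exact Koszul complex\<close>

definition syzygies :: "nat \<Rightarrow> ('k::field pol, 'm) module \<Rightarrow> nat \<Rightarrow> (nat \<Rightarrow> 'm) \<Rightarrow> int \<Rightarrow> int \<Rightarrow> (nat \<Rightarrow> 'k pol) set" where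
  "syzygies v M n g d j = free_gr v n (\<lambda>_. d) j \<inter> {x. comb M n g x = \<zero>\<^bsub>M\<^esub>}"

text \<open>The hypotheses on \<open>M\<^sub>\<ge>\<^sub>d\<close> that are inherited by its syzygies, with \<open>d + 1\<close> in place of \<open>d\<close>.\<close>

definition linear_pieces :: "nat \<Rightarrow> ('k::field pol, 'm) module \<Rightarrow> (int \<Rightarrow> 'm set) \<Rightarrow> int \<Rightarrow> bool" where
  "linear_pieces v M G d \<longleftrightarrow> graded_pieces v M G \<and> (\<forall>j<d. \<forall>x\<in>G j. x = \<zero>\<^bsub>M\<^esub>) \<and>
     (\<exists>m g. (\<forall>k<m. g k \<in> G d) \<and> G d \<subseteq> K_span M m g) \<and> (\<forall>p j. j \<noteq> d \<longrightarrow> koszul_exact v M G p j)"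

lemma Sym_deg_0_const:
  assumes "p \<in> Sym_deg v 0"
  shows "p = const (lookup p 0)"
proof (rule poly_mapping_eqI)
  fix t
  show "lookup p t = lookup (const (lookup p 0)) t"
    using Sym_degD[OF assms, of t] by (auto simp: const_def lookup_single when_def mon_degree_eq_0_iff)
qed

context graded_pieces
begin

text \<open>An element \<open>x\<close> of degree \<open>j + 1 > d\<close>, placed at the empty index set, is a cocycle. That it is a
  coboundary says that \<open>x\<close> is a combination of elements of degree \<open>j\<close> with the variables as
  coefficients. So the image of the free module contains \<open>G j\<close> by induction on \<open>j\<close>.\<close>

lemma cover_generated_degree:
  assumes g: "\<And>k. k < n \<Longrightarrow> g k \<in> G d" and span: "G d \<subseteq> K_span M n g"
    and low: "\<And>j x. j < d \<Longrightarrow> x \<in> G j \<Longrightarrow> x = \<zero>"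
    and ex: "\<And>p j. j > d \<Longrightarrow> koszul_exact v M G p j"
  shows "G j \<subseteq> comb M n g ` free_gr v n (\<lambda>_. d) j"
proof -
  let ?F = "free_mod v n :: ('k pol, nat \<Rightarrow> 'k pol) module"
  interpret F: graded_pieces v ?F "free_gr v n (\<lambda>_. d)" by (rule graded_pieces_free)
  let ?h = "comb M n g"
  have h: "graded_hom v ?F (free_gr v n (\<lambda>_. d)) M G ?h" by (rule comb_hom) (rule g)
  have gc: "g k \<in> carrier M" if "k < n" for k using G_carrier[OF g[OF that]] .
  show ?thesis
  proof (cases "j < d")
    case True
    have "\<zero> \<in> ?h ` free_gr v n (\<lambda>_. d) j"
      using graded_hom_zero[OF F.abelian_group_axioms abelian_group_axioms h] F.G_zero[of j] by (metis imageI)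
    then show ?thesis using low[OF True] by blast
  next
    case False
    then have "d \<le> j" by simp
    then show ?thesis
    proof (induction j rule: int_ge_induct)
      case base
      show ?case
      proof
        fix x assume "x \<in> G d"
        then obtain s where x: "x = comb M n g (\<lambda>k. const (s k))" using span by (auto simp: K_span_def)
        have "comb M n g (\<lambda>k\<in>{..<n}. const (s k)) = comb M n g (\<lambda>k. const (s k))"
          by (rule comb_cong[OF module_axioms gc]) auto
        moreover have "(\<lambda>k\<in>{..<n}. const (s k)) \<in> free_gr v n (\<lambda>_. d) d"
          by (auto simp: free_gr_def)
        ultimately show "x \<in> ?h ` free_gr v n (\<lambda>_. d) d" using x by (metis imageI)
      qed
    next
      case (step j)
      show ?case
      proof
        fix x assume x: "x \<in> G (j + 1)"
        define c where "c A = (if A = {} then x else \<zero>)" for A :: "nat set"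
        have c: "c \<in> cochains v (G (j + 1))" using x G_zero by (simp add: cochains_def c_def)
        have cycle: "koszul v M c A = \<zero>" if "A \<subseteq> {..<v}" for A
          by (rule koszul_zero[OF module_axioms _ cochains_carrier[OF c] that]) (simp add: c_def)
        have ex': "koszul_exact v M G p (j + 1)" for p using ex step.hyps by simp
        obtain b where b: "b \<in> cochains v (G j)" and cb: "\<And>A. A \<subseteq> {..<v} \<Longrightarrow> c A = koszul v M b A"
          using koszul_exact_allD[OF ex' c cycle] by auto
        define y where "y A = (SOME y. y \<in> free_gr v n (\<lambda>_. d) j \<and> ?h y = b A)" for A
        have y: "y A \<in> free_gr v n (\<lambda>_. d) j \<and> ?h (y A) = b A" if "A \<subseteq> {..<v}" for A
        proof -
          from subsetD[OF step.IH cochainsD[OF b that]]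
          obtain z where z: "z \<in> free_gr v n (\<lambda>_. d) j \<and> ?h z = b A" by (auto simp only: image_iff)
          show ?thesis unfolding y_def by (rule someI[where x = z]) (rule z)
        qed
        then have yF: "y \<in> cochains v (free_gr v n (\<lambda>_. d) j)" by (simp add: cochains_def)
        have "?h (koszul v ?F y {}) = koszul v M (\<lambda>A. ?h (y A)) {}"
          by (rule graded_hom_koszul[OF F.module_axioms module_axioms h F.cochains_carrier[OF yF]]) simp
        also have "\<dots> = koszul v M b {}"
          by (rule koszul_cong[OF module_axioms cochains_carrier[OF b]]) (use y in auto)
        also have "\<dots> = x" using cb[of "{}"] by (simp add: c_def)
        finally have "?h (koszul v ?F y {}) = x" .
        moreover have "koszul v ?F y {} \<in> free_gr v n (\<lambda>_. d) (j + 1)"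
          by (rule F.koszul_G[OF yF]) simp
        ultimately show "x \<in> ?h ` free_gr v n (\<lambda>_. d) (j + 1)" by blast
      qed
    qed
  qed
qed

end

text \<open>The cover is given by a \<open>K\<close>-basis of \<open>G d\<close> and not just by generators: independence makes the
  syzygies vanish in degree \<open>d\<close>, where the coefficients are constants.\<close>

lemma linear_pieces_step:
  fixes M :: "('k::field pol, 'm) module"
  assumes "linear_pieces v M G d"
  obtains n g where "\<And>k. k < n \<Longrightarrow> g k \<in> G d"
    "\<And>j. G j \<subseteq> comb M n g ` free_gr v n (\<lambda>_. d) j"
    "linear_pieces v (free_mod v n) (syzygies v M n g d) (d + 1)"
proof -
  interpret graded_pieces v M G using assms by (simp add: linear_pieces_def)
  obtain m0 g0 where "\<And>k. k < m0 \<Longrightarrow> g0 k \<in> G d" and span0: "G d \<subseteq> K_span M m0 g0"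
    using assms by (auto simp: linear_pieces_def)
  then obtain n g where g: "\<And>k. k < n \<Longrightarrow> g k \<in> G d" and ind: "K_independent M n g"
    and span: "K_span M m0 g0 \<subseteq> K_span M n g"
    using K_basis_exists[OF module_axioms G_K_subspace, of m0 g0 d] by auto
  have low: "x = \<zero>\<^bsub>M\<^esub>" if "j < d" "x \<in> G j" for j x
    using assms that by (auto simp: linear_pieces_def)
  have ex: "koszul_exact v M G p j" if "j \<noteq> d" for p j
    using assms that by (auto simp: linear_pieces_def)
  let ?F = "free_mod v n :: ('k pol, nat \<Rightarrow> 'k pol) module"
  interpret F: graded_pieces v ?F "free_gr v n (\<lambda>_. d)" by (rule graded_pieces_free)
  let ?h = "comb M n g" and ?N = "syzygies v M n g d"
  have gc: "g k \<in> carrier M" if "k < n" for k using G_carrier[OF g[OF that]] .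
  have h: "graded_hom v ?F (free_gr v n (\<lambda>_. d)) M G ?h" by (rule comb_hom) (rule g)
  have surj: "G j \<subseteq> ?h ` free_gr v n (\<lambda>_. d) j" for j
    by (rule cover_generated_degree) (use g span0 span low ex in auto)
  have N_eq: "?N = (\<lambda>j. free_gr v n (\<lambda>_. d) j \<inter> {x. ?h x = \<zero>\<^bsub>M\<^esub>})"
    by (rule ext) (simp add: syzygies_def)
  interpret N: graded_pieces v ?F ?N
    unfolding N_eq by (rule F.graded_pieces_kernel[OF module_axioms h])
  have inj: "x = \<zero>\<^bsub>?F\<^esub>" if x: "x \<in> free_gr v n (\<lambda>_. d) d" and hx: "?h x = \<zero>\<^bsub>M\<^esub>" for x
  proof -
    define s where "s k = lookup (x k) 0" for k
    have xk: "x k = const (s k)" if "k < n" for k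
      using x that Sym_deg_0_const[of "x k" v] by (auto simp: free_gr_def PiE_iff s_def)
    have "comb M n g (\<lambda>k. const (s k)) = ?h x"
      by (rule comb_cong[OF module_axioms gc]) (use xk in auto)
    then have "\<forall>k<n. s k = 0" using hx ind unfolding K_independent_def by metis
    then have "x k = 0" if "k < n" for k using xk that by simp
    then show ?thesis by (rule free_gr_eq_zeroI[OF x])
  qed
  have "linear_pieces v ?F ?N (d + 1)"
    unfolding linear_pieces_def
  proof (intro conjI allI impI ballI)
    show "graded_pieces v ?F ?N" by (rule N.graded_pieces_axioms)
  next
    fix j x assume j: "j < d + 1" and x: "x \<in> ?N j"
    show "x = \<zero>\<^bsub>?F\<^esub>"
    proof (cases "j = d")
      case True
      then show ?thesis using inj x by (simp add: syzygies_def)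
    next
      case False
      have "x k = 0" if "k < n" for k
        using x that j False Sym_deg_neg[of "j - d" "x k" v] by (auto simp: syzygies_def free_gr_def PiE_iff)
      then show ?thesis using x by (auto simp: syzygies_def free_gr_def PiE_iff extensional_def fun_eq_iff)
    qed
  next
    show "\<exists>m g'. (\<forall>k<m. g' k \<in> ?N (d + 1)) \<and> ?N (d + 1) \<subseteq> K_span ?F m g'"
    proof (rule free_gr_finite_span[OF N.G_K_subspace])
      show "?N (d + 1) \<subseteq> free_gr v n (\<lambda>_. d) (d + 1)" by (simp add: syzygies_def)
    qed
  next
    fix p j assume "j \<noteq> d + 1"
    then show "koszul_exact v ?F ?N p j"
      unfolding N_eq using koszul_exact_kernel[OF h _ surj ex inj] by simp
  qed
  with g surj show thesis by (rule that)
qed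

lemma finsum_in_image:
  assumes "graded_pieces v N grN" and h: "graded_hom v (free_mod v m) (free_gr v m a') N grN h"
    and f: "f \<in> I \<rightarrow> carrier N" "\<And>i. i \<in> I \<Longrightarrow> f i \<in> h ` carrier (free_mod v m)"
  shows "finsum N f I \<in> h ` carrier (free_mod v m)"
proof -
  interpret N: graded_pieces v N grN by fact
  interpret F: graded_pieces v "free_mod v m" "free_gr v m a'" by (rule graded_pieces_free)
  have "\<exists>y. i \<in> I \<longrightarrow> y \<in> carrier (free_mod v m) \<and> f i = h y" for i using f(2) by blast
  then obtain y where y: "\<And>i. i \<in> I \<Longrightarrow> y i \<in> carrier (free_mod v m) \<and> f i = h (y i)" by metis
  have "finsum N f I = finsum N (\<lambda>i. h (y i)) I"
    by (rule N.finsum_cong') (use y f in \<open>auto intro: graded_homD(1)[OF h]\<close>)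
  also have "\<dots> = h (finsum (free_mod v m) y I)"
    by (rule graded_hom_finsum[OF F.abelian_group_axioms N.abelian_group_axioms h, symmetric]) (use y in auto)
  finally have "finsum N f I = h (finsum (free_mod v m) y I)" .
  moreover have "finsum (free_mod v m) y I \<in> carrier (free_mod v m)"
    by (rule F.finsum_closed) (use y in blast)
  ultimately show ?thesis by blast
qed

lemma graded_hom_zero_on_pieces:
  assumes N: "Module.module (Sym v) N" and h: "graded_hom v (free_mod v n) (free_gr v n a) N grN h"
    and 0: "\<And>j x. x \<in> free_gr v n a j \<Longrightarrow> h x = \<zero>\<^bsub>N\<^esub>" and x: "x \<in> carrier (free_mod v n)"
  shows "h x = \<zero>\<^bsub>N\<^esub>"
proof -
  interpret N: Module.module "Sym v" N by fact
  interpret F: graded_pieces v "free_mod v n" "free_gr v n a" by (rule graded_pieces_free)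
  obtain J where J: "finite J"
    "\<And>J'. finite J' \<Longrightarrow> J \<subseteq> J' \<Longrightarrow> x = finsum (free_mod v n) (\<lambda>j. vec_part n a j x) J'"
    using free_mod_decomp[OF x, where a = a] by metis
  have "h x = h (finsum (free_mod v n) (\<lambda>j. vec_part n a j x) J)" using J(2)[OF J(1) order_refl] by simp
  also have "\<dots> = (\<Oplus>\<^bsub>N\<^esub>j\<in>J. h (vec_part n a j x))"
    by (rule graded_hom_finsum[OF F.abelian_group_axioms N.abelian_group_axioms h])
      (use vec_part_free_gr[OF x] F.G_carrier in blast)
  also have "\<dots> = (\<Oplus>\<^bsub>N\<^esub>j\<in>J. \<zero>\<^bsub>N\<^esub>)"
    by (rule N.finsum_cong') (use 0 vec_part_free_gr[OF x] in auto)
  finally show ?thesis by simp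
qed

lemma graded_hom_comp:
  assumes "graded_hom v L grL M grM f" "graded_hom v M grM N grN h"
  shows "graded_hom v L grL N grN (\<lambda>x. h (f x))"
  using assms unfolding graded_hom_def by (auto simp: Pi_iff) blast

text \<open>Exactness can be checked on homogeneous elements, since a kernel element is the sum of its
  components and these lie in the kernel by independence.\<close>

lemma kernel_eq_image:
  fixes N :: "('k::field pol, 'n) module"
  assumes "graded_pieces v N grN" and h: "graded_hom v (free_mod v n) (free_gr v n a) N grN h"
    and f: "graded_hom v (free_mod v m) (free_gr v m a') (free_mod v n) (\<lambda>j. free_gr v n a j \<inter> {x. h x = \<zero>\<^bsub>N\<^esub>}) f"
    and surj: "\<And>j. free_gr v n a j \<inter> {x. h x = \<zero>\<^bsub>N\<^esub>} \<subseteq> f ` free_gr v m a' j"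
  shows "{x \<in> carrier (free_mod v n). h x = \<zero>\<^bsub>N\<^esub>} = f ` carrier (free_mod v m)"
proof
  interpret N: graded_pieces v N grN by fact
  have f': "graded_hom v (free_mod v m) (free_gr v m a') (free_mod v n) (free_gr v n a) f"
    using f unfolding graded_hom_def by (auto simp del: free_mod_simps)
  show "{x \<in> carrier (free_mod v n). h x = \<zero>\<^bsub>N\<^esub>} \<subseteq> f ` carrier (free_mod v m)"
  proof
    fix x :: "nat \<Rightarrow> 'k pol" assume "x \<in> {x \<in> carrier (free_mod v n). h x = \<zero>\<^bsub>N\<^esub>}"
    then have x: "x \<in> carrier (free_mod v n)" and hx: "h x = \<zero>\<^bsub>N\<^esub>" by auto
    obtain J where J: "finite J"
      "\<And>J'. finite J' \<Longrightarrow> J \<subseteq> J' \<Longrightarrow> x = finsum (free_mod v n) (\<lambda>j. vec_part n a j x) J'"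
      using free_mod_decomp[OF x, where a = a] by metis
    have "vec_part n a j x \<in> f ` carrier (free_mod v m)" for j
      using surj[of j] vec_part_free_gr[OF x] N.kernel_vec_part[OF h x hx] free_gr_subset by blast
    then have "finsum (free_mod v n) (\<lambda>j. vec_part n a j x) J \<in> f ` carrier (free_mod v m)"
      by (intro finsum_in_image[OF graded_pieces_free f']) (use vec_part_free_gr[OF x] free_gr_subset in blast)+
    then show "x \<in> f ` carrier (free_mod v m)" using J(2)[OF J(1) order_refl] by simp
  qed
  show "f ` carrier (free_mod v m) \<subseteq> {x \<in> carrier (free_mod v n). h x = \<zero>\<^bsub>N\<^esub>}"
  proof (rule image_subsetI)
    fix y :: "nat \<Rightarrow> 'k pol" assume y: "y \<in> carrier (free_mod v m)"
    have "h (f y) = \<zero>\<^bsub>N\<^esub>"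
      by (rule graded_hom_zero_on_pieces[OF N.module_axioms graded_hom_comp[OF f' h] _ y])
        (use graded_homD(4)[OF f] in blast)
    then show "f y \<in> {x \<in> carrier (free_mod v n). h x = \<zero>\<^bsub>N\<^esub>}" using graded_homD(1)[OF f y] by simp
  qed
qed

section \<open>From exactness to linear resolutions\<close>

context graded_pieces
begin

lemma trunc_carrier_subset: "carrier (trunc M G d) \<subseteq> carrier M"
proof
  fix x assume "x \<in> carrier (trunc M G d)"
  then obtain f I where x: "x = finsum M f I" "I \<subseteq> {d..}" "\<forall>i\<in>I. f i \<in> G i" by (auto simp: trunc_def)
  then show "x \<in> carrier M" by (auto intro!: finsum_closed intro: G_carrier)
qed

lemma trunc_gr_subset: "trunc_gr M G d j \<subseteq> carrier (trunc M G d)"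
proof
  fix x assume x: "x \<in> trunc_gr M G d j"
  show "x \<in> carrier (trunc M G d)"
  proof (cases "d \<le> j")
    case True
    then have "x \<in> G j" using x by (simp add: trunc_gr_def)
    then have "x = finsum M (\<lambda>_. x) {j}" using G_carrier by simp
    then show ?thesis using True \<open>x \<in> G j\<close>
      unfolding trunc_def by (auto intro!: exI[of _ "\<lambda>_. x"] exI[of _ "{j}"])
  next
    case False
    then have "x = finsum M (\<lambda>_. x) {}" using x by (simp add: trunc_gr_def)
    then show ?thesis unfolding trunc_def by (auto intro!: exI[of _ "\<lambda>_. x"] exI[of _ "{}"])
  qed
qed

lemma trunc_simps [simp]:
  "zero (trunc M G d) = \<zero>" "add (trunc M G d) = add M" "smult (trunc M G d) = smult M"
  by (simp_all add: trunc_def)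

text \<open>Components of degree below \<open>d\<close> have image \<open>0\<close>, which leaves a sum over degrees \<open>\<ge> d\<close> as in the
  definition of the truncation.\<close>

lemma hom_image_trunc:
  assumes h: "graded_hom v (free_mod v n) (free_gr v n a) M (trunc_gr M G d) h"
    and surj: "\<And>j. trunc_gr M G d j \<subseteq> h ` free_gr v n a j"
  shows "h ` carrier (free_mod v n) = carrier (trunc M G d)"
proof
  interpret F: graded_pieces v "free_mod v n :: ('k pol, nat \<Rightarrow> 'k pol) module" "free_gr v n a"
    by (rule graded_pieces_free)
  show "h ` carrier (free_mod v n) \<subseteq> carrier (trunc M G d)"
  proof (rule image_subsetI)
    fix x :: "nat \<Rightarrow> 'k pol" assume x: "x \<in> carrier (free_mod v n)"
    obtain J where J: "finite J"
      "\<And>J'. finite J' \<Longrightarrow> J \<subseteq> J' \<Longrightarrow> x = finsum (free_mod v n) (\<lambda>j. vec_part n a j x) J'"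
      using free_mod_decomp[OF x, where a = a] by metis
    have T: "h (vec_part n a j x) \<in> trunc_gr M G d j" for j
      using graded_homD(4)[OF h] vec_part_free_gr[OF x] by blast
    have c: "h (vec_part n a j x) \<in> carrier M" for j using T trunc_gr_subset trunc_carrier_subset by blast
    have "h x = h (finsum (free_mod v n) (\<lambda>j. vec_part n a j x) J)" using J(2)[OF J(1) order_refl] by simp
    also have "\<dots> = (\<Oplus>j\<in>J. h (vec_part n a j x))"
      by (rule graded_hom_finsum[OF F.abelian_group_axioms abelian_group_axioms h])
        (use vec_part_free_gr[OF x] F.G_carrier in blast)
    also have "\<dots> = (\<Oplus>j\<in>J \<inter> {d..}. h (vec_part n a j x))"
    proof (rule add.finprod_mono_neutral_cong_right)
      have "h (vec_part n a j x) = \<zero>" if "\<not> d \<le> j" for j using T[of j] that by (simp add: trunc_gr_def)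
      then show "h (vec_part n a j x) = \<zero>" if "j \<in> J - J \<inter> {d..}" for j using that by auto
    qed (use J c in auto)
    finally have hx: "h x = (\<Oplus>j\<in>J \<inter> {d..}. h (vec_part n a j x))" .
    have "h (vec_part n a j x) \<in> G j" if "d \<le> j" for j using T[of j] that by (simp add: trunc_gr_def)
    then show "h x \<in> carrier (trunc M G d)"
      unfolding hx trunc_def using J(1)
      by (auto intro!: exI[of _ "\<lambda>j. h (vec_part n a j x)"] exI[of _ "J \<inter> {d..}"])
  qed
  show "carrier (trunc M G d) \<subseteq> h ` carrier (free_mod v n)"
  proof
    fix x assume "x \<in> carrier (trunc M G d)"
    then obtain f I where x: "x = finsum M f I" "I \<subseteq> {d..}" "\<forall>i\<in>I. f i \<in> G i" by (auto simp: trunc_def)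
    have fi: "f i \<in> h ` carrier (free_mod v n)" if "i \<in> I" for i
      using surj[of i] that x free_gr_subset[of v n a i] by (force simp: trunc_gr_def)
    show "x \<in> h ` carrier (free_mod v n)" unfolding x(1)
      by (rule finsum_in_image[OF graded_pieces_trunc h _ fi]) (use x G_carrier in auto)
  qed
qed

lemma image_submodule:
  assumes h: "graded_hom v (free_mod v n) (free_gr v n a) M grM h"
  shows "submodule (h ` carrier (free_mod v n)) (Sym v) M"
proof (rule submoduleI)
  interpret F: Module.module "Sym v" "free_mod v n :: ('k pol, nat \<Rightarrow> 'k pol) module"
    by (rule module_free_mod)
  note ab = F.abelian_group_axioms abelian_group_axioms
  show "h ` carrier (free_mod v n) \<subseteq> carrier M" using graded_homD(1)[OF h] by blast
  show "\<zero> \<in> h ` carrier (free_mod v n)" using graded_hom_zero[OF ab h] F.zero_closed by (metis imageI)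
  show "\<ominus> x \<in> h ` carrier (free_mod v n)" if x: "x \<in> h ` carrier (free_mod v n)" for x
  proof -
    obtain y where "y \<in> carrier (free_mod v n)" "x = h y" using x by blast
    then show ?thesis using graded_hom_a_inv[OF ab h, of y] F.a_inv_closed[of y] by (metis imageI)
  qed
  show "x \<oplus> x' \<in> h ` carrier (free_mod v n)"
    if x: "x \<in> h ` carrier (free_mod v n)" and x': "x' \<in> h ` carrier (free_mod v n)" for x x'
  proof -
    obtain y y' where "y \<in> carrier (free_mod v n)" "x = h y" "y' \<in> carrier (free_mod v n)" "x' = h y'"
      using x x' by blast
    then show ?thesis using graded_homD(2)[OF h, of y y'] F.a_closed[of y y'] by (metis imageI)
  qed
  show "p \<odot> x \<in> h ` carrier (free_mod v n)"
    if p: "p \<in> carrier (Sym v)" and x: "x \<in> h ` carrier (free_mod v n)" for p x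
  proof -
    obtain y where "y \<in> carrier (free_mod v n)" "x = h y" using x by blast
    then show ?thesis using graded_homD(3)[OF h p, of y] F.smult_closed[OF p, of y] by (metis imageI)
  qed
qed

text \<open>The truncation is the image of a free module and therefore a submodule.\<close>

lemma module_trunc:
  assumes h: "graded_hom v (free_mod v n) (free_gr v n a) M grM h"
    and im: "h ` carrier (free_mod v n) = carrier (trunc M G d)"
  shows "Module.module (Sym v) (trunc M G d)"
proof -
  have "trunc M G d = M\<lparr>carrier := h ` carrier (free_mod v n)\<rparr>" unfolding im by (simp add: trunc_def)
  then show ?thesis using submodule.submodule_is_module[OF image_submodule[OF h] module_axioms] by simp
qed

end

text \<open>The resolution is obtained by iterating \<open>linear_pieces_step\<close>. All generators of \<open>F\<^sub>i\<close> have degree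
  \<open>d + i\<close>, so the entries of the matrices are linear forms and have no constant term.\<close>

lemma exact_imp_linear_resolution:
  fixes M :: "('k::field pol, 'm) module"
  assumes "graded_pieces v M gr" and lin: "linear_pieces v M (trunc_gr M gr d) d"
  shows "gen_submodule (Sym v) (trunc M gr d) (gr d) = carrier (trunc M gr d)"
    and "has_linear_resolution v (trunc M gr d) (trunc_gr M gr d)"
proof -
  interpret graded_pieces v M gr by fact
  let ?T = "trunc_gr M gr d" and ?Tr = "trunc M gr d"
  interpret T: graded_pieces v M ?T by (rule graded_pieces_trunc)
  obtain n0 g0 where g0: "\<And>k. k < n0 \<Longrightarrow> g0 k \<in> ?T d"
    and surj0: "\<And>j. ?T j \<subseteq> comb M n0 g0 ` free_gr v n0 (\<lambda>_. d) j"
    and lin0: "linear_pieces v (free_mod v n0) (syzygies v M n0 g0 d) (d + 1)"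
    using linear_pieces_step[OF lin] by metis
  define \<epsilon> where "\<epsilon> = comb M n0 g0"
  have h0: "graded_hom v (free_mod v n0) (free_gr v n0 (\<lambda>_. d)) M ?T \<epsilon>"
    unfolding \<epsilon>_def by (rule T.comb_hom) (rule g0)
  have im0: "\<epsilon> ` carrier (free_mod v n0) = carrier ?Tr"
    by (rule hom_image_trunc[OF h0]) (use surj0 in \<open>simp add: \<epsilon>_def\<close>)
  interpret Tr: Module.module "Sym v" ?Tr by (rule module_trunc[OF h0 im0])
  have g0c: "g0 k \<in> carrier M" if "k < n0" for k using T.G_carrier[OF g0[OF that]] .
  have gr_d: "?T d = gr d" by (simp add: trunc_gr_def)

  show "gen_submodule (Sym v) ?Tr (gr d) = carrier ?Tr"
    unfolding gen_submodule_def
  proof (intro equalityI Inter_greatest Inter_lower)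
    show "carrier ?Tr \<in> {N. submodule N (Sym v) ?Tr \<and> gr d \<subseteq> N}"
      using Tr.carrier_is_submodule trunc_gr_subset[of d d] by (simp add: gr_d)
    fix N assume "N \<in> {N. submodule N (Sym v) ?Tr \<and> gr d \<subseteq> N}"
    then have N: "submodule N (Sym v) ?Tr" and sub: "gr d \<subseteq> N" by auto
    note NE = Tr.submoduleE[OF N]
    have N0: "\<zero>\<^bsub>M\<^esub> \<in> N" using subgroup.one_closed[OF submodule.axioms(1)[OF N]] by simp
    show "carrier ?Tr \<subseteq> N"
    proof
      fix x assume "x \<in> carrier ?Tr"
      then obtain y where y: "y \<in> carrier (free_mod v n0)" and x: "x = \<epsilon> y" using im0 by auto
      have "comb M n0 g0 y \<in> N"
        unfolding comb_def
      proof (rule finsum_in_closed)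
        show "N \<subseteq> carrier M" using NE(1) trunc_carrier_subset by blast
        show "x \<oplus>\<^bsub>M\<^esub> z \<in> N" if "x \<in> N" "z \<in> N" for x z using NE(5)[OF that] by simp
        fix k assume "k \<in> {..<n0}"
        then have "y k \<in> carrier (Sym v)" "g0 k \<in> N" using y g0 sub gr_d by (auto simp: PiE_iff)
        then show "y k \<odot>\<^bsub>M\<^esub> g0 k \<in> N" using NE(4) by simp
      qed (rule N0)
      then show "x \<in> N" by (simp add: x \<epsilon>_def)
    qed
  qed

  \<comment> \<open>A state \<open>(n, Z)\<close> consists of the rank of \<open>F\<^sub>i\<close> and of the graded pieces of the kernel of the map
    that leaves \<open>F\<^sub>i\<close>; \<open>Q\<close> relates it to the next state by a minimal cover of \<open>Z\<close>.\<close>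
  define P where "P i s \<longleftrightarrow> linear_pieces v (free_mod v (fst s)) (snd s) (d + int i + 1) \<and>
      (\<forall>j. snd s j \<subseteq> free_gr v (fst s) (\<lambda>_. d + int i) j) \<and>
      (i = 0 \<longrightarrow> s = (n0, syzygies v M n0 g0 d))" for i and s :: "nat \<times> (int \<Rightarrow> (nat \<Rightarrow> 'k pol) set)"
  define Q where "Q i s s' \<longleftrightarrow> (\<exists>g. (\<forall>k<fst s'. g k \<in> snd s (d + int i + 1)) \<and>
      (\<forall>j. snd s j \<subseteq> comb (free_mod v (fst s)) (fst s') g ` free_gr v (fst s') (\<lambda>_. d + int i + 1) j) \<and>
      snd s' = syzygies v (free_mod v (fst s)) (fst s') g (d + int i + 1))"
    for i and s s' :: "nat \<times> (int \<Rightarrow> (nat \<Rightarrow> 'k pol) set)"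
  have "\<exists>s. P 0 s"
    by (rule exI[of _ "(n0, syzygies v M n0 g0 d)"]) (use lin0 in \<open>auto simp: P_def syzygies_def\<close>)
  moreover have "\<exists>s'. P (Suc i) s' \<and> Q i s s'" if Ps: "P i s" for i s
  proof -
    from Ps have "linear_pieces v (free_mod v (fst s)) (snd s) (d + int i + 1)" by (simp add: P_def)
    then obtain n g where g: "\<And>k. k < n \<Longrightarrow> g k \<in> snd s (d + int i + 1)"
      and surj: "\<And>j. snd s j \<subseteq> comb (free_mod v (fst s)) n g ` free_gr v n (\<lambda>_. d + int i + 1) j"
      and lin: "linear_pieces v (free_mod v n) (syzygies v (free_mod v (fst s)) n g (d + int i + 1)) (d + int i + 1 + 1)"
      by (rule linear_pieces_step) blast
    have "P (Suc i) (n, syzygies v (free_mod v (fst s)) n g (d + int i + 1))"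
      using lin by (auto simp: P_def syzygies_def add_ac)
    moreover have "Q i s (n, syzygies v (free_mod v (fst s)) n g (d + int i + 1))"
      unfolding Q_def using g surj by (intro exI[of _ g]) simp
    ultimately show ?thesis by blast
  qed
  ultimately obtain f where f: "\<And>i. P i (f i)" and fQ: "\<And>i. Q i (f i) (f (Suc i))"
    using dependent_nat_choice[of P Q] by blast
  define b where "b i = fst (f i)" for i
  define Z where "Z i = snd (f i)" for i
  define a where "a i = (\<lambda>_::nat. d + int i)" for i
  have "\<forall>i. \<exists>g. (\<forall>k<b (Suc i). g k \<in> Z i (d + int i + 1)) \<and>
      (\<forall>j. Z i j \<subseteq> comb (free_mod v (b i)) (b (Suc i)) g ` free_gr v (b (Suc i)) (\<lambda>_. d + int i + 1) j) \<and>
      Z (Suc i) = syzygies v (free_mod v (b i)) (b (Suc i)) g (d + int i + 1)"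
    using fQ unfolding Q_def b_def Z_def by blast
  then obtain g where gZ: "\<And>i k. k < b (Suc i) \<Longrightarrow> g i k \<in> Z i (d + int i + 1)"
    and surj: "\<And>i j. Z i j \<subseteq> comb (free_mod v (b i)) (b (Suc i)) (g i) ` free_gr v (b (Suc i)) (\<lambda>_. d + int i + 1) j"
    and ZS: "\<And>i. Z (Suc i) = syzygies v (free_mod v (b i)) (b (Suc i)) (g i) (d + int i + 1)"
    by metis
  define \<phi> where "\<phi> i = comb (free_mod v (b i)) (b (Suc i)) (g i)" for i
  have aS: "a (Suc i) = (\<lambda>_. d + int i + 1)" for i by (simp add: a_def add_ac)
  have b0: "b 0 = n0" and Z0: "Z 0 j = free_gr v (b 0) (a 0) j \<inter> {x. \<epsilon> x = \<zero>\<^bsub>M\<^esub>}" for j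
    using f[of 0] by (auto simp: P_def b_def Z_def a_def syzygies_def \<epsilon>_def)
  have ZS': "Z (Suc i) = (\<lambda>j. free_gr v (b (Suc i)) (a (Suc i)) j \<inter> {x. \<phi> i x = \<zero>\<^bsub>free_mod v (b i)\<^esub>})" for i
    unfolding ZS aS \<phi>_def syzygies_def by (rule refl)
  have Z_sub: "Z i j \<subseteq> free_gr v (b i) (a i) j" for i j
    using f[of i] by (simp add: P_def b_def Z_def a_def)
  have Zp: "graded_pieces v (free_mod v (b i)) (Z i)" for i
    using f[of i] by (simp add: P_def b_def Z_def linear_pieces_def)
  have \<phi>Z: "graded_hom v (free_mod v (b (Suc i))) (free_gr v (b (Suc i)) (a (Suc i))) (free_mod v (b i)) (Z i) (\<phi> i)" for i
    unfolding \<phi>_def by (rule graded_pieces.comb_hom[OF Zp]) (use gZ in \<open>simp add: aS\<close>)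
  have \<phi>: "graded_hom v (free_mod v (b (Suc i))) (free_gr v (b (Suc i)) (a (Suc i)))
      (free_mod v (b i)) (free_gr v (b i) (a i)) (\<phi> i)" for i
    using \<phi>Z[of i] Z_sub[of i] unfolding graded_hom_def by (simp del: free_mod_simps) blast
  have surj': "Z i j \<subseteq> \<phi> i ` free_gr v (b (Suc i)) (a (Suc i)) j" for i j
    using surj[of i j] by (simp add: \<phi>_def aS)
  have g_deg: "g i l k \<in> Sym_deg v 1" if "l < b (Suc i)" "k < b i" for i l k
    using subsetD[OF Z_sub gZ[OF that(1)]] that(2) by (auto simp: free_gr_def PiE_iff a_def)
  have gc: "g i l \<in> carrier (free_mod v (b i))" if "l < b (Suc i)" for i l
    using subsetD[OF Z_sub gZ[OF that]] free_gr_subset by blast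
  have h0': "graded_hom v (free_mod v (b 0)) (free_gr v (b 0) (a 0)) M ?T \<epsilon>"
    using h0 by (simp add: b0 a_def)
  have ker0: "{x \<in> carrier (free_mod v (b 0)). \<epsilon> x = \<zero>\<^bsub>M\<^esub>} = \<phi> 0 ` carrier (free_mod v (b 1))"
    using kernel_eq_image[OF T.graded_pieces_axioms h0', of "b 1" "a 1" "\<phi> 0"] \<phi>Z[of 0] surj'[of 0]
    unfolding Z0[abs_def] by (simp del: free_mod_simps)
  have kerS: "{x \<in> carrier (free_mod v (b (Suc i))). \<phi> i x = \<zero>\<^bsub>free_mod v (b i)\<^esub>} =
      \<phi> (Suc i) ` carrier (free_mod v (b (Suc (Suc i))))" for i
    using kernel_eq_image[OF graded_pieces_free \<phi>[of i], of "b (Suc (Suc i))" "a (Suc (Suc i))" "\<phi> (Suc i)"]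
      \<phi>Z[of "Suc i"] surj'[of "Suc i"]
    unfolding ZS' by (simp del: free_mod_simps)
  have h0_Tr: "graded_hom v (free_mod v (b 0)) (free_gr v (b 0) (a 0)) ?Tr ?T \<epsilon>"
    using h0' im0 unfolding graded_hom_def b0 by (auto simp del: free_mod_simps)
  have minimal: "lookup (\<phi> i x k) 0 = 0"
    if x: "x \<in> carrier (free_mod v (b (Suc i)))" and k: "k < b i" for i x k
  proof -
    interpret F: Module.module "Sym v" "free_mod v (b i) :: ('k pol, nat \<Rightarrow> 'k pol) module"
      by (rule module_free_mod)
    have xl: "x l \<in> carrier (Sym v)" if "l < b (Suc i)" for l using x that by (auto simp: PiE_iff)
    have "\<phi> i x k = (\<Sum>l<b (Suc i). (x l \<odot>\<^bsub>free_mod v (b i)\<^esub> g i l) k)"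
      unfolding \<phi>_def comb_def
      by (rule finsum_free_mod) (use k gc xl F.smult_closed in \<open>auto simp del: free_mod_simps\<close>)
    also have "\<dots> = (\<Sum>l<b (Suc i). x l * g i l k)" using k by simp
    finally have "lookup (\<phi> i x k) 0 = (\<Sum>l<b (Suc i). lookup (x l * g i l k) 0)"
      by (simp add: lookup_sum)
    also have "\<dots> = 0"
    proof (rule sum.neutral, rule ballI)
      fix l assume "l \<in> {..<b (Suc i)}"
      then have "lookup (g i l k) 0 = 0"
        using Sym_degD[OF g_deg[of l i k], of 0] k by auto
      then show "lookup (x l * g i l k) 0 = 0" by (rule lookup_mult_0)
    qed
    finally show ?thesis .
  qed
  have unit: "\<phi> i (unit_vec (b (Suc i)) j) k \<in> Sym_deg v 1" if "j < b (Suc i)" "k < b i" for i j k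
  proof -
    have "comb (free_mod v (b i)) (b (Suc i)) (g i) (unit_vec (b (Suc i)) j) = g i j"
      by (rule graded_pieces.comb_unit_vec[OF Zp that(1)]) (rule gc)
    then show ?thesis using g_deg[OF that] by (simp only: \<phi>_def)
  qed
  have "minimal_free_resolution v ?Tr ?T b a \<epsilon> \<phi>"
    unfolding minimal_free_resolution_def a_kernel_def kernel_def
  proof (intro conjI allI ballI impI)
    show "\<epsilon> ` carrier (free_mod v (b 0)) = carrier ?Tr" unfolding b0 by (rule im0)
    show "{x \<in> carrier (add_monoid (free_mod v (b 0))). \<epsilon> x = \<one>\<^bsub>add_monoid ?Tr\<^esub>} = \<phi> 0 ` carrier (free_mod v (b 1))"
      using ker0 by (simp del: free_mod_simps)
    show "{x \<in> carrier (add_monoid (free_mod v (b (Suc i)))). \<phi> i x = \<one>\<^bsub>add_monoid (free_mod v (b i))\<^esub>} =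
        \<phi> (Suc i) ` carrier (free_mod v (b (Suc (Suc i))))" for i
      using kerS[of i] by (simp del: free_mod_simps)
  qed (use h0_Tr \<phi> minimal in blast)+
  with unit show "has_linear_resolution v ?Tr ?T"
    unfolding has_linear_resolution_def by blast
qed

section \<open>From linear resolutions to exactness\<close>

lemma graded_hom_trunc:
  assumes "graded_pieces v M gr" and "graded_hom v L grL (trunc M gr d) G h"
  shows "graded_hom v L grL M G h"
proof -
  have "h \<in> carrier L \<rightarrow> carrier M"
    using assms(2) graded_pieces.trunc_carrier_subset[OF assms(1), of d] by (auto simp: graded_hom_def)
  with assms(2) show ?thesis by (simp add: graded_hom_def trunc_def)
qed

text \<open>Let \<open>U\<close> be the set of vectors with constant term \<open>0\<close> at all generators of degree \<open>\<noteq> d\<close>. Its image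
  is a submodule that contains \<open>gr d\<close>, hence is everything. If a generator \<open>k\<close> had a degree
  different from \<open>d\<close>, then its image would also be the image of some \<open>y \<in> U\<close>, and the difference of
  \<open>y\<close> and the basis vector would be a kernel element with a nonzero constant term,
  contradicting minimality.\<close>

lemma minimal_resolution_generator_degrees:
  fixes M :: "('k::field pol, 'm) module"
  assumes "graded_pieces v M gr"
    and gen: "gen_submodule (Sym v) (trunc M gr d) (gr d) = carrier (trunc M gr d)"
    and \<epsilon>: "graded_hom v (free_mod v n) (free_gr v n a) (trunc M gr d) (trunc_gr M gr d) \<epsilon>"
    and im: "\<epsilon> ` carrier (free_mod v n) = carrier (trunc M gr d)"
    and ker: "\<And>x k. x \<in> carrier (free_mod v n) \<Longrightarrow> \<epsilon> x = \<zero>\<^bsub>M\<^esub> \<Longrightarrow> k < n \<Longrightarrow> lookup (x k) 0 = 0"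
    and k: "k < n"
  shows "a k = d"
proof (rule ccontr)
  assume ak: "a k \<noteq> d"
  interpret graded_pieces v M gr by fact
  interpret T: graded_pieces v M "trunc_gr M gr d" by (rule graded_pieces_trunc)
  let ?F = "free_mod v n :: ('k pol, nat \<Rightarrow> 'k pol) module" and ?Tr = "trunc M gr d"
  interpret F: Module.module "Sym v" ?F by (rule module_free_mod)
  have \<epsilon>M: "graded_hom v ?F (free_gr v n a) M (trunc_gr M gr d) \<epsilon>"
    by (rule graded_hom_trunc[OF graded_pieces_axioms \<epsilon>])
  interpret Tr: Module.module "Sym v" ?Tr by (rule module_trunc[OF \<epsilon>M im])
  note ab = F.abelian_group_axioms Tr.abelian_group_axioms
  define U where "U = {y \<in> carrier ?F. \<forall>k<n. a k \<noteq> d \<longrightarrow> lookup (y k) 0 = 0}"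
  have "submodule (\<epsilon> ` U) (Sym v) ?Tr"
  proof (rule Tr.submoduleI)
    show "\<epsilon> ` U \<subseteq> carrier ?Tr" using im by (auto simp: U_def)
    have "\<zero>\<^bsub>?F\<^esub> \<in> U" using F.zero_closed by (simp add: U_def)
    then show "\<zero>\<^bsub>?Tr\<^esub> \<in> \<epsilon> ` U" using graded_hom_zero[OF ab \<epsilon>] by (metis imageI)
  next
    fix x assume "x \<in> \<epsilon> ` U"
    then obtain y where y: "y \<in> U" "x = \<epsilon> y" by blast
    then have yc: "y \<in> carrier ?F" by (simp add: U_def)
    have "\<ominus>\<^bsub>?F\<^esub> y \<in> U" using y F.a_inv_closed[OF yc] free_mod_a_inv[OF yc] by (simp add: U_def)
    then show "\<ominus>\<^bsub>?Tr\<^esub> x \<in> \<epsilon> ` U" using graded_hom_a_inv[OF ab \<epsilon> yc] y(2) by (metis imageI)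
  next
    fix x x' assume "x \<in> \<epsilon> ` U" "x' \<in> \<epsilon> ` U"
    then obtain y y' where y: "y \<in> U" "x = \<epsilon> y" "y' \<in> U" "x' = \<epsilon> y'" by blast
    then have yc: "y \<in> carrier ?F" "y' \<in> carrier ?F" by (simp_all add: U_def)
    have "y \<oplus>\<^bsub>?F\<^esub> y' \<in> U" using y F.a_closed[OF yc] by (simp add: U_def lookup_add)
    then show "x \<oplus>\<^bsub>?Tr\<^esub> x' \<in> \<epsilon> ` U" using graded_homD(2)[OF \<epsilon> yc] y(2,4) by (metis imageI)
  next
    fix p :: "'k pol" and x assume p: "p \<in> carrier (Sym v)" and "x \<in> \<epsilon> ` U"
    then obtain y where y: "y \<in> U" "x = \<epsilon> y" by blast
    then have yc: "y \<in> carrier ?F" by (simp add: U_def)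
    have "p \<odot>\<^bsub>?F\<^esub> y \<in> U" using y F.smult_closed[OF p yc] by (simp add: U_def lookup_mult_0)
    then show "p \<odot>\<^bsub>?Tr\<^esub> x \<in> \<epsilon> ` U" using graded_homD(3)[OF \<epsilon> p yc] y(2) by (metis imageI)
  qed
  moreover have "gr d \<subseteq> \<epsilon> ` U"
  proof
    fix x assume x: "x \<in> gr d"
    then have xT: "x \<in> trunc_gr M gr d d" by (simp add: trunc_gr_def)
    then have "x \<in> \<epsilon> ` carrier ?F" unfolding im using trunc_gr_subset by blast
    then obtain y where y: "y \<in> carrier ?F" "x = \<epsilon> y" by blast
    have "\<epsilon> (vec_part n a d y) = x" using T.hom_vec_part[OF \<epsilon>M y(1), of d] xT y(2) by simp
    moreover have "vec_part n a d y \<in> U"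
    proof -
      have "lookup (vec_part n a d y k) 0 = 0" if "k < n" "a k \<noteq> d" for k
        using that by (simp add: vec_part_def lookup_pol_part)
      moreover have "vec_part n a d y \<in> carrier ?F" using vec_part_free_gr[OF y(1)] free_gr_subset by blast
      ultimately show ?thesis by (simp add: U_def)
    qed
    ultimately show "x \<in> \<epsilon> ` U" by blast
  qed
  ultimately have "carrier ?Tr \<subseteq> \<epsilon> ` U" using gen unfolding gen_submodule_def by blast
  then have "\<epsilon> (unit_vec n k) \<in> \<epsilon> ` U" using im unit_vec_closed by blast
  then obtain y where y: "y \<in> U" and eq: "\<epsilon> (unit_vec n k) = \<epsilon> y" by blast
  have yc: "y \<in> carrier ?F" using y by (simp add: U_def)
  have uc: "unit_vec n k \<in> carrier ?F" by (rule unit_vec_closed)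
  have "\<epsilon> (unit_vec n k \<ominus>\<^bsub>?F\<^esub> y) = \<zero>\<^bsub>?Tr\<^esub>"
    using graded_hom_minus[OF ab \<epsilon> uc yc] graded_homD(1)[OF \<epsilon> uc] graded_homD(1)[OF \<epsilon> yc] eq
    by (simp only: Tr.minus_eq_zero_iff)
  then have "lookup ((unit_vec n k \<ominus>\<^bsub>?F\<^esub> y) k) 0 = 0"
    using ker[OF F.minus_closed[OF uc yc] _ k] by simp
  moreover have "(unit_vec n k \<ominus>\<^bsub>?F\<^esub> y) k = 1 - y k"
    using k free_mod_a_inv[OF yc] by (simp add: a_minus_def unit_vec_def)
  moreover have "lookup (y k) 0 = 0" using y k ak by (simp add: U_def)
  ultimately show False by (simp add: lookup_minus)
qed

text \<open>A basis vector of \<open>F\<^sub>i\<^sub>+\<^sub>1\<close> is not in the kernel by minimality, so some entry of its image is a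
  nonzero linear form; comparing degrees, generators of \<open>F\<^sub>i\<close> have degree \<open>d + i\<close> for all \<open>i\<close>. Exactness
  of all syzygy modules is then proved by induction on the support bound \<open>p\<close>, where a step for the
  \<open>i\<close>-th syzygies uses the hypothesis for the next ones.\<close>

lemma linear_resolution_imp_exact:
  fixes M :: "('k::field pol, 'm) module"
  assumes "graded_pieces v M gr"
    and gen: "gen_submodule (Sym v) (trunc M gr d) (gr d) = carrier (trunc M gr d)"
    and res: "has_linear_resolution v (trunc M gr d) (trunc_gr M gr d)"
    and j: "j \<noteq> d"
  shows "koszul_exact v M (trunc_gr M gr d) p j"
proof -
  interpret graded_pieces v M gr by fact
  let ?T = "trunc_gr M gr d" and ?Tr = "trunc M gr d"
  interpret T: graded_pieces v M ?T by (rule graded_pieces_trunc)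
  from res obtain b a \<epsilon> \<phi> where mfr: "minimal_free_resolution v ?Tr ?T b a \<epsilon> \<phi>"
    and linear: "\<And>i j k. j < b (Suc i) \<Longrightarrow> k < b i \<Longrightarrow> \<phi> i (unit_vec (b (Suc i)) j) k \<in> Sym_deg v 1"
    unfolding has_linear_resolution_def by blast
  have \<epsilon>: "graded_hom v (free_mod v (b 0)) (free_gr v (b 0) (a 0)) ?Tr ?T \<epsilon>"
    and \<phi>': "\<forall>i. graded_hom v (free_mod v (b (Suc i))) (free_gr v (b (Suc i)) (a (Suc i)))
          (free_mod v (b i)) (free_gr v (b i) (a i)) (\<phi> i)"
    and im: "\<epsilon> ` carrier (free_mod v (b 0)) = carrier ?Tr"
    and ker0': "a_kernel (free_mod v (b 0)) ?Tr \<epsilon> = \<phi> 0 ` carrier (free_mod v (b 1))"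
    and kerS': "\<forall>i. a_kernel (free_mod v (b (Suc i))) (free_mod v (b i)) (\<phi> i) =
          \<phi> (Suc i) ` carrier (free_mod v (b (Suc (Suc i))))"
    and minimal': "\<forall>i. \<forall>x\<in>carrier (free_mod v (b (Suc i))). \<forall>k<b i. lookup (\<phi> i x k) 0 = 0"
    using mfr unfolding minimal_free_resolution_def by - ((elim conjE, assumption)+)
  note \<phi> = spec[OF \<phi>']
  have minimal: "lookup (\<phi> i x k) 0 = 0"
    if "x \<in> carrier (free_mod v (b (Suc i)))" "k < b i" for i x k
    using minimal' that by blast
  have ker0: "x \<in> carrier (free_mod v (b 0)) \<and> \<epsilon> x = \<zero>\<^bsub>M\<^esub> \<longleftrightarrow> x \<in> \<phi> 0 ` carrier (free_mod v (b 1))" for x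
    unfolding ker0'[symmetric] a_kernel_def kernel_def by simp
  have kerS: "x \<in> carrier (free_mod v (b (Suc i))) \<and> \<phi> i x = \<zero>\<^bsub>free_mod v (b i)\<^esub> \<longleftrightarrow>
      x \<in> \<phi> (Suc i) ` carrier (free_mod v (b (Suc (Suc i))))" for x i
    unfolding spec[OF kerS', of i, symmetric] a_kernel_def kernel_def by simp
  have \<epsilon>M: "graded_hom v (free_mod v (b 0)) (free_gr v (b 0) (a 0)) M ?T \<epsilon>"
    by (rule graded_hom_trunc[OF graded_pieces_axioms \<epsilon>])

  have deg: "a i k = d + int i" if "k < b i" for i k
    using that
  proof (induction i arbitrary: k)
    case 0
    have "a 0 k = d"
    proof (rule minimal_resolution_generator_degrees[OF graded_pieces_axioms gen \<epsilon> im _ 0])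
      fix x k assume "x \<in> carrier (free_mod v (b 0))" "\<epsilon> x = \<zero>\<^bsub>M\<^esub>" and k: "k < b 0"
      then obtain y where "y \<in> carrier (free_mod v (b 1))" "x = \<phi> 0 y" using ker0[of x] by blast
      then show "lookup (x k) 0 = 0" using minimal[of y 0 k] k by simp
    qed
    then show ?case by simp
  next
    case (Suc i)
    let ?u = "unit_vec (b (Suc i)) k :: nat \<Rightarrow> 'k pol"
    have "\<phi> i ?u \<noteq> \<zero>\<^bsub>free_mod v (b i)\<^esub>"
    proof
      assume "\<phi> i ?u = \<zero>\<^bsub>free_mod v (b i)\<^esub>"
      then obtain y where y: "y \<in> carrier (free_mod v (b (Suc (Suc i))))" "?u = \<phi> (Suc i) y"
        using kerS[of ?u i] unit_vec_closed by blast
      have "lookup (?u k) 0 = 0" unfolding y(2) by (rule minimal[OF y(1) Suc.prems])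
      then show False using Suc.prems by (simp add: unit_vec_def)
    qed
    moreover have \<phi>u: "\<phi> i ?u \<in> free_gr v (b i) (a i) (a (Suc i) k)"
      by (rule graded_homD(4)[OF \<phi> unit_vec_free_gr[OF Suc.prems]])
    ultimately obtain l where l: "l < b i" "\<phi> i ?u l \<noteq> 0"
      using free_gr_eq_zeroI by blast
    have "\<phi> i ?u l \<in> Sym_deg v (a (Suc i) k - a i l)" using \<phi>u l by (auto simp: free_gr_def PiE_iff)
    then have "a (Suc i) k - a i l = 1" by (rule Sym_deg_unique[OF _ linear[OF Suc.prems l(1)] l(2)])
    then show ?case using Suc.IH[OF l(1)] by simp
  qed

  define N where "N i j = free_gr v (b i) (a i) j \<inter>
      (case i of 0 \<Rightarrow> {x. \<epsilon> x = \<zero>\<^bsub>M\<^esub>} | Suc i' \<Rightarrow> {x. \<phi> i' x = \<zero>\<^bsub>free_mod v (b i')\<^esub>})" for i j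
  have N0: "N 0 = (\<lambda>j. free_gr v (b 0) (a 0) j \<inter> {x. \<epsilon> x = \<zero>\<^bsub>M\<^esub>})"
    and NS: "N (Suc i) = (\<lambda>j. free_gr v (b (Suc i)) (a (Suc i)) j \<inter> {x. \<phi> i x = \<zero>\<^bsub>free_mod v (b i)\<^esub>})" for i
    by (rule ext, simp only: N_def nat.case)+
  have N_image: "x \<in> \<phi> i ` carrier (free_mod v (b (Suc i)))" if "x \<in> N i j" for x i j
  proof (cases i)
    case 0
    then show ?thesis using that ker0[of x] free_gr_subset[of v "b 0" "a 0" j] by (auto simp: N0 simp del: free_mod_simps)
  next
    case (Suc i')
    then show ?thesis using that kerS[of x i'] free_gr_subset[of v "b i" "a i" j] by (auto simp: NS simp del: free_mod_simps)
  qed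
  have image_N: "\<phi> i y \<in> N i j" if "y \<in> free_gr v (b (Suc i)) (a (Suc i)) j" for y i j
  proof -
    have "\<phi> i y \<in> free_gr v (b i) (a i) j" by (rule graded_homD(4)[OF \<phi> that])
    moreover have "y \<in> carrier (free_mod v (b (Suc i)))" using that free_gr_subset by blast
    ultimately show ?thesis using ker0[of "\<phi> i y"] kerS[of "\<phi> i y"]
      by (cases i) (auto simp: N0 NS simp del: free_mod_simps)
  qed
  have Np: "graded_pieces v (free_mod v (b i)) (N i)" for i
    by (cases i) (simp_all only: N0 NS graded_pieces.graded_pieces_kernel[OF graded_pieces_free module_axioms \<epsilon>M]
        graded_pieces.graded_pieces_kernel[OF graded_pieces_free module_free_mod \<phi>])
  have \<phi>N: "graded_hom v (free_mod v (b (Suc i))) (free_gr v (b (Suc i)) (a (Suc i))) (free_mod v (b i)) (N i) (\<phi> i)" for i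
    using \<phi>[of i] image_N[of _ i] unfolding graded_hom_def by (simp add: image_subset_iff del: free_mod_simps)
  have surj: "N i j \<subseteq> \<phi> i ` free_gr v (b (Suc i)) (a (Suc i)) j" for i j
  proof
    fix x assume x: "x \<in> N i j"
    obtain y where y: "y \<in> carrier (free_mod v (b (Suc i)))" "x = \<phi> i y" using N_image[OF x] by blast
    have "\<phi> i y \<in> free_gr v (b i) (a i) j" using x y(2) by (simp add: N_def)
    then have "\<phi> i (vec_part (b (Suc i)) (a (Suc i)) j y) = x"
      using graded_pieces.hom_vec_part[OF graded_pieces_free \<phi> y(1)] y(2) by blast
    then show "x \<in> \<phi> i ` free_gr v (b (Suc i)) (a (Suc i)) j" using vec_part_free_gr[OF y(1)] by blast
  qed
  have exact: "koszul_exact v (free_mod v (b i)) (N i) p j" if "j \<noteq> d + int i + 1" for i p j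
    using that
  proof (induction p arbitrary: i j)
    case 0
    show ?case by (rule graded_pieces.koszul_exact_0[OF Np])
  next
    case (Suc p)
    have "koszul_exact v (free_mod v (b (Suc i))) (N (Suc i)) p (j + 1)"
      by (rule Suc.IH) (use Suc.prems in auto)
    then show ?case
      using graded_pieces.koszul_exact_from_kernel[OF Np \<phi>N, of i "d + int i + 1" j p] surj[of i] deg[of _ "Suc i"] Suc.prems
      unfolding NS by auto
  qed
  show ?thesis
  proof (cases p)
    case 0
    then show ?thesis using T.koszul_exact_0 by simp
  next
    case (Suc q)
    have surj0: "?T j \<subseteq> \<epsilon> ` free_gr v (b 0) (a 0) j" for j
    proof
      fix x assume x: "x \<in> ?T j"
      then have "x \<in> \<epsilon> ` carrier (free_mod v (b 0))" unfolding im using trunc_gr_subset by blast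
      then obtain y where y: "y \<in> carrier (free_mod v (b 0))" "x = \<epsilon> y" by blast
      have "\<epsilon> (vec_part (b 0) (a 0) j y) = x" using T.hom_vec_part[OF \<epsilon>M y(1), of j] x y(2) by simp
      then show "x \<in> \<epsilon> ` free_gr v (b 0) (a 0) j" using vec_part_free_gr[OF y(1)] by blast
    qed
    have "koszul_exact v (free_mod v (b 0)) (N 0) q (j + 1)" by (rule exact) (use j in simp)
    then show ?thesis
      unfolding Suc N0 using T.koszul_exact_from_kernel[OF \<epsilon>M, of d j q] surj0 deg[of _ 0] j by auto
  qed
qed

section \<open>Finite generation\<close>

text \<open>The nonzero homogeneous components of finitely many generators are again generators.\<close>

lemma homogeneous_generators:
  fixes M :: "('k::field pol, 'm) module"
  assumes "graded_module v M gr" and fg: "finitely_generated (Sym v) M"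
  obtains n a g where "\<And>k. k < n \<Longrightarrow> g k \<in> gr (a k)" "comb M n g ` carrier (free_mod v n) = carrier M"
proof -
  interpret graded_module v M gr by fact
  interpret P: graded_pieces v M gr by (rule graded_module_pieces) fact
  obtain A where A: "finite A" "A \<subseteq> carrier M" and gen: "gen_submodule (Sym v) M A = carrier M"
    using fg unfolding finitely_generated_def by blast
  have "\<exists>f. (\<forall>j. f j \<in> gr j) \<and> finite {j. f j \<noteq> \<zero>\<^bsub>M\<^esub>} \<and> x = finsum M f {j. f j \<noteq> \<zero>\<^bsub>M\<^esub>}"
    if "x \<in> carrier M" for x
    using decomp[OF that] by (rule ex1_implies_ex)
  then obtain f where f: "\<And>x. x \<in> carrier M \<Longrightarrow> (\<forall>j. f x j \<in> gr j) \<and>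
      finite {j. f x j \<noteq> \<zero>\<^bsub>M\<^esub>} \<and> x = finsum M (f x) {j. f x j \<noteq> \<zero>\<^bsub>M\<^esub>}" by metis
  define B where "B = (SIGMA x:A. {j. f x j \<noteq> \<zero>\<^bsub>M\<^esub>})"
  have "finite B" unfolding B_def using A f by (intro finite_SigmaI) auto
  then obtain e where e: "bij_betw e {..<card B} B" 
    using ex_bij_betw_nat_finite by (metis atLeast0LessThan)
  define g where "g k = f (fst (e k)) (snd (e k))" for k
  define a where "a k = snd (e k)" for k
  have ga: "g k \<in> gr (a k)" if "k < card B" for k
  proof -
    have "e k \<in> B" using e that by (auto simp: bij_betw_def)
    then have "fst (e k) \<in> carrier M" using A by (auto simp: B_def)
    then show ?thesis using f by (simp add: g_def a_def)
  qed
  have gc: "g k \<in> carrier M" if "k < card B" for k using P.G_carrier[OF ga[OF that]] .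
  let ?h = "comb M (card B) g" and ?F = "free_mod v (card B) :: ('k pol, nat \<Rightarrow> 'k pol) module"
  have h: "graded_hom v ?F (free_gr v (card B) a) M gr ?h" by (rule P.comb_hom) (rule ga)
  note sub = P.image_submodule[OF h]
  have "A \<subseteq> ?h ` carrier ?F"
  proof
    fix x assume x: "x \<in> A"
    then have xc: "x \<in> carrier M" using A by blast
    have in_image: "f x j \<in> ?h ` carrier ?F" if "f x j \<noteq> \<zero>\<^bsub>M\<^esub>" for j
    proof -
      have "(x, j) \<in> B" using x that by (simp add: B_def)
      then obtain k where k: "k < card B" "e k = (x, j)" using e by (force simp: bij_betw_def)
      have "?h (unit_vec (card B) k) = g k"
        by (rule P.comb_unit_vec[OF k(1)]) (rule gc)
      then have "?h (unit_vec (card B) k) = f x j" using k(2) by (simp add: g_def)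
      then show ?thesis using unit_vec_closed[of "card B" k v] by (metis imageI)
    qed
    have "finsum M (f x) {j. f x j \<noteq> \<zero>\<^bsub>M\<^esub>} \<in> ?h ` carrier ?F"
      by (rule finsum_in_image[OF P.graded_pieces_axioms h]) (use f[OF xc] P.G_carrier in_image in blast)+
    then show "x \<in> ?h ` carrier ?F" using f[OF xc] by simp
  qed
  then have "carrier M \<subseteq> ?h ` carrier ?F"
    using sub unfolding gen[symmetric] gen_submodule_def by blast
  moreover have "?h ` carrier ?F \<subseteq> carrier M" using graded_homD(1)[OF h] by blast
  ultimately show thesis using that[of "card B" g a] ga by blast
qed

text \<open>By homogeneity, \<open>gr d\<close> is the image of the component of degree \<open>d\<close> of a free module of finite
  rank.\<close>

lemma finitely_generated_degree_span:
  fixes M :: "('k::field pol, 'm) module"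
  assumes "graded_module v M gr" and fg: "finitely_generated (Sym v) M"
  shows "\<exists>m u. (\<forall>l<m. u l \<in> gr d) \<and> gr d \<subseteq> K_span M m u"
proof -
  interpret graded_pieces v M gr by (rule graded_module_pieces) fact
  obtain n a g where g: "\<And>k. k < n \<Longrightarrow> g k \<in> gr (a k)"
    and im: "comb M n g ` carrier (free_mod v n) = carrier M"
    using homogeneous_generators[OF assms] by metis
  let ?h = "comb M n g" and ?F = "free_mod v n :: ('k pol, nat \<Rightarrow> 'k pol) module"
  interpret F: graded_pieces v ?F "free_gr v n a" by (rule graded_pieces_free)
  have h: "graded_hom v ?F (free_gr v n a) M gr ?h" by (rule comb_hom) (rule g)
  obtain m u where u: "\<And>l. l < m \<Longrightarrow> u l \<in> free_gr v n a d" and span: "free_gr v n a d \<subseteq> K_span ?F m u"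
    using free_gr_finite_span[OF F.G_K_subspace order_refl] by blast
  have uc: "u l \<in> carrier ?F" if "l < m" for l using F.G_carrier[OF u[OF that]] .
  have "gr d \<subseteq> K_span M m (\<lambda>l. ?h (u l))"
  proof
    fix x assume x: "x \<in> gr d"
    obtain y where y: "y \<in> carrier ?F" "x = ?h y" using im G_carrier[OF x] by blast
    have "x = ?h (vec_part n a d y)" using hom_vec_part[OF h y(1), of d] x y(2) by simp
    moreover obtain s where "vec_part n a d y = comb ?F m u (\<lambda>l. const (s l))"
      using span vec_part_free_gr[OF y(1), of a d] by (auto simp: K_span_def)
    ultimately have "x = ?h (comb ?F m u (\<lambda>l. const (s l)))" by simp
    also have "\<dots> = comb M m (\<lambda>l. ?h (u l)) (\<lambda>l. const (s l))"
      by (rule graded_hom_comb[OF F.module_axioms module_axioms h uc]) simp_all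
    finally show "x \<in> K_span M m (\<lambda>l. ?h (u l))" by (simp add: K_span_def)
  qed
  moreover have "?h (u l) \<in> gr d" if "l < m" for l by (rule graded_homD(4)[OF h u[OF that]])
  ultimately show ?thesis by (intro exI[of _ m] exI[of _ "\<lambda>l. ?h (u l)"]) blast
qed

section \<open>Regularity and acyclicity\<close>

theorem corollary2p4:
  fixes v :: nat and M :: "('k::field pol, 'm) module" and gr :: "int \<Rightarrow> 'm set" and d :: int
  assumes "graded_module v M gr" and "finitely_generated (Sym v) M"
  shows "R_trunc_acyclic v M gr d \<longleftrightarrow> is_regular v M gr d"
proof -
  interpret graded_pieces v M gr by (rule graded_module_pieces) fact
  \<comment> \<open>\<open>E r\<close> says that \<open>\<^bold>R(M)\<^sub>\<ge>\<^sub>r\<close> is acyclic, and \<open>L r\<close> is the condition in the definition of the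
    regularity.\<close>
  define E where "E r \<longleftrightarrow> (\<forall>j p. j \<noteq> r \<longrightarrow> koszul_exact v M (trunc_gr M gr r) p j)" for r
  define L where "L r \<longleftrightarrow> gen_submodule (Sym v) (trunc M gr r) (gr r) = carrier (trunc M gr r) \<and>
      has_linear_resolution v (trunc M gr r) (trunc_gr M gr r)" for r
  have low: "x = \<zero>\<^bsub>M\<^esub>" if "j < r" "x \<in> trunc_gr M gr r j" for j r x
    using that by (simp add: trunc_gr_def)
  have acyclic: "R_trunc_acyclic v M gr d \<longleftrightarrow> E d"
  proof -
    interpret T: graded_pieces v M "trunc_gr M gr d" by (rule graded_pieces_trunc)
    have "R_trunc v M gr d j = Hom_E v M (trunc_gr M gr d j)" for j
      by (simp add: R_trunc_def trunc_gr_def)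
    then show ?thesis
      unfolding R_trunc_acyclic_def E_def using T.R_exact_iff_koszul_exact by simp
  qed
  have E_mono: "E d" if E: "E r" and "r \<le> d" for r
    unfolding E_def
  proof (intro allI impI)
    fix j p assume "j \<noteq> d"
    interpret T: graded_pieces v M "trunc_gr M gr d" by (rule graded_pieces_trunc)
    show "koszul_exact v M (trunc_gr M gr d) p j"
    proof (cases "j < d")
      case True
      then show ?thesis by (intro T.koszul_exact_trivial low)
    next
      case False
      then have "trunc_gr M gr d j = trunc_gr M gr r j" "trunc_gr M gr d (j - 1) = trunc_gr M gr r (j - 1)"
        using \<open>j \<noteq> d\<close> \<open>r \<le> d\<close> by (simp_all add: trunc_gr_def)
      moreover have "koszul_exact v M (trunc_gr M gr r) p j"
        using E \<open>j \<noteq> d\<close> \<open>r \<le> d\<close> False by (simp add: E_def)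
      ultimately show ?thesis by (simp add: koszul_exact_def)
    qed
  qed
  have EL: "L d" if E: "E d"
  proof -
    have "linear_pieces v M (trunc_gr M gr d) d"
      unfolding linear_pieces_def
    proof (intro conjI)
      show "graded_pieces v M (trunc_gr M gr d)" by (rule graded_pieces_trunc)
      show "\<exists>m g. (\<forall>k<m. g k \<in> trunc_gr M gr d d) \<and> trunc_gr M gr d d \<subseteq> K_span M m g"
        using finitely_generated_degree_span[OF assms, of d] by (simp add: trunc_gr_def)
    qed (use low E in \<open>auto simp: E_def\<close>)
    then show ?thesis unfolding L_def using exact_imp_linear_resolution[OF graded_pieces_axioms] by blast
  qed
  have LE: "E r" if "L r" for r
    unfolding E_def using linear_resolution_imp_exact[OF graded_pieces_axioms] that by (simp add: L_def)
  have "is_regular v M gr d \<longleftrightarrow> (\<exists>r\<le>d. L r)"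
  proof
    assume reg: "is_regular v M gr d"
    show "\<exists>r\<le>d. L r"
    proof (rule ccontr)
      assume none: "\<not> (\<exists>r\<le>d. L r)"
      \<comment> \<open>The infimum is taken in the extended reals; integers above \<open>d\<close> are at least \<open>d + 1\<close>.\<close>
      have "d + 1 \<le> r" if "L r" for r
      proof -
        have "\<not> r \<le> d" using none that by blast
        then show ?thesis by simp
      qed
      then have "ereal (of_int (d + 1)) \<le> Inf {ereal (of_int r) | r. L r}"
        by (intro Inf_greatest) force
      then have "ereal (of_int (d + 1)) \<le> ereal (of_int d)"
        using reg unfolding is_regular_def regularity_def L_def by (rule order_trans)
      then show False by simp
    qed
  next
    assume "\<exists>r\<le>d. L r"
    then obtain r where r: "r \<le> d" "L r" by blast
    have "regularity v M gr \<le> ereal (of_int r)"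
      unfolding regularity_def by (rule Inf_lower) (use r in \<open>auto simp: L_def\<close>)
    also have "\<dots> \<le> ereal (of_int d)" using r by simp
    finally show "is_regular v M gr d" by (simp add: is_regular_def)
  qed
  then show ?thesis using acyclic E_mono EL LE by blast
qed

end
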